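(* Let $n\ge 1$ and let $\psi:[0,1]\to \mathrm{Sp}(\mathbb{R}^{2n},\Omega_0)$ be a continuous path with $\psi(0)=\mathrm{Id}$ such that $1$ is not an eigenvalue of $\psi(1)$. Let $\widetilde\psi:[0,2]\to \mathrm{Sp}(\mathbb{R}^{2n},\Omega_0)$ be a continuous extension of $\psi$ (i.e. $\widetilde\psi=\psi$ on $[0,1]$) such that $1$ is not an eigenvalue of $\widetilde\psi(s)$ for all $s\ge 1$, and such that either $\widetilde\psi(2)=W^+:=-\mathrm{Id}$ or $\widetilde\psi(2)=W^-:=\mathrm{diag}(2,-1,\ldots,-1,\tfrac12,-1,\ldots,-1)$ (with $2$ in position $1$ and $\tfrac12$ in position $n+1$). Then the Conley-Zehnder index of $\psi$ satisfies $$\mu_{CZ}(\psi)=\deg(\tilde\rho^{\,2}\circ\widetilde\psi)$$ for any continuous map $\tilde\rho:\mathrm{Sp}(\mathbb{R}^{2n},\Omega_0)\to S^1$ with the following properties: 1. $\tilde\rho$ coincides with the complex determinant $\det_{\mathbb C}$ on $U(n)=O(\mathbb{R}^{2n})\cap \mathrm{Sp}(\mathbb{R}^{2n},\Omega_0)$; 2. $\tilde\rho(W^-)\in\{\pm1\}$; 3. $\deg(\tilde\rho^{\,2}\circ\psi_{2-})=n-1$ for the path $$\psi_{2-}:t\in[0,1]\mapsto \exp\left(t\pi J_0\begin{pmatrix}0&0&-\frac{\log 2}{\pi}&0\\ 0&\mathrm{Id}_{n-1}&0&0\\ -\frac{\log 2}{\pi}&0&0&0\\ 0&0&0&\mathrm{Id}_{n-1}\end{pmatrix}\right).$$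 In particular: (a) $\mu_{CZ}(\psi)=\deg\bigl({\det}_{\mathbb C}^2\circ U\circ\widetilde\psi\bigr)$, where $U:\mathrm{Sp}(\mathbb{R}^{2n},\Omega_0)\to U(n)$, $A\mapsto AP^{-1}$, with $P$ the unique symmetric positive definite matrix such that $P^2=A^{\tau}A$ (here $A^\tau$ is the transpose of $A$); (b) $\mu_{CZ}(\psi)=\deg(\hat\rho^{\,2}\circ\widetilde\psi)$, where $\hat\rho:\mathrm{Sp}(\mathbb{R}^{2n},\Omega_0)\to S^1$ is $$\hat\rho(A)=\frac{\det_{\mathbb C}\bigl(\frac12(A-J_0AJ_0)\bigr)}{\bigl|\det_{\mathbb C}\bigl(\frac12(A-J_0AJ_0)\bigr)\bigr|}.$$
   Context: Notation. $\Omega_0=\begin{pmatrix}0&\mathrm{Id}_n\\ -\mathrm{Id}_n&0\end{pmatrix}$, $\Omega_0(v,w)=v^\tau\Omega_0 w$, is the standard symplectic form on $\mathbb{R}^{2n}$; $\mathrm{Sp}(\mathbb{R}^{2n},\Omega_0)$ is the group of real $2n\times 2n$ symplectic matrices; $J_0=\begin{pmatrix}0&-\mathrm{Id}_n\\ \mathrm{Id}_n&0\end{pmatrix}$ is the standard complex structure. Real matrices commuting with $J_0$, i.e. of the form $\begin{pmatrix}X&-Y\\ Y&X\end{pmatrix}$, are identified with complex $n\times n$ matrices $X+iY$, and $\det_{\mathbb C}$ denotes the complex determinant $\det(X+iY)$. In the block matrices the block sizes are $1,n-1,1,n-1$. Degree. For a continuous $f:[a,b]\to S^1$ with $f(a)=f(b)$,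 write $f(t)=e^{2\pi i\theta(t)}$ with $\theta$ continuous; $\deg f:=\theta(b)-\theta(a)\in\mathbb{Z}$. The map $\rho$. For $A\in\mathrm{Sp}(\mathbb{R}^{2n},\Omega_0)$ and an eigenvalue $\lambda\in S^1\setminus\{\pm1\}$ of $A$, let $E_\lambda\subset\mathbb{C}^{2n}$ be the generalized eigenspace and let $m^+(\lambda)$ be the number of positive eigenvalues of the nondegenerate real symmetric bilinear form $Q:E_\lambda\times E_\lambda\to\mathbb{R}$, $Q(z,z')=\mathrm{Im}\,\Omega_0(z,\overline{z'})$ ($\Omega_0$ extended complex bilinearly and $E_\lambda$ viewed as a real vector space). Let $m^-$ be the sum of the algebraic multiplicities of the real negative eigenvalues of $A$. Then $\rho:\mathrm{Sp}(\mathbb{R}^{2n},\Omega_0)\to S^1$ is the continuous map $$\rho(A)=(-1)^{\frac12 m^-}\prod_{\lambda\in S^1\setminus\{\pm1\}}\lambda^{\frac12 m^+(\lambda)},$$ the product being over eigenvalues of $A$. Conley-Zehnder index. For a continuous path $\psi:[0,1]\to\mathrm{Sp}(\mathbb{R}^{2n},\Omega_0)$ with $\psi(0)=\mathrm{Id}$ and $1$ not an eigenvalue of $\psi(1)$, choose any continuous extension $\widetilde\psi:[0,2]\to\mathrm{Sp}(\mathbb{R}^{2n},\Omega_0)$ such that $1$ is not an eigenvalue of $\widetilde\psi(t)$ for $t\ge1$ and $\widetilde\psi(2)\in\{W^+,W^-\}$. Such extensions exist, and $\mu_{CZ}(\psi):=\deg(\rho^2\circ\widetilde\psi)\in\mathbb{Z}$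 is independent of the choice. *)

theory Defs
  imports "HOL-Analysis.Analysis" "HOL-Computational_Algebra.Polynomial"
begin

text \<open>
  \<open>\<real>\<^sup>2\<^sup>n\<close> is indexed by \<open>'n + 'n\<close> with \<open>n = CARD('n)\<close>; \<open>Inl\<close> are the positions \<open>1, \<dots>, n\<close> and
  \<open>Inr\<close> the positions \<open>n + 1, \<dots>, 2n\<close>. Since \<open>'n\<close> carries no order, the index playing the role of
  position \<open>1\<close> is an explicit parameter \<open>i0 :: 'n\<close> (position \<open>n + 1\<close> is then \<open>Inr i0\<close>).
\<close>

definition block_matrix ::
    "'a^'n^'n \<Rightarrow> 'a^'n^'n \<Rightarrow> 'a^'n^'n \<Rightarrow> 'a^'n^'n \<Rightarrow> 'a^('n::finite + 'n)^('n + 'n)" where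
  "block_matrix A B C D = (\<chi> i j.
     case i of
       Inl k \<Rightarrow> (case j of Inl l \<Rightarrow> A $ k $ l | Inr l \<Rightarrow> B $ k $ l)
     | Inr k \<Rightarrow> (case j of Inl l \<Rightarrow> C $ k $ l | Inr l \<Rightarrow> D $ k $ l))"

definition Omega0 :: "'a::comm_ring_1^('n::finite + 'n)^('n + 'n)" where
  "Omega0 = block_matrix 0 (mat 1) (- mat 1) 0"

text \<open>Used over both \<open>\<real>\<close> and \<open>\<complex>\<close>; over \<open>\<complex>\<close> it is bilinear, not sesquilinear.\<close>

definition symp_form :: "'a::comm_ring_1^('n::finite + 'n) \<Rightarrow> 'a^('n + 'n) \<Rightarrow> 'a" where
  "symp_form v w = (\<Sum>i\<in>UNIV. \<Sum>j\<in>UNIV. v $ i * Omega0 $ i $ j * w $ j)"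

definition Sp :: "(real^('n::finite + 'n)^('n + 'n)) set" where
  "Sp = {A. \<forall>v w. symp_form (A *v v) (A *v w) = symp_form v w}"

definition J0 :: "real^('n::finite + 'n)^('n + 'n)" where
  "J0 = block_matrix 0 (- mat 1) (mat 1) 0"

definition U_n :: "(real^('n::finite + 'n)^('n + 'n)) set" where
  "U_n = {A. orthogonal_matrix A} \<inter> Sp"

text \<open>Meaningful for \<open>A\<close> commuting with \<open>J0\<close>: then \<open>A\<close> has blocks \<open>X, -Y, Y, X\<close> and this is
  \<open>det (X + \<i>Y)\<close>, read off from the left column of blocks.\<close>

definition det_C :: "real^('n::finite + 'n)^('n + 'n) \<Rightarrow> complex" where
  "det_C A = det ((\<chi> k l. Complex (A $ Inl k $ Inl l) (A $ Inr k $ Inl l)) :: complex^'n^'n)"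

definition circle_degree :: "real \<Rightarrow> real \<Rightarrow> (real \<Rightarrow> complex) \<Rightarrow> int" where
  "circle_degree a b f = (THE d. \<exists>\<theta>::real \<Rightarrow> real. continuous_on {a..b} \<theta> \<and>
     (\<forall>t\<in>{a..b}. f t = exp (2 * pi * \<i> * \<theta> t)) \<and> of_int d = \<theta> b - \<theta> a)"

definition is_eigenvalue :: "'a::field^'m^'m::finite \<Rightarrow> 'a \<Rightarrow> bool" where
  "is_eigenvalue A c \<longleftrightarrow> (\<exists>v. v \<noteq> 0 \<and> A *v v = c *s v)"

definition charpoly :: "'a::field^'m^'m::finite \<Rightarrow> 'a poly" where
  "charpoly A = det (\<chi> i j. (if i = j then [:0, 1:] else 0) - [:A $ i $ j:])"

definition alg_mult :: "'a::field^'m^'m::finite \<Rightarrow> 'a \<Rightarrow> nat" where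
  "alg_mult A c = order c (charpoly A)"

definition gen_eigenspace :: "'a::field^'m^'m::finite \<Rightarrow> 'a \<Rightarrow> ('a^'m) set" where
  "gen_eigenspace A c = {v. \<exists>k. ((\<lambda>u. A *v u - c *s u) ^^ k) v = 0}"

abbreviation complexify :: "real^'m^'m::finite \<Rightarrow> complex^'m^'m" where
  "complexify \<equiv> map_matrix complex_of_real"

text \<open>Eigenspaces of a symmetric real bilinear form \<open>Q\<close> on a real subspace \<open>E\<close>, that is, of the
  matrix of \<open>Q\<close> in an orthonormal basis of \<open>E\<close>. The number of positive eigenvalues (with
  multiplicity) would be the same in any other basis, by Sylvester's law of inertia.\<close>

definition form_eigenspace ::
    "('v::euclidean_space) set \<Rightarrow> ('v \<Rightarrow> 'v \<Rightarrow> real) \<Rightarrow> real \<Rightarrow> 'v set" where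
  "form_eigenspace E Q c = {z\<in>E. \<forall>w\<in>E. Q z w = c * (z \<bullet> w)}"

definition num_pos_eigenvalues :: "('v::euclidean_space) set \<Rightarrow> ('v \<Rightarrow> 'v \<Rightarrow> real) \<Rightarrow> nat" where
  "num_pos_eigenvalues E Q =
     (\<Sum>c | c > 0 \<and> (\<exists>z\<in>form_eigenspace E Q c. z \<noteq> 0). dim (form_eigenspace E Q c))"

definition Q_form :: "complex^('n::finite + 'n) \<Rightarrow> complex^('n + 'n) \<Rightarrow> real" where
  "Q_form z z' = Im (symp_form z (\<chi> i. cnj (z' $ i)))"

definition m_plus :: "real^('n::finite + 'n)^('n + 'n) \<Rightarrow> complex \<Rightarrow> nat" where
  "m_plus A l = num_pos_eigenvalues (gen_eigenspace (complexify A) l) Q_form"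

definition m_minus :: "real^('n::finite + 'n)^('n + 'n) \<Rightarrow> nat" where
  "m_minus A = (\<Sum>c | c < 0 \<and> is_eigenvalue A c. alg_mult A c)"

text \<open>Both halved exponents are integers on \<open>Sp\<close>: \<open>m_plus\<close> is a real dimension and \<open>Q_form\<close> is
  invariant under multiplication by \<open>\<i>\<close>; negative eigenvalues come in pairs \<open>c, 1/c\<close>, with \<open>-1\<close>
  of even multiplicity.\<close>

definition rho :: "real^('n::finite + 'n)^('n + 'n) \<Rightarrow> complex" where
  "rho A = (-1) ^ (m_minus A div 2) *
     (\<Prod>l | l \<in> sphere 0 1 - {1, -1} \<and> is_eigenvalue (complexify A) l. l ^ (m_plus A l div 2))"

definition W_plus :: "real^('n::finite + 'n)^('n + 'n)" where
  "W_plus = - mat 1"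

definition W_minus :: "'n::finite \<Rightarrow> real^('n + 'n)^('n + 'n)" where
  "W_minus i0 = block_matrix
     (\<chi> k l. if k = l then if k = i0 then 2 else -1 else 0) 0
     0 (\<chi> k l. if k = l then if k = i0 then 1/2 else -1 else 0)"

definition CZ_path :: "(real \<Rightarrow> real^('n::finite + 'n)^('n + 'n)) \<Rightarrow> bool" where
  "CZ_path \<psi> \<longleftrightarrow> continuous_on {0..1} \<psi> \<and> \<psi> ` {0..1} \<subseteq> Sp \<and> \<psi> 0 = mat 1 \<and>
     \<not> is_eigenvalue (\<psi> 1) 1"

definition CZ_extension :: "'n::finite \<Rightarrow> (real \<Rightarrow> real^('n + 'n)^('n + 'n)) \<Rightarrow>
    (real \<Rightarrow> real^('n + 'n)^('n + 'n)) \<Rightarrow> bool" where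
  "CZ_extension i0 \<psi> \<psi>' \<longleftrightarrow> continuous_on {0..2} \<psi>' \<and> \<psi>' ` {0..2} \<subseteq> Sp \<and>
     (\<forall>t\<in>{0..1}. \<psi>' t = \<psi> t) \<and> (\<forall>s\<in>{1..2}. \<not> is_eigenvalue (\<psi>' s) 1) \<and>
     (\<psi>' 2 = W_plus \<or> \<psi>' 2 = W_minus i0)"

text \<open>The value does not depend on the chosen extension; this is a theorem, not built into the
  definition.\<close>

definition mu_CZ :: "'n::finite \<Rightarrow> (real \<Rightarrow> real^('n + 'n)^('n + 'n)) \<Rightarrow> int" where
  "mu_CZ i0 \<psi> = circle_degree 0 2 (\<lambda>t. (rho ((SOME \<psi>'. CZ_extension i0 \<psi> \<psi>') t))\<^sup>2)"

text \<open>The class constant \<open>exp\<close> is not available on \<open>real^'m^'m\<close>, whose \<open>(*)\<close> is componentwise.\<close>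

definition matrix_exp :: "real^'m^'m::finite \<Rightarrow> real^'m^'m" where
  "matrix_exp A = (\<Sum>k. (1 / fact k) *\<^sub>R (((**) A) ^^ k) (mat 1))"

definition S2_minus :: "'n::finite \<Rightarrow> real^('n + 'n)^('n + 'n)" where
  "S2_minus i0 =
     (let D = (\<chi> k l. if k = l \<and> k \<noteq> i0 then 1 else 0);
          B = (\<chi> k l. if k = i0 \<and> l = i0 then - (ln 2 / pi) else 0)
      in block_matrix D B B D)"

definition psi2_minus :: "'n::finite \<Rightarrow> real \<Rightarrow> real^('n + 'n)^('n + 'n)" where
  "psi2_minus i0 t = matrix_exp ((t * pi) *\<^sub>R (J0 ** S2_minus i0))"

definition is_polar_factor :: "real^'m^'m::finite \<Rightarrow> real^'m^'m \<Rightarrow> bool" where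
  "is_polar_factor A P \<longleftrightarrow> transpose P = P \<and> (\<forall>x. x \<noteq> 0 \<longrightarrow> x \<bullet> (P *v x) > 0) \<and>
     P ** P = transpose A ** A"

definition polar_U :: "real^'m^'m::finite \<Rightarrow> real^'m^'m" where
  "polar_U A = A ** matrix_inv (THE P. is_polar_factor A P)"

definition rho_hat :: "real^('n::finite + 'n)^('n + 'n) \<Rightarrow> complex" where
  "rho_hat A = (let d = det_C ((1/2) *\<^sub>R (A - J0 ** A ** J0)) in d / cmod d)"

end

theory Submission
  imports Defs "HOL-Computational_Algebra.Fundamental_Theorem_Algebra"
begin

text \<open>
  Only \<open>rho\<^sup>2\<close> matters. The Hermitian form with real part \<open>Q_form\<close> has signature \<open>(n, n)\<close> on \<open>\<complex>\<^sup>2\<^sup>n\<close>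
  and is preserved by symplectic matrices. By Brouwer's theorem every symplectic \<open>A\<close> leaves a
  maximal nonnegative subspace invariant, and if \<open>M\<close> denotes the restriction of \<open>A\<close> to such a
  subspace then \<open>rho A\<^sup>2 = (det M / |det M|)\<^sup>2\<close>. Since these subspaces form a compact family, \<open>rho\<^sup>2\<close>
  is continuous. By the polar decomposition the symplectic group retracts onto \<open>U_n\<close>, so the
  quotient of two circle valued maps that agree on \<open>U_n\<close> has a continuous logarithm; hence the
  degrees along a path starting at the identity differ by an amount that only depends on the end
  point, which is zero at \<open>W_plus\<close> (join it to the identity inside \<open>U_n\<close>) and is detected at
  \<open>W_minus\<close> by \<open>psi2_minus\<close>. Independence of the extension follows because \<open>rho_hat\<^sup>2\<close> has a
  continuous logarithm on the symplectic matrices without the eigenvalue \<open>1\<close>: the Cayley transform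
  \<open>S = J0 (A + 1) (A - 1)\<^sup>-\<^sup>1\<close> is symmetric, \<open>rho_hat A\<close> is up to sign the conjugate of the phase of
  \<open>det (A - 1) det (1 + \<i> S)\<close>, and \<open>S\<close> can be scaled to \<open>0\<close>.
\<close>


section \<open>Direct sums and symmetric bilinear forms\<close>

text \<open>The formula for \<open>rho\<close> changes its shape when eigenvalues collide on the
  circle or leave it, so continuity cannot be read off from it. One determinant on an invariant
  subspace removes the case distinctions. The exponents match for the following reason. An
  eigenvalue \<open>c\<close> on the circle occurs in \<open>M\<close> with half of
  \<open>m_plus\<close> as multiplicity. Off the circle \<open>c\<close> and
  \<open>1 / cnj c\<close> lie on one ray and together occur in \<open>M\<close> with the full
  multiplicity of \<open>c\<close> in \<open>A\<close>; over conjugate pairs these phases multiply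
  to a sign. Squaring removes this sign, the sign contributed by negative eigenvalues, and any
  contribution of \<open>1\<close> and \<open>-1\<close>.

  The invariant subspace is not unique. Every choice gives the same value, and this turns
  compactness of the set of candidates into continuity, although no continuous choice is made.

  An extension cannot choose its end point: the sign of \<open>det (A - 1)\<close> at the end of the
  given path decides between \<open>W_plus\<close> and \<open>W_minus\<close>.\<close>

definition ksum :: "'i set \<Rightarrow> ('i \<Rightarrow> 'v::real_vector set) \<Rightarrow> 'v set" where
  "ksum I S = {x. \<exists>u. (\<forall>i\<in>I. u i \<in> S i) \<and> x = (\<Sum>i\<in>I. u i)}"

text \<open>Zero subspaces are allowed as members, so a summand may be replaced by
  \<open>{0}\<close> or by a smaller subspace without changing the index set.\<close>

definition indep_family :: "'i set \<Rightarrow> ('i \<Rightarrow> 'v::real_vector set) \<Rightarrow> bool" where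
  "indep_family I S \<longleftrightarrow>
     (\<forall>u. (\<forall>i\<in>I. u i \<in> S i) \<and> (\<Sum>i\<in>I. u i) = 0 \<longrightarrow> (\<forall>i\<in>I. u i = 0))"

lemma ksumI: "(\<And>i. i \<in> I \<Longrightarrow> u i \<in> S i) \<Longrightarrow> (\<Sum>i\<in>I. u i) \<in> ksum I S"
  unfolding ksum_def by blast

lemma ksumE:
  assumes "x \<in> ksum I S"
  obtains u where "\<And>i. i \<in> I \<Longrightarrow> u i \<in> S i" "x = (\<Sum>i\<in>I. u i)"
  using assms unfolding ksum_def by blast

lemma subspace_ksum:
  assumes "\<And>i. i \<in> I \<Longrightarrow> subspace (S i)"
  shows "subspace (ksum I S)"
  unfolding subspace_def
proof (intro conjI ballI allI)
  show "0 \<in> ksum I S"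
    using ksumI[of I "\<lambda>_. 0" S] assms by (simp add: subspace_0)
  fix x y assume "x \<in> ksum I S" "y \<in> ksum I S"
  then obtain u v where "\<And>i. i \<in> I \<Longrightarrow> u i \<in> S i" "x = (\<Sum>i\<in>I. u i)"
    "\<And>i. i \<in> I \<Longrightarrow> v i \<in> S i" "y = (\<Sum>i\<in>I. v i)"
    by (metis ksumE)
  then show "x + y \<in> ksum I S"
    using ksumI[of I "\<lambda>i. u i + v i" S] assms by (simp add: sum.distrib subspace_add)
next
  fix c x assume "x \<in> ksum I S"
  then obtain u where "\<And>i. i \<in> I \<Longrightarrow> u i \<in> S i" "x = (\<Sum>i\<in>I. u i)"
    by (metis ksumE)
  then show "c *\<^sub>R x \<in> ksum I S"
    using ksumI[of I "\<lambda>i. c *\<^sub>R u i" S] assms by (simp add: scaleR_sum_right subspace_scale)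
qed

lemma indep_family_mono:
  assumes "indep_family I S" "\<And>i. i \<in> I \<Longrightarrow> T i \<subseteq> S i"
  shows "indep_family I T"
  using assms unfolding indep_family_def by (metis subsetD)

lemma dim_ksum:
  fixes S :: "'i \<Rightarrow> 'v::euclidean_space set"
  assumes "finite I" "\<And>i. i \<in> I \<Longrightarrow> subspace (S i)" "indep_family I S"
  shows "dim (ksum I S) = (\<Sum>i\<in>I. dim (S i))"
  using assms
proof (induction I)
  case empty
  have "ksum {} S = {0}" by (auto simp: ksum_def)
  then show ?case by simp
next
  case (insert j I)
  have ind: "indep_family I S"
    unfolding indep_family_def
  proof (intro allI impI)
    fix u assume u: "(\<forall>i\<in>I. u i \<in> S i) \<and> (\<Sum>i\<in>I. u i) = 0"
    define v where "v = u(j := 0)"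
    have "\<forall>i\<in>insert j I. v i \<in> S i"
      using u insert.prems(1) by (auto simp: v_def subspace_0)
    moreover have "(\<Sum>i\<in>I. v i) = (\<Sum>i\<in>I. u i)"
      using insert.hyps by (intro sum.cong) (auto simp: v_def)
    ultimately have "\<forall>i\<in>insert j I. v i = 0"
      using u insert.prems(2) insert.hyps unfolding indep_family_def
      by (metis (no_types, lifting) add.right_neutral fun_upd_same sum.insert v_def)
    then show "\<forall>i\<in>I. u i = 0"
      using insert.hyps by (metis fun_upd_other insertCI v_def)
  qed
  have eq: "ksum (insert j I) S = {x + y |x y. x \<in> S j \<and> y \<in> ksum I S}"
  proof (intro set_eqI iffI)
    fix x assume "x \<in> ksum (insert j I) S"
    then obtain u where u: "\<And>i. i \<in> insert j I \<Longrightarrow> u i \<in> S i" "x = (\<Sum>i\<in>insert j I. u i)"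
      by (metis ksumE)
    then have "x = u j + (\<Sum>i\<in>I. u i)" "u j \<in> S j" "(\<Sum>i\<in>I. u i) \<in> ksum I S"
      using insert.hyps by (auto intro!: ksumI)
    then show "x \<in> {x + y |x y. x \<in> S j \<and> y \<in> ksum I S}" by blast
  next
    fix x assume "x \<in> {x + y |x y. x \<in> S j \<and> y \<in> ksum I S}"
    then obtain a u where a: "a \<in> S j" "\<And>i. i \<in> I \<Longrightarrow> u i \<in> S i" "x = a + (\<Sum>i\<in>I. u i)"
      by (auto elim!: ksumE)
    define v where "v = u(j := a)"
    have "(\<Sum>i\<in>I. v i) = (\<Sum>i\<in>I. u i)"
      using insert.hyps by (intro sum.cong) (auto simp: v_def)
    then have "x = (\<Sum>i\<in>insert j I. v i)" using a insert.hyps by (simp add: v_def)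
    then show "x \<in> ksum (insert j I) S" using a by (auto intro!: ksumI simp: v_def)
  qed
  have "S j \<inter> ksum I S = {0}"
  proof
    show "S j \<inter> ksum I S \<subseteq> {0}"
    proof
      fix x assume x: "x \<in> S j \<inter> ksum I S"
      then obtain u where u: "\<And>i. i \<in> I \<Longrightarrow> u i \<in> S i" "x = (\<Sum>i\<in>I. u i)"
        by (auto elim!: ksumE)
      define v where "v = u(j := - x)"
      have s: "(\<Sum>i\<in>I. v i) = (\<Sum>i\<in>I. u i)"
        using insert.hyps by (intro sum.cong) (auto simp: v_def)
      have "(\<Sum>i\<in>insert j I. v i) = 0" using insert.hyps s u by (simp add: v_def)
      moreover have "\<forall>i\<in>insert j I. v i \<in> S i"
        using u x insert.prems(1)[of j] by (auto simp: v_def subspace_neg)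
      ultimately have "v j = 0" using insert.prems(2) unfolding indep_family_def by blast
      then show "x \<in> {0}" by (simp add: v_def)
    qed
    show "{0} \<subseteq> S j \<inter> ksum I S"
      using insert.prems(1) subspace_ksum[of I S] by (auto simp: subspace_0)
  qed
  then have "dim (ksum (insert j I) S) = dim (S j) + dim (ksum I S)"
    using dim_sums_Int[of "S j" "ksum I S"] subspace_ksum[of I S] insert.prems(1)
    by (simp add: eq)
  then show ?case using insert ind by simp
qed

section \<open>Symmetric bilinear forms and their orthonormal eigenbases\<close>

definition sym_bilinear :: "('v::real_vector \<Rightarrow> 'v \<Rightarrow> real) \<Rightarrow> bool" where
  "sym_bilinear Q \<longleftrightarrow> (\<forall>x. linear (Q x)) \<and> (\<forall>x y. Q x y = Q y x)"

lemma sym_bilinear_simps: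
  assumes "sym_bilinear Q"
  shows "Q (x + y) z = Q x z + Q y z" "Q z (x + y) = Q z x + Q z y"
    "Q (c *\<^sub>R x) z = c * Q x z" "Q z (c *\<^sub>R x) = c * Q z x"
    "Q 0 z = 0" "Q z 0 = 0" "Q (x - y) z = Q x z - Q y z" "Q z (x - y) = Q z x - Q z y"
    "Q (- x) z = - Q x z" "Q z (- x) = - Q z x"
proof -
  have l: "linear (Q z)" using assms by (simp add: sym_bilinear_def)
  have s: "Q u z = Q z u" for u using assms by (simp add: sym_bilinear_def)
  show r: "Q z (x + y) = Q z x + Q z y" "Q z (c *\<^sub>R x) = c * Q z x" "Q z 0 = 0"
    "Q z (x - y) = Q z x - Q z y" "Q z (- x) = - Q z x"
    using linear_add[OF l] linear_scale[OF l] linear_0[OF l] linear_diff[OF l] linear_neg[OF l]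
    by simp_all
  show "Q (x + y) z = Q x z + Q y z" "Q (c *\<^sub>R x) z = c * Q x z" "Q 0 z = 0"
    "Q (x - y) z = Q x z - Q y z" "Q (- x) z = - Q x z"
    unfolding s[of "x + y"] s[of "c *\<^sub>R x"] s[of "x - y"] s[of "- x"] s[of 0] s[of x] s[of y]
    by (rule r)+
qed

lemma sym_bilinear_sum:
  assumes "sym_bilinear Q"
  shows "Q (\<Sum>i\<in>I. u i) z = (\<Sum>i\<in>I. Q (u i) z)" "Q z (\<Sum>i\<in>I. u i) = (\<Sum>i\<in>I. Q z (u i))"
proof -
  have l: "linear (Q z)" for z using assms by (simp add: sym_bilinear_def)
  have s: "Q x y = Q y x" for x y using assms by (simp add: sym_bilinear_def)
  show *: "Q z (\<Sum>i\<in>I. u i) = (\<Sum>i\<in>I. Q z (u i))" using l by (rule linear_sum)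
  show "Q (\<Sum>i\<in>I. u i) z = (\<Sum>i\<in>I. Q (u i) z)"
    unfolding s[of _ z] by (rule *)
qed

lemma sym_bilinear_continuous:
  fixes Q :: "'v::euclidean_space \<Rightarrow> 'v \<Rightarrow> real"
  assumes "sym_bilinear Q"
  shows "continuous_on UNIV (\<lambda>x. Q x x)"
proof -
  have "bilinear Q"
    using assms by (auto simp: bilinear_def sym_bilinear_def) 
  then have "bounded_bilinear Q" by (rule bilinear_conv_bounded_bilinear[THEN iffD1])
  then show ?thesis by (rule bounded_bilinear.continuous_on) (auto intro: continuous_intros)
qed

text \<open>For small \<open>t\<close> of the right sign the linear term dominates the quadratic
  one. This is the first variation argument, used wherever a quadratic form is maximal or has a
  fixed sign.\<close>

lemma linear_coeff_zero:
  fixes a b :: real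
  assumes "\<And>t. 2 * t * a \<le> t\<^sup>2 * b"
  shows "a = 0"
proof (rule ccontr)
  assume "a \<noteq> 0"
  have *: "2 * t * a \<le> t\<^sup>2 * (\<bar>b\<bar> + 1)" for t
    using assms[of t] mult_left_mono[of b "\<bar>b\<bar> + 1" "t\<^sup>2"]
    by (smt (verit) zero_le_power2)
  \<comment> \<open>At \<open>t = a / (\<bar>b\<bar> + 1)\<close> the quadratic side is half of the
    linear one; the \<open>+ 1\<close> keeps the denominator positive.\<close>
  have "2 * (a / (\<bar>b\<bar> + 1)) * a \<le> (a / (\<bar>b\<bar> + 1))\<^sup>2 * (\<bar>b\<bar> + 1)"
    by (rule *)
  also have "\<dots> = (a / (\<bar>b\<bar> + 1)) * a" by (simp add: power2_eq_square)
  finally have "a\<^sup>2 / (\<bar>b\<bar> + 1) \<le> 0" by (simp add: power2_eq_square)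
  moreover have "a\<^sup>2 / (\<bar>b\<bar> + 1) > 0"
    using \<open>a \<noteq> 0\<close> by (intro divide_pos_pos) (auto simp: add_nonneg_pos)
  ultimately show False by linarith
qed

text \<open>By compactness \<open>Q x x\<close> attains its maximum on the unit sphere of
  \<open>E\<close> at some \<open>b\<close>. With \<open>c = Q b b\<close>, the expression
  \<open>Q y y - c * (y \<bullet> y)\<close> is maximal at \<open>b\<close> on all of
  \<open>E\<close>, so its first variation there vanishes.\<close>

lemma form_eigenvector_exists:
  fixes Q :: "'v::euclidean_space \<Rightarrow> 'v \<Rightarrow> real"
  assumes Q: "sym_bilinear Q" and E: "subspace E" and ne: "\<exists>x\<in>E. x \<noteq> 0"
  shows "\<exists>b\<in>E. norm b = 1 \<and> (\<exists>c. b \<in> form_eigenspace E Q c)"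
proof -
  note Qs = sym_bilinear_simps[OF Q]
  have sym: "Q x y = Q y x" for x y using Q by (simp add: sym_bilinear_def)
  let ?K = "E \<inter> sphere 0 1"
  obtain x where x: "x \<in> E" "x \<noteq> 0" using ne by blast
  have "inverse (norm x) *\<^sub>R x \<in> ?K" using x E by (auto simp: subspace_scale)
  then have "?K \<noteq> {}" by blast
  moreover have "compact ?K"
    using closed_subspace[OF E] by (simp add: closed_Int_compact)
  ultimately obtain b where b: "b \<in> ?K" "\<And>y. y \<in> ?K \<Longrightarrow> Q y y \<le> Q b b"
    using continuous_attains_sup[of ?K "\<lambda>x. Q x x"] continuous_on_subset[OF sym_bilinear_continuous[OF Q]]
    by (metis subset_UNIV)
  have nb: "norm b = 1" and bE: "b \<in> E" using b by auto
  define c where "c = Q b b"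
  have mx: "Q y y \<le> c * (y \<bullet> y)" if "y \<in> E" for y
  proof (cases "y = 0")
    case False
    let ?y = "inverse (norm y) *\<^sub>R y"
    have "?y \<in> ?K" using that False E by (auto simp: subspace_scale)
    then have "Q ?y ?y \<le> c" using b by (simp add: c_def)
    then have "Q y y / (norm y)\<^sup>2 \<le> c" by (simp add: Qs power2_eq_square field_simps)
    then show ?thesis using False by (simp add: divide_le_eq power2_norm_eq_inner)
  qed (simp add: Qs)
  have "Q b w = c * (b \<bullet> w)" if w: "w \<in> E" for w
  proof -
    have "Q b w - c * (b \<bullet> w) = 0"
    proof (rule linear_coeff_zero)
      fix t :: real
      have "b + t *\<^sub>R w \<in> E" using bE w E by (simp add: subspace_add subspace_scale)
      from mx[OF this]
      have "Q b b + 2 * t * Q b w + t\<^sup>2 * Q w w \<le> c * (b \<bullet> b + 2 * t * (b \<bullet> w) + t\<^sup>2 * (w \<bullet> w))"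
        by (simp add: Qs inner_simps sym[of w b] inner_commute[of w b] power2_eq_square algebra_simps)
      moreover have "b \<bullet> b = 1" using nb by (simp add: norm_eq_1)
      ultimately show "2 * t * (Q b w - c * (b \<bullet> w)) \<le> t\<^sup>2 * (c * (w \<bullet> w) - Q w w)"
        by (simp add: c_def algebra_simps)
    qed
    then show ?thesis by simp
  qed
  then show ?thesis using bE nb by (auto simp: form_eigenspace_def)
qed

text \<open>Induction on the dimension: split off an eigenvector \<open>b\<close> and restrict to
  its orthogonal complement in \<open>E\<close>. An eigenvector \<open>z\<close> found there remains
  one on \<open>E\<close>, because \<open>Q z b\<close> is a multiple of
  \<open>b \<bullet> z = 0\<close>.\<close>

lemma form_eigenbasis:
  fixes Q :: "'v::euclidean_space \<Rightarrow> 'v \<Rightarrow> real"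
  assumes Q: "sym_bilinear Q" and E: "subspace E"
  shows "\<exists>B. finite B \<and> B \<subseteq> E \<and> span B = E \<and> pairwise orthogonal B \<and>
    (\<forall>b\<in>B. norm b = 1) \<and> (\<forall>b\<in>B. \<exists>c. b \<in> form_eigenspace E Q c)"
  using E
proof (induction "dim E" arbitrary: E rule: less_induct)
  case less
  show ?case
  proof (cases "\<exists>x\<in>E. x \<noteq> 0")
    case False
    then have "E = {0}" using less.prems by (auto simp: subspace_0)
    then show ?thesis by (intro exI[of _ "{}"]) auto
  next
    case True
    have sym: "Q x y = Q y x" for x y using Q by (simp add: sym_bilinear_def)
    obtain b c where b: "b \<in> E" "norm b = 1" "b \<in> form_eigenspace E Q c"
      using form_eigenvector_exists[OF Q less.prems True] by blast
    have bb: "b \<bullet> b = 1" using b by (simp add: norm_eq_1)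
    define E' where "E' = {x\<in>E. b \<bullet> x = 0}"
    have sub': "subspace E'"
      using less.prems by (auto simp: E'_def subspace_def inner_simps)
    have "b \<notin> E'" "E' \<subseteq> E" using bb by (auto simp: E'_def)
    then have "E' \<subset> E" using b by blast
    then have "dim E' < dim E"
      using sub' less.prems by (metis dim_psubset span_eq_iff)
    from less.hyps[OF this sub'] obtain B where B: "finite B" "B \<subseteq> E'" "span B = E'"
      "pairwise orthogonal B" "\<forall>b\<in>B. norm b = 1" "\<forall>b\<in>B. \<exists>c. b \<in> form_eigenspace E' Q c"
      by blast
    have dec: "x - (b \<bullet> x) *\<^sub>R b \<in> E'" if "x \<in> E" for x
      using that b less.prems by (auto simp: E'_def inner_simps subspace_diff subspace_scale bb)
    have "span (insert b B) = E"
    proof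
      show "span (insert b B) \<subseteq> E"
        using b B less.prems by (intro span_minimal) (auto simp: E'_def)
      show "E \<subseteq> span (insert b B)"
      proof
        fix x assume "x \<in> E"
        then have "x - (b \<bullet> x) *\<^sub>R b \<in> span B" using dec B by simp
        then show "x \<in> span (insert b B)" unfolding span_insert by blast
      qed
    qed
    moreover have "\<exists>c'. z \<in> form_eigenspace E Q c'" if "z \<in> B" for z
    proof -
      obtain c' where c': "z \<in> form_eigenspace E' Q c'" using B \<open>z \<in> B\<close> by blast
      then have zE: "z \<in> E" "b \<bullet> z = 0" by (auto simp: form_eigenspace_def E'_def)
      have "Q z w = c' * (z \<bullet> w)" if w: "w \<in> E" for w
      proof -
        have "Q z b = 0" using b(3) zE sym[of z b] by (simp add: form_eigenspace_def)
        have "Q z w = Q z (w - (b \<bullet> w) *\<^sub>R b)"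
          using \<open>Q z b = 0\<close> by (simp add: sym_bilinear_simps[OF Q])
        also have "\<dots> = c' * (z \<bullet> (w - (b \<bullet> w) *\<^sub>R b))"
          using c' dec[OF w] by (simp add: form_eigenspace_def)
        also have "\<dots> = c' * (z \<bullet> w)" using zE by (simp add: inner_simps inner_commute)
        finally show ?thesis .
      qed
      then show ?thesis using zE by (auto simp: form_eigenspace_def)
    qed
    moreover have "pairwise orthogonal (insert b B)"
      using B by (auto simp: pairwise_insert orthogonal_def E'_def inner_commute)
    ultimately show ?thesis
      using B b by (intro exI[of _ "insert b B"]) (auto simp: E'_def)
  qed
qed

lemma orthonormal_coeff:
  fixes B :: "'v::euclidean_space set"
  assumes "finite B" "pairwise orthogonal B" "\<And>b. b \<in> B \<Longrightarrow> norm b = 1" "x \<in> span B"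
  shows "x = (\<Sum>b\<in>B. (x \<bullet> b) *\<^sub>R b)"
proof -
  have bb: "b \<bullet> b' = (if b = b' then 1 else 0)" if "b \<in> B" "b' \<in> B" for b b'
    using assms that by (auto simp: pairwise_def orthogonal_def norm_eq_1)
  obtain u where u: "x = (\<Sum>b\<in>B. u b *\<^sub>R b)"
    using assms(4) span_finite[OF assms(1)] by auto
  have "x \<bullet> b = u b" if "b \<in> B" for b
  proof -
    have "x \<bullet> b = (\<Sum>b'\<in>B. u b' * (b' \<bullet> b))" by (simp add: u inner_sum_left)
    also have "\<dots> = (\<Sum>b'\<in>B. if b' = b then u b' else 0)"
      using that by (intro sum.cong) (auto simp: bb)
    finally show ?thesis using that assms(1) by simp
  qed
  then show ?thesis using u by (metis (no_types, lifting) sum.cong)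
qed

lemma dim_span_orthonormal:
  fixes B :: "'v::euclidean_space set"
  assumes "pairwise orthogonal B" "\<And>b. b \<in> B \<Longrightarrow> norm b = 1"
  shows "dim (span B) = card B"
proof -
  have "0 \<notin> B" using assms(2) by force
  then have "independent B" using assms(1) pairwise_orthogonal_independent by blast
  then show ?thesis by (simp add: dim_eq_card_independent)
qed

text \<open>An eigenspace is spanned by the members of an eigenbasis it contains, so the number of
  positive eigenvalues counts the eigenbasis vectors with a positive eigenvalue.\<close>

lemma positive_part:
  fixes Q :: "'v::euclidean_space \<Rightarrow> 'v \<Rightarrow> real"
  assumes Q: "sym_bilinear Q" and E: "subspace E"
  obtains P N where "subspace P" "subspace N" "P \<subseteq> E" "N \<subseteq> E"
    "dim P = num_pos_eigenvalues E Q" "dim E = dim P + dim N"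
    "\<And>x. x \<in> E \<Longrightarrow> \<exists>p\<in>P. \<exists>q\<in>N. x = p + q"
    "\<And>p. p \<in> P \<Longrightarrow> p \<noteq> 0 \<Longrightarrow> Q p p > 0" "\<And>q. q \<in> N \<Longrightarrow> Q q q \<le> 0"
    "\<And>p q. p \<in> P \<Longrightarrow> q \<in> N \<Longrightarrow> Q p q = 0"
proof -
  note Qs = sym_bilinear_simps[OF Q] sym_bilinear_sum[OF Q]
  have sym: "Q x y = Q y x" for x y using Q by (simp add: sym_bilinear_def)
  obtain B where B: "finite B" "B \<subseteq> E" "span B = E" "pairwise orthogonal B"
    "\<And>b. b\<in>B \<Longrightarrow> norm b = 1" "\<forall>b\<in>B. \<exists>c. b \<in> form_eigenspace E Q c"
    using form_eigenbasis[OF Q E] by blast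
  obtain c where c: "\<And>b. b \<in> B \<Longrightarrow> b \<in> form_eigenspace E Q (c b)"
    using B(6) by metis
  have bb: "b \<bullet> b' = (if b = b' then 1 else 0)" if "b \<in> B" "b' \<in> B" for b b'
    using B that by (auto simp: pairwise_def orthogonal_def norm_eq_1)
  have Qb: "Q b w = c b * (b \<bullet> w)" if "b \<in> B" "w \<in> E" for b w
    using c[OF that(1)] that(2) by (simp add: form_eigenspace_def)
  define BP where "BP = {b\<in>B. c b > 0}"
  define BN where "BN = {b\<in>B. c b \<le> 0}"
  have BPN: "B = BP \<union> BN" "BP \<inter> BN = {}" "finite BP" "finite BN"
    using B(1) by (auto simp: BP_def BN_def)
  have on: "pairwise orthogonal C" "\<And>b. b \<in> C \<Longrightarrow> norm b = 1" "finite C" "span C \<subseteq> E" if "C \<subseteq> B" for C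
    using B that pairwise_subset finite_subset span_mono[OF that] by blast+
  have QC: "Q x y = (\<Sum>b\<in>C. c b * (x \<bullet> b) * (y \<bullet> b))" if "C \<subseteq> B" "x \<in> span C" "y \<in> E" for C x y
  proof -
    have "Q x y = Q (\<Sum>b\<in>C. (x \<bullet> b) *\<^sub>R b) y"
      using orthonormal_coeff[of C x] on[OF that(1)] that by metis
    also have "\<dots> = (\<Sum>b\<in>C. c b * (x \<bullet> b) * (y \<bullet> b))"
      using that unfolding Qs
      by (intro sum.cong) (auto simp: Qb subset_iff inner_commute mult_ac)
    finally show ?thesis .
  qed
  have sub: "BP \<subseteq> B" "BN \<subseteq> B" using BPN by auto
  have eig: "form_eigenspace E Q d = span {b\<in>B. c b = d}" for d
  proof
    show "span {b\<in>B. c b = d} \<subseteq> form_eigenspace E Q d"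
    proof (rule span_minimal)
      show "{b \<in> B. c b = d} \<subseteq> form_eigenspace E Q d" using c by auto
      show "subspace (form_eigenspace E Q d)"
        using E by (auto simp: form_eigenspace_def subspace_def Qs inner_simps algebra_simps)
    qed
    show "form_eigenspace E Q d \<subseteq> span {b\<in>B. c b = d}"
    proof
      fix x assume x: "x \<in> form_eigenspace E Q d"
      then have xE: "x \<in> E" by (simp add: form_eigenspace_def)
      have z: "x \<bullet> b = 0" if "b \<in> B" "c b \<noteq> d" for b
      proof -
        have "Q x b = d * (x \<bullet> b)" using x that B by (auto simp: form_eigenspace_def)
        moreover have "Q x b = c b * (x \<bullet> b)" using Qb[OF that(1) xE] sym[of x b] by (simp add: inner_commute)
        ultimately show ?thesis using that by simp
      qed
      have "x = (\<Sum>b\<in>B. (x \<bullet> b) *\<^sub>R b)"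
        using orthonormal_coeff[of B x] B xE by blast
      also have "\<dots> = (\<Sum>b\<in>{b\<in>B. c b = d}. (x \<bullet> b) *\<^sub>R b)"
        using B(1) z by (intro sum.mono_neutral_right) auto
      also have "\<dots> \<in> span {b\<in>B. c b = d}"
        by (intro span_sum span_scale span_base)
      finally show "x \<in> span {b\<in>B. c b = d}" .
    qed
  qed
  have dimeig: "dim (form_eigenspace E Q d) = card {b\<in>B. c b = d}" for d
    unfolding eig using on[of "{b\<in>B. c b = d}"] by (intro dim_span_orthonormal) auto
  have posset: "{d. d > 0 \<and> (\<exists>z\<in>form_eigenspace E Q d. z \<noteq> 0)} = c ` BP"
  proof (intro set_eqI iffI)
    fix d assume "d \<in> {d. d > 0 \<and> (\<exists>z\<in>form_eigenspace E Q d. z \<noteq> 0)}"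
    then have d: "d > 0" "\<exists>z\<in>span {b\<in>B. c b = d}. z \<noteq> 0" unfolding eig by auto
    then have "{b\<in>B. c b = d} \<noteq> {}" by (metis singletonD span_empty)
    then show "d \<in> c ` BP" using d by (auto simp: BP_def)
  next
    fix d assume "d \<in> c ` BP"
    then obtain b where b: "b \<in> B" "c b = d" "d > 0" by (auto simp: BP_def)
    then have "b \<in> form_eigenspace E Q d" "b \<noteq> 0" using c B(5) by force+
    then show "d \<in> {d. d > 0 \<and> (\<exists>z\<in>form_eigenspace E Q d. z \<noteq> 0)}" using b by blast
  qed
  have "num_pos_eigenvalues E Q = (\<Sum>d\<in>c ` BP. card {b\<in>BP. c b = d})"
    unfolding num_pos_eigenvalues_def posset dimeig
    by (intro sum.cong arg_cong[where f = card]) (auto simp: BP_def)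
  also have "\<dots> = card BP"
    using sum_fun_comp[of BP "c ` BP" c "\<lambda>_. 1::nat"] BPN(3) by simp
  finally have npos: "num_pos_eigenvalues E Q = card BP" .
  show thesis
  proof (rule that[of "span BP" "span BN"])
    show "subspace (span BP)" "subspace (span BN)" by auto
    show "span BP \<subseteq> E" "span BN \<subseteq> E" using on sub by auto
    show "dim (span BP) = num_pos_eigenvalues E Q"
      using npos dim_span_orthonormal[of BP] on[OF sub(1)] by simp
    show "dim E = dim (span BP) + dim (span BN)"
      using dim_span_orthonormal[of BP] dim_span_orthonormal[of BN] dim_span_orthonormal[of B]
        on[OF sub(1)] on[OF sub(2)] B BPN by (metis card_Un_disjoint)
    show "\<exists>p\<in>span BP. \<exists>q\<in>span BN. x = p + q" if "x \<in> E" for x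
      using that B(3) span_Un[of BP BN] BPN(1) by auto
    show "Q p p > 0" if p: "p \<in> span BP" "p \<noteq> 0" for p
    proof -
      have eq: "Q p p = (\<Sum>b\<in>BP. c b * (p \<bullet> b) * (p \<bullet> b))"
        using QC[OF sub(1) p(1)] p(1) on(4)[OF sub(1)] by blast
      have "\<exists>b\<in>BP. p \<bullet> b \<noteq> 0"
      proof (rule ccontr)
        assume "\<not> ?thesis"
        then have "p = 0" using orthonormal_coeff[of BP p] on[OF sub(1)] p by simp
        then show False using p by simp
      qed
      then obtain b where b: "b \<in> BP" "p \<bullet> b \<noteq> 0" by blast
      have "c b * (p \<bullet> b) * (p \<bullet> b) > 0"
        using b by (auto simp: BP_def mult.assoc zero_less_mult_iff)
      moreover have "c b * (p \<bullet> b) * (p \<bullet> b) \<ge> 0" if "b \<in> BP" for b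
        using that by (auto simp: BP_def mult.assoc intro!: mult_nonneg_nonneg)
      ultimately show ?thesis
        unfolding eq using b(1) BPN(3) by (intro sum_pos2) auto
    qed
    show "Q q q \<le> 0" if q: "q \<in> span BN" for q
    proof -
      have eq: "Q q q = (\<Sum>b\<in>BN. c b * (q \<bullet> b) * (q \<bullet> b))"
        using QC[OF sub(2) q] q on(4)[OF sub(2)] by blast
      show ?thesis unfolding eq
        by (intro sum_nonpos) (auto simp: BN_def mult.assoc intro!: mult_nonpos_nonneg)
    qed
    show "Q p q = 0" if p: "p \<in> span BP" and q: "q \<in> span BN" for p q
    proof -
      have eq: "Q p q = (\<Sum>b\<in>BP. c b * (p \<bullet> b) * (q \<bullet> b))"
        using QC[OF sub(1) p] q on(4)[OF sub(2)] by blast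
      have "q \<bullet> b = 0" if b: "b \<in> BP" for b
      proof -
        have "orthogonal b q"
        proof (rule orthogonal_to_span[OF q])
          fix y assume "y \<in> BN"
          then show "orthogonal b y"
            using b BPN sub bb[of b y] by (auto simp: orthogonal_def)
        qed
        then show ?thesis by (simp add: orthogonal_def inner_commute)
      qed
      then show ?thesis unfolding eq by simp
    qed
  qed
qed

section \<open>Generalized eigenspaces of complex matrices\<close>

abbreviation eigenvalues :: "complex^'m^'m::finite \<Rightarrow> complex set" where
  "eigenvalues B \<equiv> {c. is_eigenvalue B c}"

lemma ksumD: "x \<in> ksum I S \<Longrightarrow> \<exists>u. (\<forall>i\<in>I. u i \<in> S i) \<and> x = (\<Sum>i\<in>I. u i)"
  by (simp add: ksum_def)

definition shift :: "'a::field^'m^'m::finite \<Rightarrow> 'a \<Rightarrow> 'a^'m \<Rightarrow> 'a^'m" where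
  "shift B c = (\<lambda>u. B *v u - c *s u)"

lemma gen_eigenspace_shift: "gen_eigenspace B c = {v. \<exists>k. (shift B c ^^ k) v = 0}"
  by (simp add: gen_eigenspace_def shift_def)

lemma scaleR_eq_smult: "r *\<^sub>R (x::complex^'m) = of_real r *s x"
  by (simp add: vec_eq_iff complex_eq_iff)

lemma vec_subspace_imp_subspace:
  "vec.subspace S \<Longrightarrow> subspace (S :: (complex^'m) set)"
  by (simp add: subspace_def vec.subspace_def scaleR_eq_smult)

lemma shift_linear: "Vector_Spaces.linear (*s) (*s) (shift B c)"
  by unfold_locales
    (auto simp: shift_def vec.add vec.scale vec_eq_iff algebra_simps)

lemma shift_pow_linear: "Vector_Spaces.linear (*s) (*s) (shift B c ^^ k)"
proof (induction k)
  case 0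
  show ?case by unfold_locales (auto simp: vec_eq_iff algebra_simps)
next
  case (Suc k)
  show ?case using Vector_Spaces.linear_compose[OF Suc shift_linear] by (simp add: o_def comp_def)
qed

lemmas shift_pow_simps =
  vec.linear_add[OF shift_pow_linear] vec.linear_scale[OF shift_pow_linear]
  vec.linear_0[OF shift_pow_linear] vec.linear_diff[OF shift_pow_linear]
  vec.linear_sum[OF shift_pow_linear] vec.linear_neg[OF shift_pow_linear]

lemmas shift_simps =
  vec.linear_add[OF shift_linear] vec.linear_scale[OF shift_linear]
  vec.linear_0[OF shift_linear] vec.linear_diff[OF shift_linear]
  vec.linear_sum[OF shift_linear] vec.linear_neg[OF shift_linear]

lemma shift_commute: "shift B c (shift B d u) = shift B d (shift B c u)"
  by (simp add: shift_def vec.diff vec.scale vec_eq_iff algebra_simps)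

lemma shift_pow_commute: "(shift B c ^^ k) (shift B d u) = shift B d ((shift B c ^^ k) u)"
  by (induction k) (auto simp: shift_commute)

lemma shift_pow_zero_mono: "(shift B c ^^ k) v = 0 \<Longrightarrow> k \<le> l \<Longrightarrow> (shift B c ^^ l) v = 0"
  by (auto simp: shift_pow_simps funpow_add dest!: le_Suc_ex simp: add.commute[of k])

lemma vec_subspace_gen_eigenspace: "vec.subspace (gen_eigenspace B c)"
proof -
  have "x + y \<in> gen_eigenspace B c" if x: "x \<in> gen_eigenspace B c" and y: "y \<in> gen_eigenspace B c" for x y
  proof -
    obtain k l where "(shift B c ^^ k) x = 0" "(shift B c ^^ l) y = 0"
      using x y by (auto simp: gen_eigenspace_shift)
    then have "(shift B c ^^ max k l) x = 0" "(shift B c ^^ max k l) y = 0"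
      using shift_pow_zero_mono by (meson max.cobounded1 max.cobounded2)+
    then show ?thesis by (auto simp: gen_eigenspace_shift shift_pow_simps intro: exI[of _ "max k l"])
  qed
  moreover have "0 \<in> gen_eigenspace B c" by (auto simp: gen_eigenspace_shift shift_pow_simps)
  ultimately show ?thesis
    unfolding vec.subspace_def by (auto simp: gen_eigenspace_shift shift_pow_simps)
qed

lemma subspace_gen_eigenspace: "subspace (gen_eigenspace (B::complex^'m::finite^'m) c)"
  by (simp add: vec_subspace_imp_subspace vec_subspace_gen_eigenspace)

lemma shift_gen_eigenspace: "u \<in> gen_eigenspace B c \<Longrightarrow> shift B d u \<in> gen_eigenspace B c"
  unfolding gen_eigenspace_shift mem_Collect_eq shift_pow_commute by (metis shift_simps(3))

lemma shift_pow_gen_eigenspace: "u \<in> gen_eigenspace B c \<Longrightarrow> (shift B d ^^ k) u \<in> gen_eigenspace B c"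
  by (induction k) (auto simp: shift_gen_eigenspace)

text \<open>On the generalized eigenspace \<open>t\<close> times \<open>B - c\<close> is nilpotent
  and has no nonzero eigenvalue \<open>d\<close>. The factor \<open>t\<close> is there for the
  deformation in \<open>det_gen_eigenspaces\<close>; \<open>shift_inj\<close> is the case
  \<open>t = 1\<close>.\<close>

lemma scaled_shift_inj:
  assumes "u \<in> gen_eigenspace B c" "t *s shift B c u = d *s u" "d \<noteq> 0"
  shows "u = 0"
proof -
  have "t ^ k *s (shift B c ^^ k) u = d ^ k *s u" for k
  proof (induction k)
    case (Suc k)
    have "t ^ Suc k *s (shift B c ^^ Suc k) u = t *s shift B c (t ^ k *s (shift B c ^^ k) u)"
      by (simp add: shift_simps)
    also have "\<dots> = d ^ k *s (t *s shift B c u)"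
      unfolding Suc by (simp add: shift_simps vec_eq_iff algebra_simps)
    also have "\<dots> = d ^ Suc k *s u" unfolding assms(2) by (simp add: mult.commute)
    finally show ?case .
  qed simp
  then show ?thesis
    using assms by (auto simp: gen_eigenspace_shift) (metis power_not_zero vec.scale_eq_0_iff)
qed

lemma shift_inj:
  assumes "u \<in> gen_eigenspace B d" "c \<noteq> d" "shift B c u = 0"
  shows "u = 0"
proof (rule scaled_shift_inj[OF assms(1), of 1 "c - d"])
  show "1 *s shift B d u = (c - d) *s u"
    using assms(3) by (simp add: shift_def vec_eq_iff algebra_simps)
qed (use assms in auto)

lemma shift_pow_inj:
  assumes "u \<in> gen_eigenspace B d" "c \<noteq> d" "(shift B c ^^ k) u = 0"
  shows "u = 0"
  using assms(3)
proof (induction k)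
  case (Suc k)
  then show ?case
    using shift_inj[OF shift_pow_gen_eigenspace[OF assms(1)] assms(2)] by simp
qed simp

text \<open>Induction on the nilpotency order of \<open>u\<close> under \<open>B - d\<close>. The
  operators \<open>B - c\<close> and \<open>B - d\<close> differ by the scalar \<open>d - c\<close>,
  so a preimage \<open>w\<close> of \<open>(B - d) u\<close>, a vector of smaller order, yields the
  preimage \<open>(u - w) / (d - c)\<close> of \<open>u\<close>.\<close>

lemma shift_surj:
  assumes "u \<in> gen_eigenspace B d" "c \<noteq> d"
  shows "\<exists>v\<in>gen_eigenspace B d. shift B c v = u"
proof -
  have sub: "vec.subspace (gen_eigenspace B d)" by (rule vec_subspace_gen_eigenspace)
  have "\<exists>v\<in>gen_eigenspace B d. shift B c v = u"
    if "(shift B d ^^ k) u = 0" "u \<in> gen_eigenspace B d" for k u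
    using that
  proof (induction k arbitrary: u)
    case 0
    then show ?case using vec.subspace_0[OF sub] by (auto simp: shift_simps intro!: bexI[of _ 0])
  next
    case (Suc k)
    have "(shift B d ^^ k) (shift B d u) = 0"
      using Suc.prems(1) by (simp add: shift_pow_commute)
    then obtain w where w: "w \<in> gen_eigenspace B d" "shift B c w = shift B d u"
      using Suc.IH shift_gen_eigenspace[OF Suc.prems(2)] by blast
    let ?v = "(1 / (d - c)) *s (u - w)"
    have "shift B c ?v = (1 / (d - c)) *s (shift B c u - shift B d u)"
      by (simp add: shift_simps w)
    also have "shift B c u - shift B d u = (d - c) *s u"
      by (simp add: shift_def vec_eq_iff algebra_simps)
    also have "(1 / (d - c)) *s ((d - c) *s u) = u"
    proof -
      have "1 / (d - c) * (d - c) = 1" using assms(2) by simp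
      then show ?thesis by (simp only: vec.scale_scale vec.scale_one)
    qed
    finally show ?case
      using w Suc.prems(2) by (intro bexI[of _ ?v]) (auto intro!: vec.subspace_scale vec.subspace_diff sub)
  qed
  then show ?thesis using assms(1) by (auto simp: gen_eigenspace_shift)
qed

lemma gen_eigenspace_trivial:
  assumes "\<not> is_eigenvalue B c"
  shows "gen_eigenspace B c = {0}"
proof
  show "{0} \<subseteq> gen_eigenspace B c" using vec.subspace_0[OF vec_subspace_gen_eigenspace] by auto
  have "v = 0" if "(shift B c ^^ k) v = 0" for k v
    using that
  proof (induction k)
    case (Suc k)
    then show ?case using assms by (auto simp: shift_def is_eigenvalue_def)
  qed simp
  then show "gen_eigenspace B c \<subseteq> {0}" by (auto simp: gen_eigenspace_shift)
qed

lemma eigenvector_in_gen_eigenspace: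
  assumes "B *v v = c *s v" shows "v \<in> gen_eigenspace B c"
  unfolding gen_eigenspace_shift mem_Collect_eq
  by (rule exI[of _ 1]) (simp add: shift_def assms)

text \<open>A power of \<open>B - j\<close> kills the component at \<open>j\<close>, preserves the
  other generalized eigenspaces and is injective on them; this reduces a relation to the smaller
  family.\<close>

lemma indep_gen_eigenspaces:
  assumes "finite F"
  shows "indep_family F (gen_eigenspace (B::complex^'m::finite^'m))"
  using assms
proof (induction F)
  case empty
  then show ?case by (simp add: indep_family_def)
next
  case (insert j F)
  show ?case unfolding indep_family_def
  proof (intro allI impI)
    fix u assume u: "(\<forall>i\<in>insert j F. u i \<in> gen_eigenspace B i) \<and> sum u (insert j F) = 0"
    then obtain k where k: "(shift B j ^^ k) (u j) = 0" by (auto simp: gen_eigenspace_shift)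
    have "(shift B j ^^ k) (sum u (insert j F)) = 0" using u by (simp add: shift_pow_simps)
    then have "(\<Sum>i\<in>F. (shift B j ^^ k) (u i)) = 0"
      using k insert.hyps by (simp add: shift_pow_simps)
    then have "\<forall>i\<in>F. (shift B j ^^ k) (u i) = 0"
      using insert.IH[unfolded indep_family_def, rule_format, of "\<lambda>i. (shift B j ^^ k) (u i)"]
        u shift_pow_gen_eigenspace by blast
    then have z: "\<forall>i\<in>F. u i = 0" using u shift_pow_inj insert.hyps by (metis insertCI)
    then have "u j = 0" using u insert.hyps by simp
    then show "\<forall>i\<in>insert j F. u i = 0" using z by simp
  qed
qed

text \<open>Generalized eigenspaces of eigenvalues are nonzero and independent, so the dimension
  bounds their number.\<close>

lemma finite_eigenvalues: "finite (eigenvalues (B::complex^'m::finite^'m))"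
proof (rule finite_if_finite_subsets_card_bdd[THEN conjunct1])
  fix F assume F: "F \<subseteq> eigenvalues B" "finite F"
  have "1 \<le> dim (gen_eigenspace B c)" if "c \<in> F" for c
  proof -
    obtain v where v: "v \<noteq> 0" "B *v v = c *s v"
      using F \<open>c \<in> F\<close> by (auto simp: is_eigenvalue_def)
    then have "v \<in> gen_eigenspace B c" by (intro eigenvector_in_gen_eigenspace)
    with v have "\<not> gen_eigenspace B c \<subseteq> {0}" by blast
    then show ?thesis using dim_eq_0[of "gen_eigenspace B c"] by linarith
  qed
  then have "card F \<le> (\<Sum>c\<in>F. dim (gen_eigenspace B c))"
    using sum_mono[of F "\<lambda>_. 1" "\<lambda>c. dim (gen_eigenspace B c)"] by simp
  also have "\<dots> = dim (ksum F (gen_eigenspace B))"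
    using F by (simp add: dim_ksum subspace_gen_eigenspace indep_gen_eigenspaces)
  also have "\<dots> \<le> DIM(complex^'m)" by (rule dim_subset_UNIV)
  finally show "card F \<le> DIM(complex^'m)" .
qed

text \<open>The vector \<open>p(B) v\<close>, evaluated by Horner's scheme; only products of
  \<open>B\<close> with vectors occur.\<close>

definition pact :: "complex^'m^'m::finite \<Rightarrow> complex poly \<Rightarrow> complex^'m \<Rightarrow> complex^'m" where
  "pact B p v = fold_coeffs (\<lambda>a f. a *s v + B *v f) p 0"

lemma pact_0 [simp]: "pact B 0 v = 0" by (simp add: pact_def)

lemma pact_pCons [simp]: "pact B (pCons a p) v = a *s v + B *v pact B p v"
  by (cases "a = 0 \<and> p = 0") (auto simp: pact_def vec_eq_iff)

lemma pact_add: "pact B (p + q) v = pact B p v + pact B q v"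
proof (induction p arbitrary: q)
  case (pCons a p)
  obtain b q' where q: "q = pCons b q'" by (cases q)
  show ?case by (simp add: q pCons.IH vec.add vec.scale_left_distrib)
qed simp

lemma pact_smult: "pact B (smult c p) v = c *s pact B p v"
  by (induction p) (auto simp: vec.scale vec.scale_right_distrib)

lemma pact_sum: "pact B (\<Sum>i\<in>I. p i) v = (\<Sum>i\<in>I. pact B (p i) v)"
  by (induction I rule: infinite_finite_induct) (auto simp: pact_add)

lemma pact_monom: "pact B (monom c k) v = c *s (((*v) B ^^ k) v)"
  by (induction k) (auto simp: monom_0 monom_Suc vec.scale)

lemma pact_shift: "pact B p (shift B r v) = shift B r (pact B p v)"
proof (induction p)
  case (pCons a p)
  have "B *v shift B r x = shift B r (B *v x)" for x
    by (simp add: shift_def vec.diff vec.scale)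
  with pCons show ?case by (simp add: shift_simps)
qed (simp add: shift_simps)

lemma pact_linear_factor: "pact B ([:- r, 1:] * q) v = pact B q (shift B r v)"
proof -
  have "[:- r, 1:] * q = smult (- r) q + pCons 0 q" by simp
  then have "pact B ([:- r, 1:] * q) v = shift B r (pact B q v)"
    by (simp only: pact_add pact_smult pact_pCons) (simp add: shift_def vec_eq_iff)
  then show ?thesis by (simp add: pact_shift)
qed

lemma annihilating_polynomial: "\<exists>p. p \<noteq> 0 \<and> pact B p (v::complex^'m::finite) = 0"
proof -
  define f where "f = (\<lambda>k. (((*v) B) ^^ k) v)"
  let ?I = "{..CARD('m)}"
  show ?thesis
  \<comment> \<open>Linear dependence is a property of sets and does not see repetitions among the
    iterates. If two iterates coincide, a difference of monomials annihilates \<open>v\<close>;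
    otherwise there are more distinct vectors than the dimension.\<close>
  proof (cases "inj_on f ?I")
    case False
    then obtain i j where ij: "i \<noteq> j" "f i = f j" by (auto simp: inj_on_def)
    have "coeff (monom 1 i - monom (1::complex) j) i = 1" using ij by simp
    then have "monom 1 i - monom (1::complex) j \<noteq> 0" by fastforce
    moreover have "pact B (monom 1 i + monom (-1) j) v = 0"
      using ij by (simp add: pact_add pact_monom f_def)
    ultimately show ?thesis by (metis minus_monom uminus_add_conv_diff add.commute)
  next
    case True
    have "vec.dim (f ` ?I) < card (f ` ?I)"
      using card_image[OF True] dim_subset_UNIV_cart_gen[of "f ` ?I"] by simp
    then have "vec.dependent (f ` ?I)"
      using vec.dim_eq_card_independent by fastforce
    then obtain u where u: "\<exists>w\<in>f ` ?I. u w \<noteq> 0" "(\<Sum>w\<in>f ` ?I. u w *s w) = 0"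
      using vec.dependent_finite[of "f ` ?I"] by auto
    define p where "p = (\<Sum>i\<in>?I. monom (u (f i)) i)"
    have "pact B p v = (\<Sum>i\<in>?I. u (f i) *s f i)"
      by (simp add: p_def pact_sum pact_monom f_def)
    also have "\<dots> = 0" using u(2) sum.reindex[OF True, of "\<lambda>w. u w *s w"] by simp
    finally have pv: "pact B p v = 0" .
    obtain i where i: "i \<in> ?I" "u (f i) \<noteq> 0" using u by auto
    have "coeff p i = (\<Sum>j\<in>?I. if j = i then u (f j) else 0)"
      by (simp add: p_def coeff_sum eq_commute)
    also have "\<dots> = u (f i)" using i by simp
    finally have "p \<noteq> 0" using i by auto
    then show ?thesis using pv by blast
  qed
qed

text \<open>An annihilating polynomial of \<open>v\<close> splits into linear factors, which are
  stripped one at a time: \<open>?W\<close> contains \<open>v\<close> as soon as it contains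
  \<open>(B - c) v\<close>. A root \<open>c\<close> need not be an eigenvalue; its generalized
  eigenspace is then \<open>{0}\<close>.\<close>

lemma gen_eigenspaces_span: "ksum (eigenvalues B) (gen_eigenspace B) = UNIV"
  for B :: "complex^'m::finite^'m"
proof -
  let ?L = "eigenvalues B" let ?E = "gen_eigenspace B" let ?W = "ksum ?L ?E"
  have fin: "finite ?L" by (rule finite_eigenvalues)
  have subW: "subspace ?W" by (intro subspace_ksum subspace_gen_eigenspace)
  have EW: "?E c \<subseteq> ?W" for c
  proof (cases "c \<in> ?L")
    case True
    show ?thesis
    proof
      fix x assume x: "x \<in> ?E c"
      have "(\<Sum>i\<in>?L. if i = c then x else 0) \<in> ?W"
        using x by (intro ksumI) (auto intro: subspace_0 subspace_gen_eigenspace)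
      then show "x \<in> ?W" using True fin by simp
    qed
  qed (use gen_eigenspace_trivial[of B c] subspace_0[OF subW] in auto)
  \<comment> \<open>The components of \<open>(B - c) v\<close> away from \<open>c\<close> have
    preimages \<open>w i\<close> under \<open>B - c\<close>. With \<open>w c = 0\<close>, the
    difference of \<open>v\<close> and their sum is mapped into the generalized eigenspace of
    \<open>c\<close>, hence already lies in it.\<close>
  have step: "v \<in> ?W" if v: "shift B c v \<in> ?W" for c v
  proof -
    obtain u where "\<forall>i\<in>?L. u i \<in> ?E i" "shift B c v = (\<Sum>i\<in>?L. u i)"
      using ksumD[OF v] by blast
    note u = bspec[OF this(1)] this(2)
    have "\<exists>w. w \<in> ?E i \<and> (i \<noteq> c \<longrightarrow> shift B c w = u i) \<and> (i = c \<longrightarrow> w = 0)" if "i \<in> ?L" for i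
      using shift_surj[OF u(1)[OF that], of c] subspace_0[OF subspace_gen_eigenspace[of B i]]
      by (cases "i = c") auto
    then obtain w where w: "\<And>i. i \<in> ?L \<Longrightarrow> w i \<in> ?E i"
      "\<And>i. i \<in> ?L \<Longrightarrow> i \<noteq> c \<Longrightarrow> shift B c (w i) = u i" "c \<in> ?L \<Longrightarrow> w c = 0"
      by metis
    have "shift B c (v - (\<Sum>i\<in>?L. w i)) = (\<Sum>i\<in>?L. u i - shift B c (w i))"
      by (simp add: shift_simps u sum_subtractf)
    also have "\<dots> = (\<Sum>i\<in>?L. if i = c then u c else 0)"
      using w by (intro sum.cong) (auto simp: shift_simps)
    also have "\<dots> \<in> ?E c"
      using fin u subspace_0[OF subspace_gen_eigenspace[of B c]] by auto
    finally obtain k where "(shift B c ^^ k) (shift B c (v - (\<Sum>i\<in>?L. w i))) = 0"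
      by (auto simp: gen_eigenspace_shift)
    then have "(shift B c ^^ Suc k) (v - (\<Sum>i\<in>?L. w i)) = 0"
      by (simp add: shift_pow_commute)
    then have "v - (\<Sum>i\<in>?L. w i) \<in> ?W" using EW by (auto simp only: gen_eigenspace_shift)
    moreover have "(\<Sum>i\<in>?L. w i) \<in> ?W" using w by (intro ksumI) auto
    ultimately show ?thesis using subspace_add[OF subW] by fastforce
  qed
  have ann: "v \<in> ?W" if "pact B (\<Prod>x\<in>#A. [:-x, 1:]) v = 0" for A v
    using that
  proof (induction A arbitrary: v)
    case empty
    then have "v = 0" by (simp add: one_pCons vec_eq_iff)
    then show ?case using subspace_0[OF subW] by simp
  next
    case (add x A)
    then have "pact B (\<Prod>x\<in>#A. [:-x, 1:]) (shift B x v) = 0"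
      using pact_linear_factor[of B x] by simp
    then show ?case using add.IH step by blast
  qed
  have "v \<in> ?W" for v
  proof -
    obtain p where p: "p \<noteq> 0" "pact B p v = 0" using annihilating_polynomial by blast
    obtain A where A: "p = smult (lead_coeff p) (\<Prod>x\<in>#A. [:-x, 1:])"
      using alg_closed_imp_factorization[OF p(1)] by blast
    have "lead_coeff p *s pact B (\<Prod>x\<in>#A. [:-x, 1:]) v = 0"
      using p(2) A pact_smult by metis
    then show ?thesis using p(1) by (intro ann[of A]) simp
  qed
  then show ?thesis by blast
qed

lemma sum_dim_gen_eigenspaces:
  "(\<Sum>c\<in>eigenvalues B. dim (gen_eigenspace B c)) = 2 * CARD('m)" for B :: "complex^'m::finite^'m"
  using dim_ksum[OF finite_eigenvalues subspace_gen_eigenspace indep_gen_eigenspaces, of B B]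
  by (simp add: finite_eigenvalues gen_eigenspaces_span)

text \<open>A complex basis splits the subspace into complex lines of real dimension two. This links
  the real dimensions counted by \<open>m_plus\<close> to complex multiplicities.\<close>

lemma real_dim_complex_subspace:
  fixes S :: "(complex^'m::finite) set"
  assumes S: "vec.subspace S"
  shows "dim S = 2 * vec.dim S"
proof -
  obtain b where b: "b \<subseteq> S" "vec.independent b" "S \<subseteq> vec.span b" "card b = vec.dim S"
    using vec.basis_exists[of S] by metis
  have fb: "finite b" using b(2) vec.finiteI_independent by blast
  have span: "vec.span b = S" using b S by (simp add: vec.span_subspace)
  define L where "L = (\<lambda>x::complex^'m. range (\<lambda>c. c *s x))"
  have lin: "linear (\<lambda>c. c *s x)" for x :: "complex^'m"
    by (rule linearI) (auto simp: vec_eq_iff algebra_simps)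
  have subL: "subspace (L x)" for x
    unfolding L_def by (rule linear_subspace_image[OF lin]) auto
  have "x \<noteq> 0" if "x \<in> b" for x using that b(2) vec.dependent_zero by blast
  then have "inj (\<lambda>c. c *s x)" if "x \<in> b" for x
    using that by (simp add: inj_def)
  then have dimL: "dim (L x) = 2" if "x \<in> b" for x
    using that dim_image_eq[OF lin, of x UNIV] by (simp add: L_def)
  have "indep_family b L"
    unfolding indep_family_def
  proof (intro allI impI)
    fix u assume u: "(\<forall>i\<in>b. u i \<in> L i) \<and> sum u b = 0"
    then have "\<forall>i\<in>b. \<exists>c. u i = c *s i" by (auto simp: L_def)
    then obtain c where c: "\<And>i. i \<in> b \<Longrightarrow> u i = c i *s i" using bchoice by metis
    then have "(\<Sum>i\<in>b. c i *s i) = 0" using u by simp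
    then have "\<forall>i\<in>b. c i = 0" using b(2) vec.dependent_finite[OF fb] by blast
    then show "\<forall>i\<in>b. u i = 0" using c by simp
  qed
  then have "dim (ksum b L) = 2 * card b"
    using dim_ksum[OF fb subL] dimL by simp
  moreover have "ksum b L = S"
  proof
    show "ksum b L \<subseteq> S"
    proof
      fix x assume "x \<in> ksum b L"
      then obtain u where "\<forall>i\<in>b. u i \<in> L i" "x = (\<Sum>i\<in>b. u i)"
      using ksumD by blast
    note u = bspec[OF this(1)] this(2)
      have "u i \<in> S" if "i \<in> b" for i
      proof -
        have "i \<in> S" using that b(1) by blast
        then show ?thesis using u(1)[OF that] vec.subspace_scale[OF S] by (auto simp: L_def)
      qed
      then show "x \<in> S" using u(2) S by (auto intro: vec.subspace_sum)
    qed
    show "S \<subseteq> ksum b L"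
    proof
      fix x assume "x \<in> S"
      then obtain c where "x = (\<Sum>i\<in>b. c i *s i)" using span vec.span_finite[OF fb] by auto
      then show "x \<in> ksum b L" by (auto simp: L_def intro!: ksumI)
    qed
  qed
  ultimately show ?thesis using b(4) by simp
qed

section \<open>The determinant as a product over generalized eigenspaces\<close>

lemma det_nonzero_iff: "det M \<noteq> 0 \<longleftrightarrow> (\<forall>x. M *v x = 0 \<longrightarrow> x = 0)"
  for M :: "'a::field^'m::finite^'m"
  using invertible_det_nz[of M] invertible_left_inverse[of M] matrix_left_invertible_ker[of M] by simp

lemma poly_det: "poly (det P) t = det (\<chi> i j. poly (P $ i $ j) t)"
  for P :: "'a::comm_ring_1 poly^'m::finite^'m"
proof -
  have "poly (of_int s) t = of_int s" for s :: int by (simp add: of_int_poly)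
  then show ?thesis by (simp add: det_def poly_sum poly_prod)
qed

text \<open>Along \<open>D + t (M - D)\<close>, with \<open>D\<close> the semisimple part of \<open>M\<close>, the determinant is a polynomial
  in \<open>t\<close> without complex roots, hence constant.\<close>

lemma det_gen_eigenspaces:
  fixes M :: "complex^'m::finite^'m"
  shows "det M = (\<Prod>c\<in>eigenvalues M. c ^ vec.dim (gen_eigenspace M c))"
proof (cases "0 \<in> eigenvalues M")
  case True
  then obtain v where v: "v \<noteq> 0" "M *v v = 0" by (auto simp: is_eigenvalue_def)
  then have "det M = 0" using det_nonzero_iff by blast
  moreover have "v \<in> gen_eigenspace M 0" using v by (intro eigenvector_in_gen_eigenspace) simp
  then have "vec.dim (gen_eigenspace M 0) \<noteq> 0"
    using v vec.dim_eq_0[of "gen_eigenspace M 0"] by blast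
  then have "(\<Prod>c\<in>eigenvalues M. c ^ vec.dim (gen_eigenspace M c)) = 0"
    using True finite_eigenvalues[of M] by (intro prod_zero) (auto intro!: bexI[of _ 0])
  ultimately show ?thesis by simp
next
  case False
  let ?L = "eigenvalues M" let ?G = "gen_eigenspace M"
  have fin: "finite ?L" by (rule finite_eigenvalues)
  have "\<exists>b. b \<subseteq> ?G c \<and> vec.independent b \<and> ?G c \<subseteq> vec.span b \<and> card b = vec.dim (?G c)" for c
    using vec.basis_exists[of "?G c"] by metis
  then obtain b where b: "\<And>c. b c \<subseteq> ?G c" "\<And>c. vec.independent (b c)"
    "\<And>c. ?G c \<subseteq> vec.span (b c)" "\<And>c. card (b c) = vec.dim (?G c)"
    by metis
  have finb: "finite (b c)" for c using b(2) vec.finiteI_independent by blast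
  define BB where "BB = (\<Union>c\<in>?L. b c)"
  have disj: "b c \<inter> b d = {}" if "c \<noteq> d" for c d
  proof (rule ccontr)
    assume "b c \<inter> b d \<noteq> {}"
    then obtain x where x: "x \<in> b c" "x \<in> b d" by blast
    then have "x \<in> ?G c" "x \<in> ?G d" using b(1) by blast+
    then have "x = 0" using that by (auto simp: gen_eigenspace_shift[of M c] dest: shift_pow_inj)
    then show False using x b(2) vec.dependent_zero by blast
  qed
  have cardBB: "card BB = (\<Sum>c\<in>?L. vec.dim (?G c))"
    unfolding BB_def using fin finb disj b(4) by (subst card_UN_disjoint) auto
  have "2 * card BB = (\<Sum>c\<in>?L. dim (?G c))"
    by (simp add: cardBB sum_distrib_left real_dim_complex_subspace vec_subspace_gen_eigenspace)
  then have "card BB = CARD('m)" using sum_dim_gen_eigenspaces[of M] by simp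
  moreover have "finite BB" using fin finb by (simp add: BB_def)
  ultimately obtain f where f: "bij_betw f (UNIV::'m set) BB"
    using finite_same_card_bij[of "UNIV::'m set" BB] by auto
  have "\<exists>c. c \<in> ?L \<and> x \<in> b c" if "x \<in> BB" for x using that by (auto simp: BB_def)
  then obtain ev where ev: "\<And>x. x \<in> BB \<Longrightarrow> ev x \<in> ?L" "\<And>x. x \<in> BB \<Longrightarrow> x \<in> b (ev x)" by metis
  have fB: "f i \<in> BB" for i using f by (auto simp: bij_betw_def)
  define C :: "complex^'m^'m" where "C = (\<chi> r i. f i $ r)"
  have colC: "column i C = f i" for i by (simp add: C_def column_def vec_eq_iff)
  have "vec.span (columns C) = UNIV"
  proof -
    have "columns C = BB" using f colC by (auto simp: columns_def bij_betw_def)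
    moreover have "?G c \<subseteq> vec.span BB" if "c \<in> ?L" for c
      using b(3)[of c] vec.span_mono[of "b c" BB] that by (auto simp: BB_def)
    then have "ksum ?L ?G \<subseteq> vec.span BB"
      by (auto elim!: ksumE intro!: vec.span_sum)
    ultimately show ?thesis using gen_eigenspaces_span[of M] by auto
  qed
  then obtain Ci where "C ** Ci = mat 1"
    using matrix_right_invertible_span_columns[of C] by blast
  then have Ci: "C ** Ci = mat 1" "Ci ** C = mat 1" by (simp_all add: matrix_left_right_inverse)
  define dg :: "complex^'m^'m" where "dg = (\<chi> i j. if i = j then ev (f i) else 0)"
  define D where "D = C ** dg ** Ci"
  have DC: "D ** C = C ** dg" by (simp add: D_def matrix_mul_assoc[symmetric] Ci)
  have Df: "D *v f i = ev (f i) *s f i" for i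
  proof -
    have "D *v f i = column i (D ** C)"
      by (simp add: vec_eq_iff matrix_vector_mult_def matrix_matrix_mult_def column_def C_def)
    also have "\<dots> = ev (f i) *s f i"
      unfolding DC by (simp add: vec_eq_iff matrix_matrix_mult_def column_def C_def dg_def if_distrib cong: if_cong)
    finally show ?thesis .
  qed
  have DG: "D *v x = c *s x" if "x \<in> ?G c" "c \<in> ?L" for x c
  proof -
    have "D *v y = c *s y" if y: "y \<in> b c" for y
    proof -
      have yB: "y \<in> BB" using y \<open>c \<in> ?L\<close> by (auto simp: BB_def)
      then obtain i where i: "f i = y" using f by (auto simp: bij_betw_def)
      have "ev y = c" using ev[OF yB] y disj by blast
      then show ?thesis using Df[of i] i by simp
    qed
    moreover have "x \<in> vec.span (b c)" using that b(3) by blast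
    moreover have "vec.subspace {y. D *v y = c *s y}"
      by (auto simp: vec.subspace_def vec.add vec.scale vec_eq_iff algebra_simps)
    ultimately show ?thesis using vec.span_minimal[of "b c" "{y. D *v y = c *s y}"] by blast
  qed
  define p where "p = det ((\<chi> i j. [:D $ i $ j, M $ i $ j - D $ i $ j:]) :: complex poly^'m^'m)"
  have pt: "poly p t = det (\<chi> i j. D $ i $ j + t * (M $ i $ j - D $ i $ j))" for t
    by (simp add: p_def poly_det)
  have "poly p t \<noteq> 0" for t
  proof -
    let ?T = "(\<chi> i j. D $ i $ j + t * (M $ i $ j - D $ i $ j)) :: complex^'m^'m"
    have T: "?T *v x = D *v x + t *s (M *v x - D *v x)" for x
      by (simp add: vec_eq_iff matrix_vector_mult_def sum_distrib_left
        sum.distrib sum_subtractf algebra_simps)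
    have "x = 0" if x: "?T *v x = 0" for x
    proof -
      have "x \<in> ksum ?L ?G" by (simp add: gen_eigenspaces_span)
      then obtain u where "\<forall>c\<in>?L. u c \<in> ?G c" "x = (\<Sum>c\<in>?L. u c)"
      using ksumD by blast
    note u = bspec[OF this(1)] this(2)
      have Tu: "?T *v u c = c *s u c + t *s shift M c (u c)" if "c \<in> ?L" for c
        using DG[OF u(1)[OF that] that] by (simp add: T shift_def)
      have "(\<Sum>c\<in>?L. ?T *v u c) = 0" using x by (simp add: u(2) vec.sum)
      moreover have "?T *v u c \<in> ?G c" if "c \<in> ?L" for c
        unfolding Tu[OF that]
        by (intro vec.subspace_add vec.subspace_scale vec_subspace_gen_eigenspace
          shift_gen_eigenspace u that)
      ultimately have Z: "\<forall>c\<in>?L. ?T *v u c = 0"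
        using indep_gen_eigenspaces[OF fin, of M, unfolded indep_family_def, rule_format,
          of "\<lambda>c. ?T *v u c"] by blast
      \<comment> \<open>On this summand \<open>?T\<close> is the scalar \<open>c\<close> plus
        \<open>t\<close> times a nilpotent map, and \<open>c\<close> is nonzero.\<close>
      have "u c = 0" if c: "c \<in> ?L" for c
      proof (rule scaled_shift_inj[OF u(1)[OF c]])
        show "t *s shift M c (u c) = (- c) *s u c"
          using Z[rule_format, OF c] unfolding Tu[OF c] by (simp add: eq_neg_iff_add_eq_0 add.commute)
        show "- c \<noteq> 0" using False c by auto
      qed
      then show ?thesis using u(2) by simp
    qed
    then show ?thesis unfolding pt using det_nonzero_iff by blast
  qed
  then have "constant (poly p)" using fundamental_theorem_of_algebra by blast
  then have "poly p 1 = poly p 0" by (auto simp: constant_def)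
  then have "det M = det D" by (simp add: pt)
  also have "\<dots> = det dg"
    using arg_cong[OF Ci(1), of det] by (simp add: D_def det_mul)
  also have "\<dots> = (\<Prod>i\<in>UNIV. ev (f i))" by (subst det_diagonal) (auto simp: dg_def)
  also have "\<dots> = (\<Prod>x\<in>BB. ev x)" using f by (rule prod.reindex_bij_betw)
  also have "\<dots> = (\<Prod>c\<in>?L. \<Prod>x\<in>b c. ev x)"
    unfolding BB_def using fin finb disj by (intro prod.UNION_disjoint) auto
  also have "\<dots> = (\<Prod>c\<in>?L. \<Prod>x\<in>b c. c)"
  proof (intro prod.cong refl)
    fix c x assume "c \<in> ?L" "x \<in> b c"
    then have "x \<in> BB" by (auto simp: BB_def)
    then show "ev x = c" using ev disj \<open>x \<in> b c\<close> by blast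
  qed
  also have "\<dots> = (\<Prod>c\<in>?L. c ^ vec.dim (?G c))" by (simp add: b(4))
  finally show ?thesis .
qed

section \<open>The Krein form and invariant nonnegative subspaces\<close>

lemma sum_UNIV_sum: "(\<Sum>i\<in>(UNIV::('a::finite+'b::finite) set). f i) = (\<Sum>i\<in>UNIV. f (Inl i)) + (\<Sum>i\<in>UNIV. f (Inr i))"
  using sum.Plus[of UNIV UNIV f] by (simp add: comp_def)

lemma symp_form_eq:
  "symp_form v w = (\<Sum>k\<in>UNIV. v $ Inl k * w $ Inr k - v $ Inr k * w $ Inl k)"
proof -
  have "symp_form v w = (\<Sum>k\<in>UNIV. v $ Inl k * w $ Inr k) + (\<Sum>k\<in>UNIV. - (v $ Inr k * w $ Inl k))"
    by (simp add: symp_form_def sum_UNIV_sum Omega0_def block_matrix_def mat_def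
        if_distrib if_distribR sum_negf sum.If_cases cong: if_cong)
  then show ?thesis by (simp add: sum_negf sum_subtractf)
qed

section \<open>Complex conjugation and complexified real matrices\<close>

definition vcnj :: "complex^'m \<Rightarrow> complex^'m" where
  "vcnj v = (\<chi> i. cnj (v $ i))"

definition cvec :: "real^'m \<Rightarrow> complex^'m" where
  "cvec v = (\<chi> i. complex_of_real (v $ i))"

lemma vcnj_simps [simp]:
  "vcnj v $ i = cnj (v $ i)" "vcnj (v + w) = vcnj v + vcnj w" "vcnj (v - w) = vcnj v - vcnj w"
  "vcnj (c *s v) = cnj c *s vcnj v" "vcnj (vcnj v) = v" "vcnj 0 = 0"
  by (simp_all add: vcnj_def vec_eq_iff)

lemma complexify_nth [simp]: "complexify A $ i $ j = complex_of_real (A $ i $ j)"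
  by (simp add: map_matrix_def)

lemma complexify_mult_vcnj: "complexify A *v vcnj v = vcnj (complexify A *v v)"
  by (simp add: vec_eq_iff matrix_vector_mult_def)

lemma complexify_mult_cvec: "complexify A *v cvec v = cvec (A *v v)"
  by (simp add: vec_eq_iff matrix_vector_mult_def cvec_def)

lemma cvec_decompose: "v = cvec (\<chi> i. Re (v $ i)) + \<i> *s cvec (\<chi> i. Im (v $ i))"
  by (simp add: vec_eq_iff cvec_def complex_eq)

lemma symp_form_bilinear:
  "symp_form (v + v') w = symp_form v w + symp_form v' w"
  "symp_form v (w + w') = symp_form v w + symp_form v w'"
  "symp_form (c *s v) w = c * symp_form v w"
  "symp_form v (c *s w) = c * symp_form v w"
  by (simp_all add: symp_form_eq sum.distrib sum_subtractf sum_distrib_left algebra_simps)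

lemma symp_form_cvec: "symp_form (cvec v) (cvec w) = of_real (symp_form v w)"
  by (simp add: symp_form_eq cvec_def)

lemma Sp_complexify:
  assumes "A \<in> Sp"
  shows "symp_form (complexify A *v v) (complexify A *v w) = symp_form v w"
proof -
  have real: "symp_form (complexify A *v cvec a) (complexify A *v cvec b) = symp_form (cvec a) (cvec b)" for a b
    using assms by (simp add: complexify_mult_cvec symp_form_cvec Sp_def)
  show ?thesis
    by (subst (1 2) cvec_decompose[of v], subst (1 2) cvec_decompose[of w])
      (simp only: vec.add vec.scale symp_form_bilinear real)
qed

text \<open>The sesquilinear extension of the symplectic form. It is skew-Hermitian, so
  \<open>- \<i> * hform\<close> is the Hermitian form, and its real part is the imaginary part of
  \<open>hform\<close>, that is, \<open>Q_form\<close>.\<close>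

definition hform :: "complex^('n::finite + 'n) \<Rightarrow> complex^('n + 'n) \<Rightarrow> complex" where
  "hform v w = symp_form v (vcnj w)"

lemma Q_form_hform: "Q_form v w = Im (hform v w)"
  by (simp add: Q_form_def hform_def vcnj_def)

lemma hform_simps:
  "hform (v + v') w = hform v w + hform v' w" "hform v (w + w') = hform v w + hform v w'"
  "hform (c *s v) w = c * hform v w" "hform v (c *s w) = cnj c * hform v w"
  by (simp_all add: hform_def symp_form_bilinear)

lemma hform_zero [simp]: "hform 0 w = 0" "hform v 0 = 0"
  by (simp_all add: hform_def symp_form_eq)

lemma hform_Sp: "A \<in> Sp \<Longrightarrow> hform (complexify A *v v) (complexify A *v w) = hform v w"
  by (simp add: hform_def complexify_mult_vcnj[symmetric] Sp_complexify)

text \<open>This is \<open>- \<i> J0\<close>, the self-adjoint involution representing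
  \<open>Q_form\<close> in the Euclidean inner product. Its eigenspaces for \<open>1\<close> and
  \<open>-1\<close> both have complex dimension \<open>n\<close>, which is the signature.\<close>

definition Kmap :: "complex^('n::finite + 'n) \<Rightarrow> complex^('n + 'n)" where
  "Kmap v = (\<chi> i. case i of Inl k \<Rightarrow> \<i> * v $ Inr k | Inr k \<Rightarrow> - \<i> * v $ Inl k)"

lemma Kmap_Kmap [simp]: "Kmap (Kmap v) = v"
  by (simp add: Kmap_def vec_eq_iff split: sum.split)

lemma linear_Kmap: "linear Kmap"
  by (rule linearI) (auto simp: Kmap_def vec_eq_iff algebra_simps split: sum.split)

lemma Q_form_inner: "Q_form v w = v \<bullet> Kmap w"
  by (simp add: Q_form_hform hform_def symp_form_eq Kmap_def inner_vec_def sum_UNIV_sum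
      inner_complex_def sum_subtractf sum.distrib sum_negf algebra_simps)

lemma Q_form_sym_bilinear: "sym_bilinear Q_form"
  unfolding sym_bilinear_def
proof (intro conjI allI)
  show "linear (Q_form x)" for x :: "complex^('n::finite + 'n)"
    unfolding Q_form_inner
    by (rule linearI) (simp_all add: linear_add[OF linear_Kmap] linear_scale[OF linear_Kmap] inner_simps)
  show "Q_form x y = Q_form y x" for x y :: "complex^('n::finite + 'n)"
    by (simp add: Q_form_hform hform_def symp_form_eq) (intro sum.cong, auto)
qed

lemmas Q_form_simps = sym_bilinear_simps[OF Q_form_sym_bilinear] sym_bilinear_sum[OF Q_form_sym_bilinear]

lemma Q_form_commute: "Q_form v w = Q_form w v"
  using Q_form_sym_bilinear unfolding sym_bilinear_def by blast

lemma Q_form_nondegenerate: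
  assumes "\<And>w. Q_form v w = 0" shows "v = 0"
proof -
  have "Q_form v (Kmap v) = 0" by (rule assms)
  then show ?thesis by (simp add: Q_form_inner)
qed

text \<open>The range of \<open>f\<close> is the eigenspace of \<open>Kmap\<close> for
  \<open>-1\<close>. There the form is negative definite, so a nonnegative subspace meets it only in
  \<open>0\<close>, and the dimensions add up to at most \<open>4n\<close>.\<close>

lemma nonneg_subspace_dim:
  fixes S :: "(complex^('n::finite + 'n)) set"
  assumes S: "subspace S" and nn: "\<And>x. x \<in> S \<Longrightarrow> Q_form x x \<ge> 0"
  shows "dim S \<le> 2 * CARD('n)"
proof -
  define f :: "complex^'n \<Rightarrow> complex^('n + 'n)" where
    "f = (\<lambda>y. \<chi> i. case i of Inl k \<Rightarrow> - \<i> * y $ k | Inr k \<Rightarrow> y $ k)"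
  have lin: "linear f"
    by (rule linearI) (auto simp: f_def vec_eq_iff algebra_simps split: sum.split)
  have inj: "inj f"
  proof (rule injI)
    fix x y assume "f x = f y"
    then have "f x $ Inr k = f y $ Inr k" for k by simp
    then show "x = y" by (simp add: f_def vec_eq_iff)
  qed
  have sub: "subspace (range f)" using lin by (intro linear_subspace_image) auto
  have dimr: "dim (range f) = 2 * CARD('n)"
    using dim_image_eq[OF lin, of UNIV] inj by simp
  have neg: "Q_form (f y) (f y) = - 2 * (norm y)\<^sup>2" for y
  proof -
    have "Kmap (f y) = - f y"
      by (simp add: Kmap_def f_def vec_eq_iff split: sum.split)
    then have "Q_form (f y) (f y) = - (f y \<bullet> f y)" by (simp add: Q_form_inner)
    also have "f y \<bullet> f y = 2 * (y \<bullet> y)"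
      by (simp add: f_def inner_vec_def sum_UNIV_sum inner_complex_def algebra_simps)
    finally show ?thesis by (simp add: power2_norm_eq_inner)
  qed
  have "S \<inter> range f = {0}"
  proof
    show "S \<inter> range f \<subseteq> {0}"
    proof
      fix x assume x: "x \<in> S \<inter> range f"
      then obtain y where y: "x = f y" by blast
      have "(norm y)\<^sup>2 \<le> 0" using nn[of x] x neg[of y] y by simp
      then have "y = 0" by simp
      then show "x \<in> {0}" using y lin by (simp add: linear_0)
    qed
    show "{0} \<subseteq> S \<inter> range f" using S sub by (auto simp: subspace_0)
  qed
  then have "dim {x + y |x y. x \<in> S \<and> y \<in> range f} = dim S + 2 * CARD('n)"
    using dim_sums_Int[OF S sub] dimr by simp
  moreover have "dim {x + y |x y. x \<in> S \<and> y \<in> range f} \<le> 4 * CARD('n)"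
    using dim_subset_UNIV[of "{x + y |x y. x \<in> S \<and> y \<in> range f}"] by simp
  ultimately show ?thesis by linarith
qed

lemma Q_form_orthogonal_dim:
  fixes Y :: "(complex^('n::finite + 'n)) set"
  assumes Y: "subspace Y"
  shows "dim {v. \<forall>y\<in>Y. Q_form v y = 0} + dim Y = 4 * CARD('n)"
proof -
  have inj: "inj_on Kmap (span Y)" by (metis Kmap_Kmap inj_on_inverseI)
  have sub: "subspace (Kmap ` Y)" by (intro linear_subspace_image linear_Kmap Y)
  have "{v. \<forall>y\<in>Y. Q_form v y = 0} = {v\<in>UNIV. \<forall>x\<in>Kmap ` Y. orthogonal x v}"
    by (auto simp: Q_form_inner orthogonal_def inner_commute)
  then show ?thesis
    using dim_subspace_orthogonal_to_vectors[OF sub subspace_UNIV] dim_image_eq[OF linear_Kmap inj]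
    by simp
qed

text \<open>For eigenvectors, invariance gives \<open>hform u v = c * cnj d * hform u v\<close>. For
  generalized ones, induction on the sum of the two nilpotency orders makes the three additional
  terms vanish.\<close>

lemma hform_gen_eigenspaces:
  assumes A: "A \<in> Sp" and ne: "c * cnj d \<noteq> 1"
    and "u \<in> gen_eigenspace (complexify A) c" "v \<in> gen_eigenspace (complexify A) d"
  shows "hform u v = 0"
proof -
  have "hform u v = 0"
    if "(shift (complexify A) c ^^ k) u = 0" "(shift (complexify A) d ^^ l) v = 0" for k l u v
    using that
  proof (induction "k + l" arbitrary: k l u v rule: less_induct)
    case less
    show ?case
    proof (cases "k = 0 \<or> l = 0")
      case True
      then show ?thesis using less.prems by auto
    next
      case False
      then obtain k' l' where kl: "k = Suc k'" "l = Suc l'" by (meson not0_implies_Suc)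
      define u' where "u' = shift (complexify A) c u"
      define v' where "v' = shift (complexify A) d v"
      have u': "(shift (complexify A) c ^^ k') u' = 0" and v': "(shift (complexify A) d ^^ l') v' = 0"
        using less.prems by (simp_all add: kl u'_def v'_def shift_pow_commute)
      have z: "hform u v' = 0" "hform u' v = 0" "hform u' v' = 0"
        using less.hyps[of k l' u v'] less.hyps[of k' l u' v] less.hyps[of k' l' u' v'] less.prems u' v'
        by (simp_all add: kl)
      have "hform u v = hform (complexify A *v u) (complexify A *v v)" by (simp add: hform_Sp A)
      also have "\<dots> = hform (c *s u + u') (d *s v + v')"
        by (simp add: u'_def v'_def shift_def)
      also have "\<dots> = c * cnj d * hform u v"
        by (simp add: hform_simps z)
      finally show ?thesis using ne by simp
    qed
  qed
  then show ?thesis using assms(3,4) by (auto simp: gen_eigenspace_shift)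
qed

section \<open>Conjugation symmetry of the spectrum\<close>

lemma gen_eigenspace_cnj:
  "gen_eigenspace (complexify A) (cnj c) = vcnj ` gen_eigenspace (complexify A) c"
proof -
  have pow: "(shift (complexify A) (cnj c) ^^ k) (vcnj v) = vcnj ((shift (complexify A) c ^^ k) v)" for c k v
    by (induction k) (auto simp: shift_def complexify_mult_vcnj)
  have sub: "vcnj v \<in> gen_eigenspace (complexify A) (cnj c)" if "v \<in> gen_eigenspace (complexify A) c" for c v
    using that unfolding gen_eigenspace_shift mem_Collect_eq pow by (metis vcnj_simps(6))
  show ?thesis
  proof
    show "gen_eigenspace (complexify A) (cnj c) \<subseteq> vcnj ` gen_eigenspace (complexify A) c"
      using sub[of _ "cnj c"] by (metis (no_types, lifting) complex_cnj_cnj imageI subsetI vcnj_simps(5))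
    show "vcnj ` gen_eigenspace (complexify A) c \<subseteq> gen_eigenspace (complexify A) (cnj c)"
      using sub by auto
  qed
qed

lemma linear_vcnj: "linear vcnj"
  by (rule linearI) (auto simp: vec_eq_iff)

lemma dim_gen_eigenspace_cnj:
  "dim (gen_eigenspace (complexify A) (cnj c)) = dim (gen_eigenspace (complexify A) c)"
proof -
  have "inj_on vcnj (span (gen_eigenspace (complexify A) c))" by (metis inj_on_inverseI vcnj_simps(5))
  then show ?thesis unfolding gen_eigenspace_cnj by (rule dim_image_eq[OF linear_vcnj])
qed

lemma eigenvalues_cnj:
  assumes "c \<in> eigenvalues (complexify A)" shows "cnj c \<in> eigenvalues (complexify A)"
proof -
  obtain v where v: "v \<noteq> 0" "complexify A *v v = c *s v" using assms by (auto simp: is_eigenvalue_def)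
  then have "complexify A *v vcnj v = cnj c *s vcnj v" "vcnj v \<noteq> 0"
    using vcnj_simps(5)[of v] by (auto simp: complexify_mult_vcnj simp del: vcnj_simps(5))
  then show ?thesis by (auto simp: is_eigenvalue_def)
qed

lemma cmod_one_iff_inverse_cnj: "c \<noteq> 0 \<Longrightarrow> 1 / cnj c = c \<longleftrightarrow> cmod c = 1"
proof -
  assume "c \<noteq> 0"
  then have "1 / cnj c = c \<longleftrightarrow> c * cnj c = 1" by (auto simp: field_simps)
  also have "\<dots> \<longleftrightarrow> (cmod c)\<^sup>2 = 1"
    by (metis complex_norm_square of_real_eq_1_iff)
  also have "\<dots> \<longleftrightarrow> cmod c = 1" using norm_ge_zero[of c] by (auto simp: power2_eq_1_iff simp del: norm_ge_zero)
  finally show ?thesis .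
qed

text \<open>The range of \<open>T\<close> is an invariant nonnegative subspace of complex dimension
  \<open>n\<close>, the largest possible by \<open>nonneg_subspace_dim\<close>, and \<open>M\<close>
  is the restriction of \<open>A\<close> in the coordinates given by \<open>T\<close>. Maximality is
  what pins down the multiplicities of \<open>M\<close>.\<close>

locale invariant_nonneg =
  fixes A :: "real^('n::finite + 'n)^('n + 'n)"
    and T :: "complex^'n^('n + 'n)"
    and M :: "complex^'n^'n"
  assumes Sp: "A \<in> Sp"
    and intertwine: "complexify A ** T = T ** M"
    and inj_T: "\<And>z. T *v z = 0 \<Longrightarrow> z = 0"
    and nonneg_T: "\<And>z. Q_form (T *v z) (T *v z) \<ge> 0"
begin

abbreviation "E \<equiv> gen_eigenspace (complexify A)"
abbreviation "G \<equiv> gen_eigenspace M"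
abbreviation "\<Lambda> \<equiv> eigenvalues (complexify A)"

lemma zero_not_eigenvalue: "0 \<notin> \<Lambda>"
proof
  assume "0 \<in> \<Lambda>"
  then obtain v where v: "v \<noteq> 0" "complexify A *v v = 0" by (auto simp: is_eigenvalue_def)
  have "Q_form v w = 0" for w
    using hform_Sp[OF Sp, of v w] v(2) by (simp add: Q_form_hform)
  then show False using v(1) Q_form_nondegenerate by blast
qed

lemma Q_orthogonal:
  assumes "c * cnj d \<noteq> 1" "u \<in> E c" "v \<in> E d"
  shows "Q_form u v = 0"
  using hform_gen_eigenspaces[OF Sp assms] by (simp add: Q_form_hform)

text \<open>By \<open>hform_gen_eigenspaces\<close>, only the generalized eigenspace of the partner
  \<open>1 / cnj c\<close> can pair nontrivially with that of \<open>c\<close>. The partner equals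
  \<open>c\<close> exactly on the unit circle.\<close>

lemma partner_iff: "c \<noteq> 0 \<Longrightarrow> c * cnj d = 1 \<longleftrightarrow> d = 1 / cnj c"
  by (metis complex_cnj_cnj complex_cnj_divide complex_cnj_one complex_cnj_zero_iff
      nonzero_eq_divide_eq mult.commute)

lemma linear_T: "linear ((*v) T)"
  by (rule linearI) (auto simp: vec.add scaleR_eq_smult vec.scale)

lemma inj_on_T: "inj_on ((*v) T) S"
proof -
  have "inj ((*v) T)" by (subst linear_injective_0[OF linear_T]) (use inj_T in auto)
  then show ?thesis using inj_on_subset by blast
qed

lemma T_shift: "T *v shift M c z = shift (complexify A) c (T *v z)"
  by (simp add: shift_def vec.diff vec.scale matrix_vector_mul_assoc intertwine)

lemma T_shift_pow: "T *v (shift M c ^^ k) z = (shift (complexify A) c ^^ k) (T *v z)"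
  by (induction k) (auto simp: T_shift)

lemma T_gen_eigenspace: "z \<in> G c \<Longrightarrow> T *v z \<in> E c"
  unfolding gen_eigenspace_shift mem_Collect_eq T_shift_pow[symmetric]
  by (metis vec.zero)

lemma subspace_TG: "subspace ((*v) T ` G c)"
  by (intro linear_subspace_image linear_T subspace_gen_eigenspace)

lemma dim_TG: "dim ((*v) T ` G c) = dim (G c)"
  by (rule dim_image_eq[OF linear_T inj_on_T])

lemma eigenvalues_M: "eigenvalues M \<subseteq> \<Lambda>"
proof
  fix c assume "c \<in> eigenvalues M"
  then obtain z where z: "z \<noteq> 0" "M *v z = c *s z" by (auto simp: is_eigenvalue_def)
  then have "complexify A *v (T *v z) = c *s (T *v z)"
    by (simp add: matrix_vector_mul_assoc intertwine) (simp add: matrix_vector_mul_assoc[symmetric] vec.scale)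
  moreover have "T *v z \<noteq> 0" using z inj_T by blast
  ultimately show "c \<in> \<Lambda>" by (auto simp: is_eigenvalue_def)
qed

lemma dim_G_trivial: "c \<notin> eigenvalues M \<Longrightarrow> dim (G c) = 0"
  using gen_eigenspace_trivial[of M c] by simp

lemma sum_dim_G: "(\<Sum>c\<in>\<Lambda>. dim (G c)) = 2 * CARD('n)"
proof -
  have "(\<Sum>c\<in>\<Lambda>. dim (G c)) = (\<Sum>c\<in>eigenvalues M. dim (G c))"
    using eigenvalues_M dim_G_trivial finite_eigenvalues
    by (intro sum.mono_neutral_right) auto
  then show ?thesis by (simp add: sum_dim_gen_eigenspaces)
qed

text \<open>Replacing the part of \<open>range T\<close> in \<open>E c\<close> and its dual \<open>E (1 / cnj c)\<close> by a nonnegative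
  subspace \<open>X\<close> of \<open>E c\<close> keeps the total space nonnegative, so its dimension cannot increase.\<close>

lemma replace_bound:
  assumes c: "c \<in> \<Lambda>" and X: "subspace X" "X \<subseteq> E c" "\<And>x. x \<in> X \<Longrightarrow> Q_form x x \<ge> 0"
  shows "dim X \<le> (\<Sum>i\<in>\<Lambda> \<inter> {c, 1 / cnj c}. dim (G i))"
proof -
  \<comment> \<open>On the circle the partner is \<open>c\<close> itself and the first branch
    applies. Off the circle the summand of the partner is emptied, so that \<open>X\<close> is
    orthogonal to everything that is kept.\<close>
  define S where "S = (\<lambda>i. if i = c then X else if i = 1 / cnj c then {0} else (*v) T ` G i)"
  have c0: "c \<noteq> 0" using c zero_not_eigenvalue by auto
  have fin: "finite \<Lambda>" by (rule finite_eigenvalues)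
  have subS: "subspace (S i)" for i using X subspace_TG by (auto simp: S_def)
  have SE: "S i \<subseteq> E i" for i
    using X T_gen_eigenspace subspace_0[OF subspace_gen_eigenspace] by (auto simp: S_def)
  have ind: "indep_family \<Lambda> S"
    by (rule indep_family_mono[OF indep_gen_eigenspaces[OF fin] SE])
  have nn: "Q_form x x \<ge> 0" if x: "x \<in> ksum \<Lambda> S" for x
  proof -
    obtain u where "\<forall>i\<in>\<Lambda>. u i \<in> S i" "x = (\<Sum>i\<in>\<Lambda>. u i)" using ksumD[OF x] by blast
    note u = bspec[OF this(1)] this(2)
    have "\<exists>z. u i = T *v z \<and> (i = 1 / cnj c \<longrightarrow> u i = 0)" if "i \<in> \<Lambda> - {c}" for i
      using u(1)[of i] that by (auto simp: S_def intro: exI[of _ 0] split: if_splits)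
    then obtain z where z: "\<And>i. i \<in> \<Lambda> - {c} \<Longrightarrow> u i = T *v z i"
        "\<And>i. i \<in> \<Lambda> - {c} \<Longrightarrow> i = 1 / cnj c \<Longrightarrow> u i = 0"
      by metis
    let ?y = "\<Sum>i\<in>\<Lambda> - {c}. u i"
    have x: "x = u c + ?y" using u(2) c fin by (simp add: sum.remove)
    have "Q_form (u c) (u i) = 0" if i: "i \<in> \<Lambda> - {c}" for i
    proof (cases "i = 1 / cnj c")
      case True
      then show ?thesis using z(2)[OF i] by (simp add: Q_form_simps)
    next
      case False
      then have "c * cnj i \<noteq> 1" using partner_iff[OF c0] by blast
      then show ?thesis using Q_orthogonal u(1) c i SE by blast
    qed
    then have cross: "Q_form (u c) ?y = 0" by (simp add: Q_form_simps)
    have "?y = T *v (\<Sum>i\<in>\<Lambda> - {c}. z i)" by (simp add: vec.sum z(1))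
    then have "Q_form ?y ?y \<ge> 0" using nonneg_T by simp
    moreover have "u c \<in> X" using u(1)[OF c] by (simp add: S_def)
    then have "Q_form (u c) (u c) \<ge> 0" by (rule X(3))
    moreover have "Q_form x x = Q_form (u c) (u c) + Q_form ?y ?y"
      unfolding x using cross Q_form_commute[of ?y "u c"] by (simp add: Q_form_simps(1,2))
    ultimately show ?thesis by simp
  qed
  have "(\<Sum>i\<in>\<Lambda>. dim (S i)) = dim (ksum \<Lambda> S)"
    using dim_ksum[OF fin subS ind] by simp
  also have "\<dots> \<le> 2 * CARD('n)"
    using subS nn by (intro nonneg_subspace_dim subspace_ksum)
  also have "\<dots> = (\<Sum>i\<in>\<Lambda>. dim (G i))" by (simp add: sum_dim_G)
  also have "\<dots> = (\<Sum>i\<in>\<Lambda> \<inter> {c, 1 / cnj c}. dim (G i)) + (\<Sum>i\<in>\<Lambda> - {c, 1 / cnj c}. dim (G i))"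
    using sum.union_disjoint[of "\<Lambda> \<inter> {c, 1 / cnj c}" "\<Lambda> - {c, 1 / cnj c}" "\<lambda>i. dim (G i)"] fin
    by (simp add: Int_Diff_disjoint Int_Diff_Un)
  finally have *: "(\<Sum>i\<in>\<Lambda>. dim (S i)) \<le> \<dots>" .
  have "(\<Sum>i\<in>\<Lambda> - {c, 1 / cnj c}. dim (G i)) = (\<Sum>i\<in>\<Lambda> - {c, 1 / cnj c}. dim (S i))"
    by (intro sum.cong) (auto simp: S_def dim_TG)
  moreover have "dim X + (\<Sum>i\<in>\<Lambda> - {c, 1 / cnj c}. dim (S i)) \<le> (\<Sum>i\<in>\<Lambda>. dim (S i))"
  proof -
    have "(\<Sum>i\<in>insert c (\<Lambda> - {c, 1 / cnj c}). dim (S i)) \<le> (\<Sum>i\<in>\<Lambda>. dim (S i))"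
      using fin c by (intro sum_mono2) auto
    then show ?thesis using fin by (simp add: S_def)
  qed
  ultimately show ?thesis using * by linarith
qed

text \<open>The form is nondegenerate on the whole space, and \<open>E c\<close> is orthogonal to
  every summand except that of its partner.\<close>

lemma E_nondegenerate:
  assumes "c \<noteq> 0" "x \<in> E c" "\<And>y. y \<in> E (1 / cnj c) \<Longrightarrow> Q_form x y = 0"
  shows "x = 0"
proof (rule Q_form_nondegenerate)
  fix w
  have "w \<in> ksum \<Lambda> E" by (simp add: gen_eigenspaces_span)
  then obtain u where "\<forall>i\<in>\<Lambda>. u i \<in> E i" "w = (\<Sum>i\<in>\<Lambda>. u i)" using ksumD by blast
  note u = bspec[OF this(1)] this(2)
  have "Q_form x (u i) = 0" if "i \<in> \<Lambda>" for i
  proof (cases "i = 1 / cnj c")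
    case True
    then show ?thesis using assms(3) u(1)[OF that] by simp
  next
    case False
    then show ?thesis using Q_orthogonal partner_iff assms(1,2) u(1)[OF that] by blast
  qed
  then show "Q_form x w = 0" by (simp add: u(2) Q_form_simps)
qed

lemma partner_eigenvalue:
  assumes "c \<in> \<Lambda>" shows "1 / cnj c \<in> \<Lambda>"
proof (rule ccontr)
  assume "1 / cnj c \<notin> \<Lambda>"
  then have "E (1 / cnj c) = {0}" by (intro gen_eigenspace_trivial) auto
  then have "x = 0" if "x \<in> E c" for x
    using E_nondegenerate[OF _ that] assms zero_not_eigenvalue by (auto simp: Q_form_simps)
  moreover obtain v where "v \<noteq> 0" "complexify A *v v = c *s v"
    using assms by (auto simp: is_eigenvalue_def)
  ultimately show False using eigenvector_in_gen_eigenspace by blast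
qed

text \<open>Split \<open>E c\<close> into a positive part \<open>P\<close> and a nonpositive part
  \<open>N\<close>. Maximality gives \<open>dim P \<le> dim (G c)\<close> through
  \<open>replace_bound\<close>. Conversely the nonnegative image of \<open>G c\<close> meets
  \<open>N\<close> only in \<open>0\<close>, since the form is nondegenerate on \<open>E c\<close>;
  hence \<open>dim (G c) \<le> dim (E c) - dim N = dim P\<close>.\<close>

lemma m_plus_circle:
  assumes c: "c \<in> \<Lambda>" "cmod c = 1"
  shows "m_plus A c = dim (G c)"
proof -
  have c0: "c \<noteq> 0" using c zero_not_eigenvalue by auto
  have partner: "1 / cnj c = c" using c c0 cmod_one_iff_inverse_cnj by blast
  obtain P N where PN: "subspace P" "subspace N" "P \<subseteq> E c" "N \<subseteq> E c"
    "dim P = num_pos_eigenvalues (E c) Q_form" "dim (E c) = dim P + dim N"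
    "\<And>x. x \<in> E c \<Longrightarrow> \<exists>p\<in>P. \<exists>q\<in>N. x = p + q"
    "\<And>p. p \<in> P \<Longrightarrow> p \<noteq> 0 \<Longrightarrow> Q_form p p > 0" "\<And>q. q \<in> N \<Longrightarrow> Q_form q q \<le> 0"
    "\<And>p q. p \<in> P \<Longrightarrow> q \<in> N \<Longrightarrow> Q_form p q = 0"
    using positive_part[OF Q_form_sym_bilinear subspace_gen_eigenspace] by blast
  have "Q_form x x \<ge> 0" if "x \<in> P" for x
    using PN(8)[OF that] by (cases "x = 0") (auto simp: Q_form_simps)
  then have "dim P \<le> (\<Sum>i\<in>\<Lambda> \<inter> {c, 1 / cnj c}. dim (G i))"
    using PN by (intro replace_bound c)
  also have "\<Lambda> \<inter> {c, 1 / cnj c} = {c}" using partner c by auto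
  finally have lower: "dim P \<le> dim (G c)" by simp
  have "(*v) T ` G c \<inter> N = {0}"
  proof
    show "{0} \<subseteq> (*v) T ` G c \<inter> N" using PN subspace_TG by (auto simp: subspace_0)
    show "(*v) T ` G c \<inter> N \<subseteq> {0}"
    proof
      fix x assume x: "x \<in> (*v) T ` G c \<inter> N"
      then obtain z where "x = T *v z" "x \<in> N" by blast
      then have Qx: "Q_form x x = 0" using nonneg_T[of z] PN(9)[of x] by simp
      \<comment> \<open>The isotropic vector \<open>x\<close> maximizes the form on
        \<open>N\<close>, so the first variation at \<open>x\<close> vanishes along
        \<open>N\<close>.\<close>
      have QN: "Q_form x w = 0" if w: "w \<in> N" for w
      proof (rule linear_coeff_zero)
        fix t :: real
        have "x + t *\<^sub>R w \<in> N" using x w PN(2) by (auto simp: subspace_add subspace_scale)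
        then have "Q_form (x + t *\<^sub>R w) (x + t *\<^sub>R w) \<le> 0" by (rule PN(9))
        then show "2 * t * Q_form x w \<le> t\<^sup>2 * (- Q_form w w)"
          using Qx Q_form_commute[of w x] by (simp add: Q_form_simps power2_eq_square algebra_simps)
      qed
      have "x = 0"
      proof (rule E_nondegenerate[OF c0])
        show "x \<in> E c" using x PN by blast
        fix y assume "y \<in> E (1 / cnj c)"
        then obtain p q where "p \<in> P" "q \<in> N" "y = p + q" using PN(7)[of y] partner by auto
        then show "Q_form x y = 0"
          using QN x PN(10)[of p x] Q_form_commute[of x p] by (simp add: Q_form_simps)
      qed
      then show "x \<in> {0}" by simp
    qed
  qed
  then have "dim {x + y |x y. x \<in> (*v) T ` G c \<and> y \<in> N} = dim (G c) + dim N"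
    using dim_sums_Int[OF subspace_TG PN(2), of c] by (simp add: dim_TG)
  moreover have "{x + y |x y. x \<in> (*v) T ` G c \<and> y \<in> N} \<subseteq> E c"
    using T_gen_eigenspace PN(4) subspace_add[OF subspace_gen_eigenspace] by blast
  ultimately have "dim (G c) + dim N \<le> dim (E c)" using dim_subset[of "{x + y |x y. x \<in> (*v) T ` G c \<and> y \<in> N}" "E c"] by (simp only:)
  then show ?thesis using lower PN(5,6) by (simp add: m_plus_def)
qed

text \<open>Here \<open>E c\<close> and \<open>E (1 / cnj c)\<close> are isotropic and dual to each
  other. Taking all of \<open>E c\<close> in \<open>replace_bound\<close> gives one inequality. For
  the other, the parts of the invariant subspace in the two spaces annihilate each other, so their
  dimensions add up to at most that of \<open>E c\<close>.\<close>

lemma dim_G_off_circle: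
  assumes c: "c \<in> \<Lambda>" "cmod c \<noteq> 1"
  shows "dim (G c) + dim (G (1 / cnj c)) = dim (E c)"
proof -
  let ?d = "1 / cnj c"
  have c0: "c \<noteq> 0" using c zero_not_eigenvalue by auto
  have ne: "?d \<noteq> c" using c c0 cmod_one_iff_inverse_cnj by blast
  have fin: "finite \<Lambda>" by (rule finite_eigenvalues)
  have d: "?d \<in> \<Lambda>" by (rule partner_eigenvalue[OF c(1)])
  have cc: "c * cnj c \<noteq> 1" using ne partner_iff[OF c0, of c] by auto
  have dd: "?d * cnj ?d = 1 / (c * cnj c)" by (simp add: mult.commute)
  have iso: "Q_form x y = 0" if "x \<in> E i" "y \<in> E i" "i = c \<or> i = ?d" for i x y
  proof (rule Q_orthogonal[OF _ that(1,2)])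
    show "i * cnj i \<noteq> 1"
    proof (cases "i = c")
      case False
      then have "i * cnj i = 1 / (c * cnj c)" using that(3) dd by metis
      then show ?thesis using cc by (metis div_by_1 divide_divide_eq_right mult_1)
    qed (use cc in simp)
  qed
  have "dim (E c) \<le> (\<Sum>i\<in>\<Lambda> \<inter> {c, ?d}. dim (G i))"
    using iso by (intro replace_bound c subspace_gen_eigenspace) auto
  also have "\<Lambda> \<inter> {c, ?d} = {c, ?d}" using c d by auto
  finally have lower: "dim (E c) \<le> dim (G c) + dim (G ?d)" using ne by simp
  \<comment> \<open>Both vectors are isotropic and their combinations remain in the nonnegative
    range of \<open>T\<close>, so the mixed term cannot have a sign.\<close>
  have orth: "Q_form x y = 0" if xy: "x \<in> (*v) T ` G c" "y \<in> (*v) T ` G ?d" for x y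
  proof -
    obtain a b where ab: "x = T *v a" "a \<in> G c" "y = T *v b" "b \<in> G ?d" using xy by blast
    have z: "Q_form x x = 0" "Q_form y y = 0"
      using ab T_gen_eigenspace iso by blast+
    have "- Q_form x y = 0"
    proof (rule linear_coeff_zero)
      fix t :: real
      have "x + t *\<^sub>R y = T *v (a + t *\<^sub>R b)"
        using ab linear_add[OF linear_T] linear_scale[OF linear_T] by simp
      then have "Q_form (x + t *\<^sub>R y) (x + t *\<^sub>R y) \<ge> 0" using nonneg_T by simp
      then show "2 * t * (- Q_form x y) \<le> t\<^sup>2 * 0"
        using z Q_form_commute[of y x] by (simp add: Q_form_simps)
    qed
    then show ?thesis by simp
  qed
  \<comment> \<open>Only \<open>E c\<close> is cut down. The resulting sum is orthogonal to the
    image of \<open>G ?d\<close>, and comparing its dimension with that of the orthogonal complement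
    leaves the desired bound.\<close>
  define S where "S = (\<lambda>i. if i = c then (*v) T ` G c else E i)"
  have subS: "subspace (S i)" for i by (simp add: S_def subspace_TG subspace_gen_eigenspace)
  have SE: "S i \<subseteq> E i" for i using T_gen_eigenspace by (auto simp: S_def)
  have ind: "indep_family \<Lambda> S" by (rule indep_family_mono[OF indep_gen_eigenspaces[OF fin] SE])
  have "ksum \<Lambda> S \<subseteq> {v. \<forall>y\<in>(*v) T ` G ?d. Q_form v y = 0}"
  proof (intro subsetI CollectI ballI)
    fix x y assume x: "x \<in> ksum \<Lambda> S" and y: "y \<in> (*v) T ` G ?d"
    obtain u where "\<forall>i\<in>\<Lambda>. u i \<in> S i" "x = (\<Sum>i\<in>\<Lambda>. u i)" using ksumD[OF x] by blast
    note u = bspec[OF this(1)] this(2)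
    have "Q_form (u i) y = 0" if i: "i \<in> \<Lambda>" for i
    proof (cases "i = c")
      case True
      then show ?thesis using u(1)[OF i] orth y by (simp add: S_def)
    next
      case False
      have "i * cnj ?d \<noteq> 1" using False c0 by (simp add: field_simps)
      moreover have "u i \<in> E i" using u(1)[OF i] SE by blast
      moreover have "y \<in> E ?d" using y T_gen_eigenspace by blast
      ultimately show ?thesis by (rule Q_orthogonal)
    qed
    then show "Q_form x y = 0" by (simp add: u(2) Q_form_simps)
  qed
  then have "dim (ksum \<Lambda> S) \<le> dim {v. \<forall>y\<in>(*v) T ` G ?d. Q_form v y = 0}" by (rule dim_subset)
  then have "(\<Sum>i\<in>\<Lambda>. dim (S i)) + dim (G ?d) \<le> 4 * CARD('n)"
    using dim_ksum[OF fin subS ind] Q_form_orthogonal_dim[OF subspace_TG, of ?d] by (simp add: dim_TG)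
  also have "\<dots> = (\<Sum>i\<in>\<Lambda>. dim (E i))" by (simp add: sum_dim_gen_eigenspaces)
  also have "\<dots> = dim (E c) + (\<Sum>i\<in>\<Lambda> - {c}. dim (S i))"
    using c fin by (simp add: sum.remove S_def)
  also have "(\<Sum>i\<in>\<Lambda>. dim (S i)) = dim (G c) + (\<Sum>i\<in>\<Lambda> - {c}. dim (S i))"
    using c fin by (simp add: sum.remove S_def dim_TG)
  finally show ?thesis using lower by simp
qed

end

section \<open>The square of rho\<close>

lemma sgn_prod_complex: "sgn (\<Prod>i\<in>I. f i) = (\<Prod>i\<in>I. sgn (f i))" for f :: "'i \<Rightarrow> complex"
  by (induction I rule: infinite_finite_induct) (auto simp: sgn_mult)

lemma sgn_power_complex: "sgn (z ^ k) = sgn z ^ k" for z :: complex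
  by (induction k) (auto simp: sgn_mult)

lemma sgn_partner: "sgn (1 / cnj c) = sgn c" for c :: complex
proof (cases "c = 0")
  case False
  then show ?thesis
    by (simp add: sgn_eq norm_divide field_simps complex_norm_square[symmetric] power2_eq_square)
qed simp

context invariant_nonneg
begin

abbreviation "d \<equiv> \<lambda>c. vec.dim (G c)"

lemma dim_G_eq: "dim (G c) = 2 * d c"
  by (intro real_dim_complex_subspace vec_subspace_gen_eigenspace)

lemma det_M: "det M = (\<Prod>c\<in>\<Lambda>. c ^ d c)"
proof -
  have d0: "d c = 0" if "c \<notin> eigenvalues M" for c
    using dim_G_trivial[OF that] unfolding dim_G_eq by linarith
  show ?thesis
    unfolding det_gen_eigenspaces
  proof (rule prod.mono_neutral_left)
    show "\<forall>i\<in>\<Lambda> - eigenvalues M. i ^ d i = 1" using d0 by (metis DiffD2 power_0)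
  qed (use eigenvalues_M finite_eigenvalues[of "complexify A"] in auto)
qed

text \<open>Eigenvalues inside the disc are matched with their partners outside, which have the same
  phase; the joint exponent is the multiplicity in \<open>A\<close>. The product \<open>t\<close>
  over the inside is invariant under conjugation, hence real of modulus one. It may be
  \<open>-1\<close>, so the square is essential.\<close>

lemma off_circle_part: "(\<Prod>c\<in>{c\<in>\<Lambda>. cmod c \<noteq> 1}. sgn c ^ (2 * d c)) = 1"
proof -
  let ?S = "{c\<in>\<Lambda>. cmod c < 1}" and ?B = "{c\<in>\<Lambda>. cmod c > 1}"
  let ?p = "\<lambda>c::complex. 1 / cnj c"
  define e where "e = (\<lambda>c. vec.dim (E c))"
  define t where "t = (\<Prod>c\<in>?S. sgn c ^ e c)"
  have fin: "finite \<Lambda>" by (rule finite_eigenvalues)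
  have nz: "c \<noteq> 0" if "c \<in> \<Lambda>" for c using that zero_not_eigenvalue by auto
  have dimE: "dim (E c) = 2 * e c" for c
    unfolding e_def by (intro real_dim_complex_subspace vec_subspace_gen_eigenspace)
  have bij: "bij_betw ?p ?S ?B"
  proof (rule bij_betw_byWitness[where f' = ?p])
    show "?p ` ?S \<subseteq> ?B" "?p ` ?B \<subseteq> ?S"
      using partner_eigenvalue nz by (auto simp: norm_divide field_simps)
  qed auto
  have "{c\<in>\<Lambda>. cmod c \<noteq> 1} = ?S \<union> ?B" by auto
  then have "(\<Prod>c\<in>{c\<in>\<Lambda>. cmod c \<noteq> 1}. sgn c ^ (2 * d c))
      = (\<Prod>c\<in>?S. sgn c ^ (2 * d c)) * (\<Prod>c\<in>?B. sgn c ^ (2 * d c))"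
    using fin prod.union_disjoint[of ?S ?B "\<lambda>c. sgn c ^ (2 * d c)"] by fastforce
  also have "(\<Prod>c\<in>?B. sgn c ^ (2 * d c)) = (\<Prod>c\<in>?S. sgn c ^ (2 * d (?p c)))"
    using prod.reindex_bij_betw[OF bij, of "\<lambda>c. sgn c ^ (2 * d c)"] unfolding sgn_partner by (rule sym)
  also have "(\<Prod>c\<in>?S. sgn c ^ (2 * d c)) * \<dots> = (\<Prod>c\<in>?S. sgn c ^ (2 * e c))"
    unfolding prod.distrib[symmetric] power_add[symmetric]
  proof (intro prod.cong refl arg_cong[where f = "power _"])
    fix c assume "c \<in> ?S"
    then show "2 * d c + 2 * d (?p c) = 2 * e c"
      using dim_G_off_circle[of c] by (simp add: dim_G_eq dimE)
  qed
  also have "\<dots> = t * t"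
    unfolding t_def prod.distrib[symmetric] power_add[symmetric] mult_2 ..
  also have "\<dots> = 1"
  proof -
    have bij': "bij_betw cnj ?S ?S"
      by (rule bij_betw_byWitness[where f' = cnj]) (use eigenvalues_cnj[of _ A] in auto)
    have "e (cnj c) = e c" for c using dim_gen_eigenspace_cnj[of A c] by (simp add: dimE)
    then have "(\<Prod>c\<in>?S. sgn (cnj c) ^ e c) = t"
      unfolding t_def using prod.reindex_bij_betw[OF bij', of "\<lambda>c. sgn c ^ e c"] by simp
    then have "cnj t = t" by (simp add: t_def sgn_eq)
    then have "t * t = (cmod t)\<^sup>2" by (metis complex_norm_square)
    also have "cmod t = 1"
      using nz by (simp add: t_def prod_norm[symmetric] norm_power norm_sgn)
    finally show ?thesis by simp
  qed
  finally show ?thesis .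
qed

text \<open>The eigenvalues \<open>1\<close> and \<open>-1\<close> omitted in \<open>rho\<close>
  have phase squared equal to \<open>1\<close>, the power of \<open>-1\<close> disappears, and the
  eigenvalues off the circle contribute \<open>1\<close>. What is left is the product of all phases
  of eigenvalues of \<open>M\<close>.\<close>

lemma rho_squared: "(rho A)\<^sup>2 = (sgn (det M))\<^sup>2"
proof -
  have fin: "finite \<Lambda>" by (rule finite_eigenvalues)
  let ?C = "{c\<in>\<Lambda>. cmod c = 1}"
  let ?C' = "{c. c \<in> sphere 0 1 - {1, -1} \<and> is_eigenvalue (complexify A) c}"
  have sub: "?C' \<subseteq> ?C" by auto
  have "(rho A)\<^sup>2 = ((-1) ^ (m_minus A div 2))\<^sup>2 * (\<Prod>c\<in>?C'. (c ^ (m_plus A c div 2))\<^sup>2)"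
    by (simp only: rho_def power_mult_distrib prod_power_distrib)
  also have "((-1::complex) ^ (m_minus A div 2))\<^sup>2 = 1"
    by (cases "even (m_minus A div 2)") auto
  also have "(\<Prod>c\<in>?C'. (c ^ (m_plus A c div 2))\<^sup>2) = (\<Prod>c\<in>?C'. sgn c ^ (2 * d c))"
  proof (intro prod.cong refl)
    fix c assume "c \<in> ?C'"
    then have c: "c \<in> \<Lambda>" "cmod c = 1" by auto
    then have "m_plus A c div 2 = d c" using m_plus_circle[OF c] dim_G_eq by simp
    moreover have "sgn c = c" using c by (simp add: sgn_eq)
    ultimately show "(c ^ (m_plus A c div 2))\<^sup>2 = sgn c ^ (2 * d c)"
      by (simp only: power_mult[symmetric] mult.commute[of 2])
  qed
  also have "\<dots> = (\<Prod>c\<in>?C. sgn c ^ (2 * d c))"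
  proof (rule prod.mono_neutral_left)
    show "\<forall>i\<in>?C - ?C'. sgn i ^ (2 * d i) = 1"
      by (auto simp: power_mult)
  qed (use fin sub in auto)
  also have "1 * \<dots> = (\<Prod>c\<in>?C. sgn c ^ (2 * d c)) * (\<Prod>c\<in>{c\<in>\<Lambda>. cmod c \<noteq> 1}. sgn c ^ (2 * d c))"
    by (simp only: off_circle_part mult_1 mult_1_right)
  also have "\<dots> = (\<Prod>c\<in>\<Lambda>. sgn c ^ (2 * d c))"
  proof -
    have "?C \<union> {c\<in>\<Lambda>. cmod c \<noteq> 1} = \<Lambda>" by auto
    then have "(\<Prod>c\<in>\<Lambda>. sgn c ^ (2 * d c)) = (\<Prod>c\<in>?C \<union> {c\<in>\<Lambda>. cmod c \<noteq> 1}. sgn c ^ (2 * d c))"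
      by (rule arg_cong[OF sym])
    also have "\<dots> = (\<Prod>c\<in>?C. sgn c ^ (2 * d c)) * (\<Prod>c\<in>{c\<in>\<Lambda>. cmod c \<noteq> 1}. sgn c ^ (2 * d c))"
      using fin by (intro prod.union_disjoint) auto
    finally show ?thesis by (rule sym)
  qed
  also have "\<dots> = (sgn (det M))\<^sup>2"
    by (simp only: det_M sgn_prod_complex sgn_power_complex prod_power_distrib
        power_mult[symmetric] mult.commute[of _ 2])
  finally show ?thesis .
qed

end

section \<open>Continuity of matrix operations\<close>

lemma continuous_on_matrix_mult [continuous_intros]:
  fixes f :: "'x::topological_space \<Rightarrow> 'a::real_normed_field^'n::finite^'m::finite"
  assumes "continuous_on S f" "continuous_on S g"
  shows "continuous_on S (\<lambda>x. f x ** g x)"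
  unfolding matrix_matrix_mult_def
  by (intro continuous_on_vec_lambda continuous_on_sum continuous_on_mult
      continuous_on_component assms)

lemma continuous_on_matrix_vector_mult [continuous_intros]:
  fixes f :: "'x::topological_space \<Rightarrow> 'a::real_normed_field^'n::finite^'m::finite"
  assumes "continuous_on S f" "continuous_on S g"
  shows "continuous_on S (\<lambda>x. f x *v g x)"
  unfolding matrix_vector_mult_def
  by (intro continuous_on_vec_lambda continuous_on_sum continuous_on_mult
      continuous_on_component assms)

lemma continuous_on_det [continuous_intros]:
  fixes f :: "'x::topological_space \<Rightarrow> 'a::real_normed_field^'n::finite^'n"
  assumes "continuous_on S f"
  shows "continuous_on S (\<lambda>x. det (f x))"
  unfolding det_def
  by (intro continuous_on_sum continuous_on_mult continuous_on_const continuous_on_prod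
      continuous_on_component assms)

lemma continuous_on_transpose [continuous_intros]:
  fixes f :: "'x::topological_space \<Rightarrow> 'a::topological_space^'n::finite^'m::finite"
  assumes "continuous_on S f"
  shows "continuous_on S (\<lambda>x. transpose (f x))"
  unfolding transpose_def
  by (intro continuous_on_vec_lambda continuous_on_component assms)

lemma continuous_on_complexify [continuous_intros]:
  fixes f :: "'x::topological_space \<Rightarrow> real^'n::finite^'n"
  assumes "continuous_on S f"
  shows "continuous_on S (\<lambda>x. complexify (f x))"
  unfolding map_matrix_def
  by (intro continuous_on_vec_lambda continuous_on_of_real continuous_on_component assms)

lemma matrix_inv_props:
  fixes A :: "'a::field^'n::finite^'n"
  assumes "det A \<noteq> 0"
  shows "A ** matrix_inv A = mat 1" "matrix_inv A ** A = mat 1"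
proof -
  have "\<exists>A'. A ** A' = mat 1 \<and> A' ** A = mat 1"
    using assms by (simp add: invertible_det_nz[symmetric] invertible_def)
  from someI_ex[OF this] show "A ** matrix_inv A = mat 1" "matrix_inv A ** A = mat 1"
    by (simp_all add: matrix_inv_def)
qed

lemma matrix_vector_mult_axis: "A *v axis k 1 = column k A"
  for A :: "'a::semiring_1^'n::finite^'m"
  by (simp add: vec_eq_iff matrix_vector_mult_def column_def axis_def if_distrib cong: if_cong)

text \<open>This form makes continuity of the inverse visible: its entries are quotients of
  determinants.\<close>

lemma matrix_inv_cramer:
  fixes A :: "'a::field^'n::finite^'n"
  assumes "det A \<noteq> 0"
  shows "matrix_inv A = (\<chi> k l. det (\<chi> i j. if j = k then axis l 1 $ i else A $ i $ j) / det A)"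
proof -
  have "column l (matrix_inv A) = (\<chi> k. det (\<chi> i j. if j = k then axis l 1 $ i else A $ i $ j) / det A)" for l
  proof -
    have "A *v (matrix_inv A *v axis l 1) = axis l 1"
      by (simp add: matrix_vector_mul_assoc matrix_inv_props[OF assms])
    then have "matrix_inv A *v axis l 1 = (\<chi> k. det (\<chi> i j. if j = k then axis l 1 $ i else A $ i $ j) / det A)"
      using cramer[OF assms] by blast
    then show ?thesis by (simp add: matrix_vector_mult_axis)
  qed
  then show ?thesis by (simp add: vec_eq_iff column_def)
qed

lemma continuous_on_matrix_inv [continuous_intros]:
  fixes f :: "'x::topological_space \<Rightarrow> 'a::real_normed_field^'n::finite^'n"
  assumes f: "continuous_on S f" and nz: "\<And>x. x \<in> S \<Longrightarrow> det (f x) \<noteq> 0"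
  shows "continuous_on S (\<lambda>x. matrix_inv (f x))"
proof -
  have "continuous_on S (\<lambda>x. if j = k then axis l 1 $ i else f x $ i $ j)" for i j k l
    by (cases "j = k") (auto intro!: continuous_intros f)
  then have "continuous_on S (\<lambda>x. \<chi> k l. det (\<chi> i j. if j = k then axis l 1 $ i else f x $ i $ j) / det (f x))"
    using nz by (intro continuous_on_vec_lambda continuous_on_divide continuous_on_det f) auto
  then show ?thesis by (rule continuous_on_eq) (simp add: matrix_inv_cramer nz)
qed

section \<open>Invariant subspaces as graphs of contractions\<close>

text \<open>In the coordinates \<open>z = v $ Inl k + \<i> * v $ Inr k\<close> and
  \<open>w = v $ Inl k - \<i> * v $ Inr k\<close>, read off by \<open>zpart\<close> and
  \<open>wpart\<close>, the form is half the difference of the squared norms of \<open>z\<close> and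
  \<open>w\<close>. The matrix \<open>emb Z\<close> parametrizes the graph \<open>w = Z z\<close> by
  \<open>z\<close>.\<close>

definition emb :: "complex^'n^'n \<Rightarrow> complex^'n^('n::finite + 'n)" where
  "emb Z = (\<chi> i j. case i of Inl k \<Rightarrow> (mat 1 $ k $ j + Z $ k $ j) / 2
     | Inr k \<Rightarrow> (mat 1 $ k $ j - Z $ k $ j) / (2 * \<i>))"

definition zpart :: "complex^('n::finite + 'n)^'n" where
  "zpart = (\<chi> k i. case i of Inl l \<Rightarrow> mat 1 $ k $ l | Inr l \<Rightarrow> \<i> * mat 1 $ k $ l)"

definition wpart :: "complex^('n::finite + 'n)^'n" where
  "wpart = (\<chi> k i. case i of Inl l \<Rightarrow> mat 1 $ k $ l | Inr l \<Rightarrow> - \<i> * mat 1 $ k $ l)"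

lemma zpart_mult: "(zpart *v v) $ k = v $ Inl k + \<i> * v $ Inr k"
  by (simp add: zpart_def matrix_vector_mult_def sum_UNIV_sum mat_def if_distrib if_distribR cong: if_cong)

lemma wpart_mult: "(wpart *v v) $ k = v $ Inl k - \<i> * v $ Inr k"
  by (simp add: wpart_def matrix_vector_mult_def sum_UNIV_sum mat_def if_distrib if_distribR sum_negf cong: if_cong)

lemma emb_mult:
  "(emb Z *v x) $ Inl k = (x $ k + (Z *v x) $ k) / 2"
  "(emb Z *v x) $ Inr k = (x $ k - (Z *v x) $ k) / (2 * \<i>)"
proof -
  have m: "(\<Sum>j\<in>UNIV. mat 1 $ k $ j * x $ j) = x $ k"
    by (simp add: mat_def if_distrib if_distribR cong: if_cong)
  show "(emb Z *v x) $ Inl k = (x $ k + (Z *v x) $ k) / 2"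
    by (simp add: emb_def matrix_vector_mult_def add_divide_distrib sum.distrib ring_distribs
        sum_divide_distrib[symmetric] m)
  show "(emb Z *v x) $ Inr k = (x $ k - (Z *v x) $ k) / (2 * \<i>)"
  proof -
    have "(emb Z *v x) $ Inr k = (\<Sum>j\<in>UNIV. (mat 1 $ k $ j - Z $ k $ j) / (2 * \<i>) * x $ j)"
      by (simp add: emb_def matrix_vector_mult_def)
    also have "\<dots> = (\<Sum>j\<in>UNIV. mat 1 $ k $ j * x $ j - Z $ k $ j * x $ j) / (2 * \<i>)"
      by (simp only: sum_divide_distrib times_divide_eq_left left_diff_distrib)
    also have "\<dots> = (x $ k - (Z *v x) $ k) / (2 * \<i>)"
      by (simp only: sum_subtractf m) (simp add: matrix_vector_mult_def)
    finally show ?thesis .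
  qed
qed

lemma zpart_emb [simp]: "zpart *v (emb Z *v x) = x"
  by (simp add: vec_eq_iff zpart_mult emb_mult field_simps)

lemma wpart_emb [simp]: "wpart *v (emb Z *v x) = Z *v x"
  by (simp add: vec_eq_iff wpart_mult emb_mult field_simps)

lemma zw_eqI:
  assumes "zpart *v v = zpart *v v'" "wpart *v v = wpart *v v'"
  shows "v = v'"
proof -
  have z: "v $ Inl k + \<i> * v $ Inr k = v' $ Inl k + \<i> * v' $ Inr k" for k
    using assms(1) by (metis zpart_mult)
  have w: "v $ Inl k - \<i> * v $ Inr k = v' $ Inl k - \<i> * v' $ Inr k" for k
    using assms(2) by (metis wpart_mult)
  have "v $ Inl k = v' $ Inl k" "v $ Inr k = v' $ Inr k" for k
    using z[of k] w[of k] by (auto simp: complex_eq_iff)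
  then show ?thesis by (simp add: vec_eq_iff) (metis sum.exhaust)
qed

lemma Q_form_zw: "Q_form v v = ((norm (zpart *v v))\<^sup>2 - (norm (wpart *v v))\<^sup>2) / 2"
proof -
  have "(cmod (a + \<i> * b))\<^sup>2 - (cmod (a - \<i> * b))\<^sup>2 = 4 * Im (a * cnj b)" for a b
    unfolding cmod_power2 by (simp add: power2_eq_square algebra_simps)
  then have "(norm (zpart *v v))\<^sup>2 - (norm (wpart *v v))\<^sup>2 = (\<Sum>k\<in>UNIV. 4 * Im (v $ Inl k * cnj (v $ Inr k)))"
    by (simp add: norm_vec_def L2_set_def real_sqrt_pow2 sum_nonneg sum_subtractf[symmetric] zpart_mult wpart_mult)
  moreover have "Q_form v v = (\<Sum>k\<in>UNIV. 2 * Im (v $ Inl k * cnj (v $ Inr k)))"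
    by (simp add: Q_form_hform hform_def symp_form_eq) (intro sum.cong, auto)
  moreover have "(\<Sum>k\<in>UNIV. 4 * Im (v $ Inl k * cnj (v $ Inr k)))
      = 2 * (\<Sum>k\<in>UNIV. 2 * Im (v $ Inl k * cnj (v $ Inr k)))"
    unfolding sum_distrib_left by (intro sum.cong) auto
  ultimately show ?thesis by simp
qed

text \<open>The closed unit ball of the operator norm. It is compact and convex, as Brouwer's
  theorem requires, and for its members the graph \<open>w = Z z\<close> is nonnegative.\<close>

definition contractions :: "(complex^'n^'n::finite) set" where
  "contractions = {Z. \<forall>x. norm (Z *v x) \<le> norm x}"

lemma compact_contractions: "compact (contractions :: (complex^'n^'n::finite) set)"
proof -
  have "closed (contractions :: (complex^'n^'n) set)"
    unfolding contractions_def
    by (intro closed_Collect_all closed_Collect_le continuous_intros)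
  moreover have "bounded (contractions :: (complex^'n^'n) set)"
    unfolding bounded_iff
  proof (intro exI ballI)
    fix Z :: "complex^'n^'n" assume Z: "Z \<in> contractions"
    have "cmod (Z $ i $ j) \<le> 1" for i j
    proof -
      have "Z $ i $ j = (Z *v axis j 1) $ i" by (simp add: matrix_vector_mult_axis column_def)
      then have "cmod (Z $ i $ j) \<le> norm (Z *v axis j 1)" by (metis Finite_Cartesian_Product.norm_nth_le)
      also have "\<dots> \<le> norm (axis j (1::complex))" using Z unfolding contractions_def by blast
      finally show ?thesis by (simp add: norm_axis_1)
    qed
    then have "norm (Z $ i) \<le> (\<Sum>j\<in>(UNIV::'n set). 1)" for i
      unfolding norm_vec_def by (intro order_trans[OF L2_set_le_sum sum_mono]) auto
    then show "norm Z \<le> (\<Sum>i\<in>(UNIV::'n set). \<Sum>j\<in>(UNIV::'n set). 1)"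
      unfolding norm_vec_def[of Z] by (intro order_trans[OF L2_set_le_sum sum_mono]) auto
  qed
  ultimately show ?thesis by (simp add: compact_eq_bounded_closed)
qed

lemma zero_contraction: "0 \<in> contractions"
  by (simp add: contractions_def)

lemma convex_contractions: "convex (contractions :: (complex^'n^'n::finite) set)"
proof (rule convexI)
  fix X Y :: "complex^'n^'n" and u v :: real
  assume XY: "X \<in> contractions" "Y \<in> contractions" and uv: "0 \<le> u" "0 \<le> v" "u + v = 1"
  have "norm ((u *\<^sub>R X + v *\<^sub>R Y) *v x) \<le> norm x" for x
  proof -
    have "(u *\<^sub>R X + v *\<^sub>R Y) *v x = u *\<^sub>R (X *v x) + v *\<^sub>R (Y *v x)"
      by (simp add: vec_eq_iff matrix_vector_mult_def sum.distrib algebra_simps scaleR_sum_right)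
    also have "norm \<dots> \<le> u * norm (X *v x) + v * norm (Y *v x)"
      using uv by (intro norm_triangle_le) simp
    also have "\<dots> \<le> u * norm x + v * norm x"
      using XY uv by (intro add_mono mult_left_mono) (auto simp: contractions_def)
    also have "\<dots> = norm x" using uv by (simp add: distrib_right[symmetric])
    finally show ?thesis .
  qed
  then show "u *\<^sub>R X + v *\<^sub>R Y \<in> contractions" by (simp add: contractions_def)
qed

text \<open>The \<open>z\<close> part of the image of the graph of \<open>Z\<close> under
  \<open>A\<close>; \<open>wblock\<close> is the \<open>w\<close> part. Where
  \<open>zblock A Z\<close> is invertible the image is the graph of \<open>wblock A Z\<close> times
  its inverse, a generalized Moebius action. On an invariant graph \<open>zblock A Z\<close> is the
  restriction of \<open>A\<close>.\<close>

definition zblock :: "real^('n::finite + 'n)^('n + 'n) \<Rightarrow> complex^'n^'n \<Rightarrow> complex^'n^'n" where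
  "zblock A Z = zpart ** complexify A ** emb Z"

definition wblock :: "real^('n::finite + 'n)^('n + 'n) \<Rightarrow> complex^'n^'n \<Rightarrow> complex^'n^'n" where
  "wblock A Z = wpart ** complexify A ** emb Z"

lemma continuous_on_emb [continuous_intros]:
  fixes f :: "'x::topological_space \<Rightarrow> complex^'n::finite^'n"
  assumes "continuous_on S f"
  shows "continuous_on S (\<lambda>x. emb (f x))"
  unfolding emb_def
proof (intro continuous_on_vec_lambda)
  fix i :: "'n + 'n" and j :: 'n
  show "continuous_on S (\<lambda>x. case i of Inl k \<Rightarrow> (mat 1 $ k $ j + f x $ k $ j) / 2
     | Inr k \<Rightarrow> (mat 1 $ k $ j - f x $ k $ j) / (2 * \<i>))"
    by (cases i) (auto intro!: continuous_intros assms)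
qed

text \<open>The \<open>z\<close> parts of both sides agree by construction, so invariance is only a
  condition on the \<open>w\<close> parts. That condition is the fixed point equation of the graph
  transform.\<close>

lemma invariance_iff:
  "complexify A ** emb Z = emb Z ** zblock A Z \<longleftrightarrow> wblock A Z = Z ** zblock A Z"
proof
  assume inv: "complexify A ** emb Z = emb Z ** zblock A Z"
  have "wblock A Z *v x = (Z ** zblock A Z) *v x" for x
    by (simp add: wblock_def matrix_mul_assoc[symmetric] inv)
       (simp add: matrix_vector_mul_assoc[symmetric])
  then show "wblock A Z = Z ** zblock A Z" by (simp add: matrix_eq)
next
  assume w: "wblock A Z = Z ** zblock A Z"
  have "complexify A *v (emb Z *v x) = emb Z *v (zblock A Z *v x)" for x
  proof (rule zw_eqI)
    show "zpart *v (complexify A *v (emb Z *v x)) = zpart *v (emb Z *v (zblock A Z *v x))"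
      by (simp add: zblock_def matrix_vector_mul_assoc[symmetric])
    have "wpart *v (complexify A *v (emb Z *v x)) = wblock A Z *v x"
      by (simp add: wblock_def matrix_vector_mul_assoc[symmetric])
    then show "wpart *v (complexify A *v (emb Z *v x)) = wpart *v (emb Z *v (zblock A Z *v x))"
      unfolding w by (simp add: matrix_vector_mul_assoc[symmetric])
  qed
  then show "complexify A ** emb Z = emb Z ** zblock A Z"
    by (simp add: matrix_eq matrix_vector_mul_assoc[symmetric])
qed

text \<open>Invariance of the form along the graph reads
  \<open>|zblock x|^2 - |wblock x|^2 = |x|^2 - |Z x|^2\<close>, and the right side is nonnegative
  for a contraction.\<close>

lemma block_norms:
  assumes "A \<in> Sp" "Z \<in> contractions"
  shows "norm (wblock A Z *v x) \<le> norm (zblock A Z *v x)"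
    and "zblock A Z *v x = 0 \<Longrightarrow> x = 0"
proof -
  let ?v = "complexify A *v (emb Z *v x)"
  have zw: "zpart *v ?v = zblock A Z *v x" "wpart *v ?v = wblock A Z *v x"
    by (simp_all add: zblock_def wblock_def matrix_vector_mul_assoc[symmetric])
  have "Q_form ?v ?v = Q_form (emb Z *v x) (emb Z *v x)"
    by (simp add: Q_form_hform hform_Sp assms(1))
  then have eq: "(norm (zblock A Z *v x))\<^sup>2 - (norm (wblock A Z *v x))\<^sup>2 = (norm x)\<^sup>2 - (norm (Z *v x))\<^sup>2"
    unfolding Q_form_zw zw by simp
  moreover have "norm (Z *v x) \<le> norm x" using assms(2) by (simp add: contractions_def)
  then have "(norm (Z *v x))\<^sup>2 \<le> (norm x)\<^sup>2" by (intro power_mono) auto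
  ultimately have le: "(norm (wblock A Z *v x))\<^sup>2 \<le> (norm (zblock A Z *v x))\<^sup>2" by linarith
  then show "norm (wblock A Z *v x) \<le> norm (zblock A Z *v x)" by (rule power2_le_imp_le) simp
  show "x = 0" if "zblock A Z *v x = 0"
  proof -
    have "wblock A Z *v x = 0" using le that by simp
    then have "?v = 0" using zw_eqI[of ?v 0] zw that by (simp add: vec.zero)
    have "Q_form (emb Z *v x) w = 0" for w
      using hform_Sp[OF assms(1), of "emb Z *v x" w] \<open>?v = 0\<close> by (simp add: Q_form_hform)
    then have "emb Z *v x = 0" by (rule Q_form_nondegenerate)
    then show ?thesis using zpart_emb[of Z x] by (simp add: vec.zero)
  qed
qed

lemma zblock_invertible: "A \<in> Sp \<Longrightarrow> Z \<in> contractions \<Longrightarrow> det (zblock A Z) \<noteq> 0"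
  using block_norms(2) by (auto simp: det_nonzero_iff)

text \<open>The graph transform \<open>?F\<close> sends contractions to contractions by
  \<open>block_norms\<close>, and its fixed points are exactly the invariant graphs.\<close>

lemma invariant_contraction_exists:
  fixes A :: "real^('n::finite + 'n)^('n + 'n)"
  assumes A: "A \<in> Sp"
  shows "\<exists>Z\<in>contractions. complexify A ** emb Z = emb Z ** zblock A Z"
proof -
  let ?F = "\<lambda>Z :: complex^'n^'n. wblock A Z ** matrix_inv (zblock A Z)"
  have "continuous_on contractions ?F"
    unfolding wblock_def zblock_def
    using zblock_invertible[OF A] by (intro continuous_intros) (auto simp: zblock_def)
  moreover have "?F \<in> contractions \<rightarrow> contractions"
  proof
    fix Z :: "complex^'n^'n" assume Z: "Z \<in> contractions"
    have "norm (?F Z *v y) \<le> norm y" for y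
    proof -
      let ?x = "matrix_inv (zblock A Z) *v y"
      have "zblock A Z *v ?x = y"
        by (simp add: matrix_vector_mul_assoc matrix_inv_props zblock_invertible A Z)
      then show ?thesis
        using block_norms(1)[OF A Z, of ?x] by (simp add: matrix_vector_mul_assoc)
    qed
    then show "?F Z \<in> contractions" by (simp add: contractions_def)
  qed
  ultimately obtain Z where Z: "Z \<in> contractions" "?F Z = Z"
    using zero_contraction by (elim brouwer[OF compact_contractions convex_contractions, rotated]) blast+
  have "wblock A Z = ?F Z ** zblock A Z"
    by (simp add: matrix_mul_assoc[symmetric] matrix_inv_props zblock_invertible A Z(1))
  then show ?thesis using Z invariance_iff by metis
qed

lemma rho_squared_zblock:
  assumes "A \<in> Sp" "Z \<in> contractions" "complexify A ** emb Z = emb Z ** zblock A Z"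
  shows "(rho A)\<^sup>2 = (sgn (det (zblock A Z)))\<^sup>2"
proof -
  interpret invariant_nonneg A "emb Z" "zblock A Z"
  proof
    show "z = 0" if "emb Z *v z = 0" for z
      using zpart_emb[of Z z] that by (simp add: vec.zero)
    have "norm (Z *v z) \<le> norm z" for z using assms(2) by (simp add: contractions_def)
    then show "0 \<le> Q_form (emb Z *v z) (emb Z *v z)" for z
      by (simp add: Q_form_zw power_mono)
  qed (use assms in auto)
  show ?thesis by (rule rho_squared)
qed

lemma closed_Sp: "closed (Sp :: (real^('n::finite + 'n)^('n + 'n)) set)"
  unfolding Sp_def symp_form_def
  by (intro closed_Collect_all closed_Collect_eq continuous_intros continuous_on_component)

lemma rho_squared_sphere:
  assumes "A \<in> Sp" shows "(rho A)\<^sup>2 \<in> sphere 0 1"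
proof -
  obtain Z where Z: "Z \<in> contractions" "complexify A ** emb Z = emb Z ** zblock A Z"
    using invariant_contraction_exists[OF assms] by blast
  then show ?thesis
    using rho_squared_zblock[OF assms Z] zblock_invertible[OF assms Z(1)] by (simp add: norm_power norm_sgn)
qed

text \<open>The graph of \<open>A \<mapsto> rho A\<^sup>2\<close> is the projection, along the compact set of contractions, of a
  closed set.\<close>

lemma continuous_on_rho_squared:
  "continuous_on (Sp :: (real^('n::finite + 'n)^('n + 'n)) set) (\<lambda>A. (rho A)\<^sup>2)"
proof (rule continuous_from_closed_graph[of "sphere 0 1"])
  let ?S = "Sp :: (real^('n + 'n)^('n + 'n)) set"
  \<comment> \<open>The relation \<open>s = (sgn (det (zblock A Z)))^2\<close> is written without
    division, so that it defines a closed set. Over contractions the determinant is nonzero and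
    nothing is lost.\<close>
  let ?P = "\<lambda>Z A s. A \<in> Sp \<and> complexify A ** emb Z = emb Z ** zblock A Z \<and>
    (det (zblock A Z))\<^sup>2 = s * of_real ((cmod (det (zblock A Z)))\<^sup>2)"
  let ?T = "{(Z, A, s). ?P Z A s} :: ((complex^'n^'n) \<times> (real^('n + 'n)^('n + 'n)) \<times> complex) set"
  show "compact (sphere 0 1 :: complex set)" by simp
  show "(\<lambda>A. (rho A)\<^sup>2) \<in> ?S \<rightarrow> sphere 0 1" using rho_squared_sphere by blast
  have "?T = {x. fst (snd x) \<in> Sp} \<inter> {x. complexify (fst (snd x)) ** emb (fst x) = emb (fst x) ** zblock (fst (snd x)) (fst x)}
     \<inter> {x. (det (zblock (fst (snd x)) (fst x)))\<^sup>2 = snd (snd x) * of_real ((cmod (det (zblock (fst (snd x)) (fst x))))\<^sup>2)}"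
    by auto
  also have "closed \<dots>"
  proof (intro closed_Int)
    show "closed {x :: (complex^'n^'n) \<times> (real^('n + 'n)^('n + 'n)) \<times> complex. fst (snd x) \<in> Sp}"
      using continuous_closed_vimage[OF closed_Sp, of "\<lambda>x. fst (snd x)"]
      by (simp add: vimage_def continuous_intros)
  qed (unfold zblock_def, (intro closed_Collect_eq continuous_intros)+)
  finally have clo: "closed ?T" .
  have "(\<lambda>A. (A, (rho A)\<^sup>2)) ` ?S = {y. \<exists>Z. Z \<in> contractions \<and> (Z, y) \<in> ?T}"
  proof (intro set_eqI iffI)
    fix y assume "y \<in> (\<lambda>A. (A, (rho A)\<^sup>2)) ` ?S"
    then obtain A where A: "A \<in> Sp" "y = (A, (rho A)\<^sup>2)" by blast
    obtain Z where Z: "Z \<in> contractions" "complexify A ** emb Z = emb Z ** zblock A Z"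
      using invariant_contraction_exists[OF A(1)] by blast
    have "(det (zblock A Z))\<^sup>2 = (rho A)\<^sup>2 * of_real ((cmod (det (zblock A Z)))\<^sup>2)"
      using rho_squared_zblock[OF A(1) Z] zblock_invertible[OF A(1) Z(1)]
      by (simp add: sgn_eq power_divide)
    then show "y \<in> {y. \<exists>Z. Z \<in> contractions \<and> (Z, y) \<in> ?T}" using A Z by auto
  next
    fix y assume "y \<in> {y. \<exists>Z. Z \<in> contractions \<and> (Z, y) \<in> ?T}"
    then obtain Z A s where h: "y = (A, s)" "Z \<in> contractions" "?P Z A s" by auto
    then have "s = (rho A)\<^sup>2"
      using rho_squared_zblock[of A Z] zblock_invertible[of A Z] by (simp add: sgn_eq power_divide)
    then show "y \<in> (\<lambda>A. (A, (rho A)\<^sup>2)) ` ?S" using h by blast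
  qed
  then show "closed ((\<lambda>A. (A, (rho A)\<^sup>2)) ` ?S)"
    using closed_compact_projection[OF compact_contractions clo] by simp
qed

section \<open>Block matrices and determinants\<close>

lemma block_matrix_nth [simp]:
  "block_matrix A B C D $ Inl k $ Inl l = A $ k $ l"
  "block_matrix A B C D $ Inl k $ Inr l = B $ k $ l"
  "block_matrix A B C D $ Inr k $ Inl l = C $ k $ l"
  "block_matrix A B C D $ Inr k $ Inr l = D $ k $ l"
  by (simp_all add: block_matrix_def)

lemma block_eqI:
  fixes M N :: "'a^('n::finite + 'n)^('n + 'n)"
  assumes "\<And>k l. M $ Inl k $ Inl l = N $ Inl k $ Inl l" "\<And>k l. M $ Inl k $ Inr l = N $ Inl k $ Inr l"
    "\<And>k l. M $ Inr k $ Inl l = N $ Inr k $ Inl l" "\<And>k l. M $ Inr k $ Inr l = N $ Inr k $ Inr l"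
  shows "M = N"
proof -
  have "M $ i $ j = N $ i $ j" for i j
    by (cases i; cases j) (simp_all add: assms)
  then show ?thesis by (simp add: vec_eq_iff)
qed

lemma block_matrix_mult:
  "block_matrix A B C D ** block_matrix A' B' C' D' =
    block_matrix (A ** A' + B ** C') (A ** B' + B ** D') (C ** A' + D ** C') (C ** B' + D ** D')"
  by (rule block_eqI) (simp_all add: matrix_matrix_mult_def sum_UNIV_sum)

lemma mat_1_block: "(mat 1 :: 'a::zero_neq_one^('n::finite + 'n)^('n + 'n)) = block_matrix (mat 1) 0 0 (mat 1)"
  by (rule block_eqI) (auto simp: mat_def)

lemma bij_betw_map_permutation:
  fixes f :: "'n::finite \<Rightarrow> 'k::finite"
  assumes "inj f"
  shows "bij_betw (map_permutation UNIV f) {q. q permutes UNIV} {p. p permutes range f}"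
proof -
  have inj: "inj_on (map_permutation UNIV f) {q. q permutes UNIV}"
  proof (rule inj_onI)
    fix q q' assume eq: "map_permutation UNIV f q = map_permutation UNIV f q'"
    have "f (q x) = f (q' x)" for x
      using fun_cong[OF eq, of "f x"] assms by (simp add: map_permutation_apply)
    then show "q = q'" using assms by (auto simp: inj_def)
  qed
  have "map_permutation UNIV f ` {q. q permutes UNIV} \<subseteq> {p. p permutes range f}"
    using assms by (auto intro!: map_permutation_permutes inj_on_imp_bij_betw)
  moreover have "card (map_permutation UNIV f ` {q. q permutes (UNIV::'n set)}) = card {p. p permutes range f}"
    unfolding card_image[OF inj]
    using assms by (subst (1 2) card_permutations[OF refl]) (auto simp: card_image)
  ultimately have "map_permutation UNIV f ` {q. q permutes UNIV} = {p. p permutes range f}"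
    by (intro card_subset_eq) (auto simp: finite_permutations)
  then show ?thesis using inj by (simp add: bij_betw_def)
qed

text \<open>In the Leibniz formula only permutations fixing every index outside
  \<open>range f\<close> contribute, and these correspond, with their signs, to the permutations of
  the smaller index type.\<close>

lemma det_identity_rows:
  fixes B :: "'a::comm_ring_1^'k::finite^'k" and f :: "'n::finite \<Rightarrow> 'k"
  assumes f: "inj f" and B: "\<And>i j. i \<notin> range f \<Longrightarrow> B $ i $ j = (if i = j then 1 else 0)"
  shows "det B = det (\<chi> k l. B $ f k $ f l)"
proof -
  have "det B = (\<Sum>p | p permutes range f. of_int (sign p) * (\<Prod>i\<in>UNIV. B $ i $ p i))"
    unfolding det_def
  proof (rule sum.mono_neutral_right)
    show "{p. p permutes range f} \<subseteq> {p. p permutes UNIV}" by (auto intro: permutes_subset)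
    show "\<forall>p\<in>{p. p permutes UNIV} - {p. p permutes range f}. of_int (sign p) * (\<Prod>i\<in>UNIV. B $ i $ p i) = 0"
    proof
      fix p assume p: "p \<in> {p. p permutes (UNIV::'k set)} - {p. p permutes range f}"
      then obtain i where "i \<notin> range f" "p i \<noteq> i"
        using permutes_superset[of p UNIV "range f"] by blast
      then have "B $ i $ p i = 0" using B[of i "p i"] by auto
      then have "(\<Prod>i\<in>UNIV. B $ i $ p i) = 0" by (intro prod_zero) auto
      then show "of_int (sign p) * (\<Prod>i\<in>UNIV. B $ i $ p i) = 0" by simp
    qed
  qed (simp add: finite_permutations)
  also have "\<dots> = (\<Sum>q | q permutes (UNIV::'n set). of_int (sign (map_permutation UNIV f q)) *
      (\<Prod>i\<in>UNIV. B $ i $ map_permutation UNIV f q i))"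
    by (rule sum.reindex_bij_betw[OF bij_betw_map_permutation[OF f], symmetric])
  also have "\<dots> = (\<Sum>q | q permutes (UNIV::'n set). of_int (sign q) * (\<Prod>k\<in>UNIV. B $ f k $ f (q k)))"
  proof (intro sum.cong refl arg_cong2[where f = times])
    fix q assume "q \<in> {q. q permutes (UNIV::'n set)}"
    then have q: "q permutes UNIV" by simp
    show "of_int (sign (map_permutation UNIV f q)) = (of_int (sign q) :: 'a)"
      using f q by (subst sign_map_permutation) auto
    have "(\<Prod>i\<in>UNIV. B $ i $ map_permutation UNIV f q i) = (\<Prod>i\<in>range f. B $ i $ map_permutation UNIV f q i)"
    proof (rule prod.mono_neutral_right)
      show "\<forall>i\<in>UNIV - range f. B $ i $ map_permutation UNIV f q i = 1"
        using B by (auto simp: map_permutation_def)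
    qed auto
    also have "\<dots> = (\<Prod>k\<in>UNIV. B $ f k $ f (q k))"
      using f by (simp add: prod.reindex map_permutation_apply)
    finally show "(\<Prod>i\<in>UNIV. B $ i $ map_permutation UNIV f q i) = (\<Prod>k\<in>UNIV. B $ f k $ f (q k))" .
  qed
  also have "\<dots> = det (\<chi> k l. B $ f k $ f l)" by (simp add: det_def)
  finally show ?thesis .
qed

text \<open>The matrix factors into two matrices, each with identity rows in one half.\<close>

lemma det_block_lower:
  fixes X Y Z :: "'a::comm_ring_1^'n::finite^'n"
  shows "det (block_matrix X 0 Y Z) = det X * det Z"
proof -
  have z: "A ** 0 = 0" "0 ** A = 0" for A :: "'a^'n^'n"
    by (simp_all add: matrix_matrix_mult_def vec_eq_iff)
  have "block_matrix X 0 Y Z = block_matrix X 0 0 (mat 1) ** block_matrix (mat 1) 0 Y Z"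
    by (simp add: block_matrix_mult z)
  moreover have "det (block_matrix X 0 0 (mat 1)) = det X"
  proof (subst det_identity_rows[of Inl])
    fix i j :: "'n + 'n" assume "i \<notin> range Inl"
    then obtain k where "i = Inr k" by (cases i) auto
    then show "block_matrix X 0 0 (mat 1) $ i $ j = (if i = j then 1 else 0)"
      by (cases j) (auto simp: mat_def)
  qed (auto simp: vec_eq_iff)
  moreover have "det (block_matrix (mat 1) 0 Y Z) = det Z"
  proof (subst det_identity_rows[of Inr])
    fix i j :: "'n + 'n" assume "i \<notin> range Inr"
    then obtain k where "i = Inl k" by (cases i) auto
    then show "block_matrix (mat 1) 0 Y Z $ i $ j = (if i = j then 1 else 0)"
      by (cases j) (auto simp: mat_def)
  qed (auto simp: vec_eq_iff)
  ultimately show ?thesis by (simp add: det_mul)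
qed

section \<open>The symplectic group\<close>

lemma J0_mult_nth [simp]:
  "(J0 ** A) $ Inl k $ j = - A $ Inr k $ j" "(J0 ** A) $ Inr k $ j = A $ Inl k $ j"
  "(B ** J0) $ i $ Inl k = B $ i $ Inr k" "(B ** J0) $ i $ Inr k = - B $ i $ Inl k"
  by (simp_all add: J0_def matrix_matrix_mult_def sum_UNIV_sum mat_def if_distrib if_distribR
      sum_negf cong: if_cong)

lemma J0_mult_vec [simp]: "(J0 *v x) $ Inl k = - x $ Inr k" "(J0 *v x) $ Inr k = x $ Inl k"
  by (simp_all add: J0_def matrix_vector_mult_def sum_UNIV_sum mat_def if_distrib if_distribR
      sum_negf cong: if_cong)

lemma J0_nth: "J0 $ Inl k $ Inl l = 0" "J0 $ Inr k $ Inr l = 0"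
  "J0 $ Inl k $ Inr l = (if k = l then -1 else 0)" "J0 $ Inr k $ Inl l = (if k = l then 1 else 0)"
  by (simp_all add: J0_def mat_def)

lemma matrix_neg_mult: "(- A) ** B = - (A ** B)" "A ** (- B) = - (A ** B)"
  for A :: "'a::ring_1^'n::finite^'m::finite" and B :: "'a^'k::finite^'n"
  by (simp_all add: matrix_matrix_mult_def vec_eq_iff sum_negf)

lemma matrix_diff_distrib: "(A - B) ** C = A ** C - B ** C" "D ** (A - B) = D ** A - D ** B"
  for A B :: "'a::ring_1^'n::finite^'m::finite" and C :: "'a^'k::finite^'n"
  by (simp_all add: matrix_matrix_mult_def vec_eq_iff sum_subtractf algebra_simps)

lemma matrix_add_distrib: "(A + B) ** C = A ** C + B ** C" "D ** (A + B) = D ** A + D ** B"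
  for A B :: "'a::semiring_1^'n::finite^'m::finite" and C :: "'a^'k::finite^'n"
  by (simp_all add: matrix_matrix_mult_def vec_eq_iff sum.distrib algebra_simps)

lemma mat_nth: "mat c $ i $ j = (if i = j then c else 0)"
  by (simp add: mat_def)

lemma transpose_mult_nth: "(transpose A ** B) $ i $ j = (\<Sum>k\<in>UNIV. A $ k $ i * B $ k $ j)"
  by (simp add: matrix_matrix_mult_def transpose_def)

lemma J0_J0: "J0 ** J0 = - mat 1"
  by (rule block_eqI) (auto simp: J0_nth mat_def)

lemma transpose_J0: "transpose J0 = - J0"
  by (rule block_eqI) (auto simp: J0_nth transpose_def)

lemma symp_form_J0: "symp_form v w = - (v \<bullet> (J0 *v w))" for v w :: "real^('n::finite + 'n)"
  by (simp add: symp_form_eq inner_vec_def sum_UNIV_sum sum_negf sum_subtractf)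

lemma inner_matrix_transpose: "(A *v v) \<bullet> w = v \<bullet> (transpose A *v w)" for A :: "real^'n::finite^'m::finite"
  by (simp add: dot_lmul_matrix[symmetric] inner_commute transpose_matrix_vector)

lemma Sp_iff: "A \<in> Sp \<longleftrightarrow> transpose A ** J0 ** A = J0"
proof -
  have "A \<in> Sp \<longleftrightarrow> (\<forall>v w. v \<bullet> ((transpose A ** J0 ** A) *v w) = v \<bullet> (J0 *v w))"
    by (simp add: Sp_def symp_form_J0 inner_matrix_transpose matrix_vector_mul_assoc[symmetric])
  also have "\<dots> \<longleftrightarrow> (\<forall>w. (transpose A ** J0 ** A) *v w = J0 *v w)"
    by (metis vector_eq_ldot)
  finally show ?thesis by (simp add: matrix_eq)
qed

lemma Sp_D: "A \<in> Sp \<Longrightarrow> transpose A ** (J0 ** A) = J0"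
  by (simp add: Sp_iff matrix_mul_assoc)

lemma Sp_mult: "A \<in> Sp \<Longrightarrow> B \<in> Sp \<Longrightarrow> A ** B \<in> Sp"
  by (simp add: Sp_def matrix_vector_mul_assoc[symmetric])

lemma mat_1_Sp: "mat 1 \<in> Sp" by (simp add: Sp_def)

lemma Sp_left_inverse:
  assumes "A \<in> Sp" shows "(- (J0 ** transpose A ** J0)) ** A = mat 1"
proof -
  have "(- (J0 ** transpose A ** J0)) ** A = - (J0 ** (transpose A ** (J0 ** A)))"
    by (simp add: matrix_neg_mult matrix_mul_assoc)
  then show ?thesis by (simp add: Sp_D[OF assms] J0_J0)
qed

lemma Sp_right_inverse: "A \<in> Sp \<Longrightarrow> A ** (- (J0 ** transpose A ** J0)) = mat 1"
  using Sp_left_inverse matrix_left_right_inverse by blast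

lemma Sp_det_nonzero: "A \<in> Sp \<Longrightarrow> det A \<noteq> 0"
  using Sp_left_inverse[of A] by (metis det_I det_mul mult_zero_right zero_neq_one)

lemma Sp_matrix_inv: assumes "A \<in> Sp" shows "matrix_inv A \<in> Sp"
proof -
  have "symp_form (matrix_inv A *v v) (matrix_inv A *v w) = symp_form v w" for v w
  proof -
    have "symp_form (A *v (matrix_inv A *v v)) (A *v (matrix_inv A *v w))
        = symp_form (matrix_inv A *v v) (matrix_inv A *v w)"
      using assms by (simp add: Sp_def)
    then show ?thesis
      by (simp add: matrix_vector_mul_assoc matrix_inv_props Sp_det_nonzero[OF assms])
  qed
  then show ?thesis by (simp add: Sp_def)
qed

lemma Sp_transpose: assumes "A \<in> Sp" shows "transpose A \<in> Sp"
proof -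
  have "A ** J0 ** transpose A ** J0 = - mat 1"
    using Sp_right_inverse[OF assms] by (simp add: matrix_neg_mult matrix_mul_assoc minus_equation_iff)
  then have "A ** J0 ** transpose A ** J0 ** J0 = - J0" by (simp add: matrix_neg_mult)
  then have "A ** J0 ** transpose A = J0"
    by (simp add: matrix_mul_assoc[symmetric] J0_J0 matrix_neg_mult)
  then show ?thesis by (simp add: Sp_iff)
qed

section \<open>Unitary matrices and the linear part\<close>

lemma zblock_zero_nth:
  "zblock A 0 $ k $ l = Complex ((A $ Inl k $ Inl l + A $ Inr k $ Inr l) / 2)
     ((A $ Inr k $ Inl l - A $ Inl k $ Inr l) / 2)"
proof -
  have zA: "(zpart ** complexify A) $ k $ j = A $ Inl k $ j + \<i> * A $ Inr k $ j" for k j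
    by (simp add: zpart_def matrix_matrix_mult_def sum_UNIV_sum mat_def if_distrib if_distribR cong: if_cong)
  show ?thesis
    by (simp add: zblock_def matrix_matrix_mult_def[of "zpart ** complexify A"] sum_UNIV_sum zA emb_def mat_def
        if_distrib if_distribR complex_eq_iff cong: if_cong)
qed

lemma wblock_zero_nth:
  "wblock A 0 $ k $ l = Complex ((A $ Inl k $ Inl l - A $ Inr k $ Inr l) / 2)
     (- (A $ Inr k $ Inl l + A $ Inl k $ Inr l) / 2)"
proof -
  have zA: "(wpart ** complexify A) $ k $ j = A $ Inl k $ j - \<i> * A $ Inr k $ j" for k j
    by (simp add: wpart_def matrix_matrix_mult_def sum_UNIV_sum mat_def if_distrib if_distribR sum_negf cong: if_cong)
  show ?thesis
    by (simp add: wblock_def matrix_matrix_mult_def[of "wpart ** complexify A"] sum_UNIV_sum zA emb_def mat_def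
        if_distrib if_distribR complex_eq_iff cong: if_cong)
qed

text \<open>The complex linear part \<open>(A - J0 A J0) / 2\<close>, read as a complex matrix, is
  \<open>zblock A 0\<close>. So \<open>rho_hat\<close> takes the phase at the reference subspace
  \<open>w = 0\<close>, whether or not that subspace is invariant.\<close>

lemma rho_hat_zblock: "rho_hat A = sgn (det (zblock A 0))"
proof -
  have "det_C ((1/2) *\<^sub>R (A - J0 ** A ** J0)) = det (zblock A 0)"
    unfolding det_C_def
  proof (rule arg_cong[where f = det], unfold vec_eq_iff, intro allI)
    fix k l
    have "(J0 ** A ** J0) $ Inl k $ Inl l = - A $ Inr k $ Inr l"
      "(J0 ** A ** J0) $ Inr k $ Inl l = A $ Inl k $ Inr l"
      by simp_all
    then show "(\<chi> k l. Complex (((1 / 2) *\<^sub>R (A - J0 ** A ** J0)) $ Inl k $ Inl l)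
          (((1 / 2) *\<^sub>R (A - J0 ** A ** J0)) $ Inr k $ Inl l)) $ k $ l = zblock A 0 $ k $ l"
      by (simp add: zblock_zero_nth)
  qed
  then show ?thesis by (simp add: rho_hat_def Let_def sgn_eq)
qed

lemma rho_hat_sphere: "A \<in> Sp \<Longrightarrow> rho_hat A \<in> sphere 0 1"
  using zblock_invertible[OF _ zero_contraction] by (simp add: rho_hat_zblock norm_sgn)

lemma continuous_on_rho_hat: "continuous_on Sp rho_hat"
proof -
  have "continuous_on Sp (\<lambda>A. sgn (det (zblock A 0)))"
    unfolding sgn_div_norm
    using zblock_invertible[OF _ zero_contraction]
    by (intro continuous_intros) (auto simp: zblock_def intro!: continuous_intros)
  then show ?thesis by (simp add: rho_hat_zblock[abs_def])
qed

lemma U_n_commute: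
  assumes "A \<in> U_n" shows "J0 ** A = A ** J0"
proof -
  have A: "A \<in> Sp" "A ** transpose A = mat 1"
    using assms by (auto simp: U_n_def orthogonal_matrix_def)
  have "A ** (transpose A ** (J0 ** A)) = A ** J0" by (simp add: Sp_D A)
  then show ?thesis by (simp add: matrix_mul_assoc A)
qed

lemma commute_nth:
  assumes "J0 ** A = A ** J0"
  shows "A $ Inr k $ Inr l = A $ Inl k $ Inl l" "A $ Inl k $ Inr l = - A $ Inr k $ Inl l"
proof -
  have "(J0 ** A) $ Inr k $ Inr l = (A ** J0) $ Inr k $ Inr l"
    "(J0 ** A) $ Inl k $ Inr l = (A ** J0) $ Inl k $ Inr l" using assms by simp_all
  then show "A $ Inl k $ Inr l = - A $ Inr k $ Inl l" "A $ Inr k $ Inr l = A $ Inl k $ Inl l" by simp_all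
qed

lemma zblock_commute:
  assumes "J0 ** A = A ** J0"
  shows "zblock A 0 = (\<chi> k l. Complex (A $ Inl k $ Inl l) (A $ Inr k $ Inl l))" "wblock A 0 = 0"
  by (simp_all add: vec_eq_iff zblock_zero_nth wblock_zero_nth commute_nth[OF assms] complex_eq_iff)

lemma det_C_zblock: "J0 ** A = A ** J0 \<Longrightarrow> det_C A = det (zblock A 0)"
  by (simp add: det_C_def zblock_commute)

lemma det_cnj: "det (\<chi> i j. cnj (M $ i $ j)) = cnj (det M)" for M :: "complex^'n::finite^'n"
  by (simp add: det_def)

text \<open>Orthogonality supplies the real part, and the symplectic relation the imaginary part, of
  the unitarity relation \<open>?H ** ?M = mat 1\<close>.\<close>

lemma cmod_det_C: assumes A: "A \<in> U_n" shows "cmod (det_C A) = 1"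
proof -
  let ?M = "(\<chi> k l. Complex (A $ Inl k $ Inl l) (A $ Inr k $ Inl l)) :: complex^'a^'a"
  let ?H = "(\<chi> k l. cnj (transpose ?M $ k $ l)) :: complex^'a^'a"
  have o: "transpose A ** A = mat 1" and S: "A \<in> Sp"
    using A by (auto simp: U_n_def orthogonal_matrix_def)
  have "?H ** ?M = mat 1"
  proof (unfold vec_eq_iff, intro allI)
    fix k l :: 'a
    have "(transpose A ** A) $ Inl k $ Inl l = (if k = l then 1 else 0)" by (simp add: o mat_def)
    then have re: "(\<Sum>j\<in>UNIV. A $ Inl j $ Inl k * A $ Inl j $ Inl l) + (\<Sum>j\<in>UNIV. A $ Inr j $ Inl k * A $ Inr j $ Inl l)
        = (if k = l then 1 else 0)"
      by (simp add: matrix_matrix_mult_def transpose_def sum_UNIV_sum)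
    have "(transpose A ** (J0 ** A)) $ Inl k $ Inl l = 0" by (simp add: Sp_D[OF S] J0_nth)
    then have im: "(\<Sum>j\<in>UNIV. A $ Inr j $ Inl k * A $ Inl j $ Inl l) = (\<Sum>j\<in>UNIV. A $ Inl j $ Inl k * A $ Inr j $ Inl l)"
      by (simp add: transpose_mult_nth sum_UNIV_sum sum_negf)
    show "(?H ** ?M) $ k $ l = mat 1 $ k $ l"
      using re im by (simp add: matrix_matrix_mult_def transpose_def complex_eq_iff mat_def sum.distrib sum_subtractf)
  qed
  then have "det ?H * det ?M = 1" using det_mul[of ?H ?M] by simp
  then have "cnj (det_C A) * det_C A = 1" by (simp add: det_cnj det_C_def)
  then have "(cmod (det_C A))\<^sup>2 = 1"
    by (metis complex_norm_square mult.commute of_real_eq_1_iff)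
  then show ?thesis 
    using norm_ge_zero[of "det_C A"] by (auto simp: power2_eq_1_iff simp del: norm_ge_zero)
qed

lemma U_n_Sp: "A \<in> U_n \<Longrightarrow> A \<in> Sp" by (simp add: U_n_def)

lemma rho_hat_U_n: assumes "A \<in> U_n" shows "rho_hat A = det_C A"
  using cmod_det_C[OF assms] det_C_zblock[OF U_n_commute[OF assms]] by (simp add: rho_hat_zblock sgn_eq)

text \<open>A unitary matrix commutes with \<open>J0\<close>, hence leaves the subspace
  \<open>w = 0\<close> invariant, and \<open>Z = 0\<close> may be used to compute
  \<open>rho\<close>.\<close>

lemma rho_squared_U_n: assumes "A \<in> U_n" shows "(rho A)\<^sup>2 = (det_C A)\<^sup>2"
proof -
  have "complexify A ** emb 0 = emb 0 ** zblock A 0"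
    by (simp add: invariance_iff zblock_commute(2)[OF U_n_commute[OF assms]])
  then have "(rho A)\<^sup>2 = (rho_hat A)\<^sup>2"
    using rho_squared_zblock[OF U_n_Sp[OF assms] zero_contraction] by (simp add: rho_hat_zblock)
  then show ?thesis by (simp add: rho_hat_U_n assms)
qed

text \<open>The homotopy contracts \<open>h 1\<close> to the constant \<open>1\<close>, and a
  null-homotopic map into the circle lifts through the exponential.\<close>

lemma logarithm_of_homotopy:
  fixes h :: "real \<Rightarrow> 'a::real_normed_vector \<Rightarrow> complex"
  assumes cont: "continuous_on ({0..1} \<times> S) (\<lambda>x. h (fst x) (snd x))"
    and circle: "\<And>s x. s \<in> {0..1} \<Longrightarrow> x \<in> S \<Longrightarrow> cmod (h s x) = 1"
    and start: "\<And>x. x \<in> S \<Longrightarrow> h 0 x = 1"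
  shows "\<exists>g. continuous_on S g \<and> (\<forall>x\<in>S. h 1 x = exp (\<i> * complex_of_real (g x)))"
proof -
  have "homotopic_with_canon (\<lambda>_. True) S (sphere 0 1) (h 0) (h 1)"
  proof (subst homotopic_with, simp, intro exI[of _ "\<lambda>x. h (fst x) (snd x)"] conjI ballI)
    have "prod_topology (top_of_set {0..1::real}) (top_of_set S) = top_of_set ({0..1} \<times> S)"
      by (simp add: prod_topology_subtopology subtopology_subtopology euclidean_product_topology Times_Int_Times)
    then show "continuous_map (prod_topology (top_of_set {0..1::real}) (top_of_set S)) (top_of_set (sphere 0 1)) (\<lambda>x. h (fst x) (snd x))"
      using cont circle by (auto simp: continuous_map_in_subtopology)
  qed auto
  then have "homotopic_with_canon (\<lambda>_. True) S (sphere 0 1) (\<lambda>_. 1) (h 1)"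
    by (rule homotopic_with_eq) (use start in auto)
  then have "homotopic_with_canon (\<lambda>_. True) S (sphere 0 1) (h 1) (\<lambda>_. 1)"
    by (simp add: homotopic_with_sym)
  then show ?thesis
    using inessential_eq_continuous_logarithm_circle[of S "h 1"] by blast
qed

section \<open>A logarithm away from the eigenvalue one\<close>

definition Sp_star :: "(real^('n::finite + 'n)^('n + 'n)) set" where
  "Sp_star = {A\<in>Sp. \<not> is_eigenvalue A 1}"

text \<open>This is \<open>(1 + \<i> s S) (A - 1)\<close> for the Cayley transform
  \<open>S = J0 (A + 1) (A - 1)^-1\<close>, with the inverse multiplied out so that the entries are
  affine in those of \<open>A\<close>.\<close>

definition Fmat :: "real \<Rightarrow> real^('n::finite + 'n)^('n + 'n) \<Rightarrow> complex^('n + 'n)^('n + 'n)" where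
  "Fmat s A = (\<chi> i j. Complex ((A - mat 1) $ i $ j) (s * (J0 ** (A + mat 1)) $ i $ j))"

lemma Sp_star_inj:
  assumes "A \<in> Sp_star" "(A - mat 1) *v x = 0" shows "x = 0"
  using assms by (auto simp: Sp_star_def is_eigenvalue_def matrix_vector_mult_diff_rdistrib)

text \<open>This expresses the symmetry of \<open>S\<close> without inverting \<open>A - 1\<close>:
  when the product is expanded, the symplectic relation cancels the terms
  \<open>transpose A ** J0 ** A\<close> and \<open>J0\<close>.\<close>

lemma cayley_symmetric:
  assumes "A \<in> Sp"
  shows "transpose (transpose (A - mat 1) ** (J0 ** (A + mat 1))) = transpose (A - mat 1) ** (J0 ** (A + mat 1))"
proof -
  have t: "transpose (X - Y) = transpose X - transpose Y" "transpose (X + Y) = transpose X + transpose Y"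
    "transpose (- X) = - transpose X"
    for X Y :: "real^('a + 'a)^('a + 'a)"
    by (simp_all add: vec_eq_iff transpose_def)
  have "transpose (A - mat 1) ** (J0 ** (A + mat 1)) = transpose A ** (J0 ** A) + transpose A ** J0 - J0 ** A - J0"
    by (simp add: t transpose_mat matrix_add_distrib matrix_diff_distrib algebra_simps)
  also have "\<dots> = transpose A ** J0 - J0 ** A" by (simp add: Sp_D[OF assms])
  finally have eq: "transpose (A - mat 1) ** (J0 ** (A + mat 1)) = transpose A ** J0 - J0 ** A" .
  show ?thesis
    unfolding eq by (simp add: t matrix_transpose_mul transpose_J0 matrix_neg_mult)
qed

text \<open>For real symmetric \<open>S\<close> the matrix \<open>1 + \<i> s S\<close> is
  invertible. Without inverses: for \<open>v = a + \<i> b\<close> in the kernel, the symmetry makes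
  \<open>|(A - 1) a|^2 + |(A - 1) b|^2\<close> equal to zero.\<close>

lemma Fmat_invertible:
  assumes A: "A \<in> Sp_star" shows "det (Fmat s A) \<noteq> 0"
proof -
  let ?q = "A - mat 1" and ?p = "J0 ** (A + mat 1)"
  have S: "A \<in> Sp" using A by (simp add: Sp_star_def)
  have "v = 0" if v: "Fmat s A *v v = 0" for v
  proof -
    define a where "a = (\<chi> i. Re (v $ i))"
    define b where "b = (\<chi> i. Im (v $ i))"
    have "Re ((Fmat s A *v v) $ i) = 0" "Im ((Fmat s A *v v) $ i) = 0" for i using v by simp_all
    then have e1: "?q *v a = s *\<^sub>R (?p *v b)" and e2: "?q *v b = - (s *\<^sub>R (?p *v a))"
      by (simp_all add: vec_eq_iff Fmat_def matrix_vector_mult_def a_def b_def sum_subtractf sum.distrib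
          sum_distrib_left mult.assoc eq_neg_iff_add_eq_0 add.commute)
    let ?s = "transpose ?q ** ?p"
    have sym: "a \<bullet> (?s *v b) = b \<bullet> (?s *v a)"
      using inner_matrix_transpose[of ?s a b] cayley_symmetric[OF S] by (simp add: inner_commute)
    have "(?q *v a) \<bullet> (?q *v a) = s * (a \<bullet> (?s *v b))"
      by (subst (2) e1) (simp add: inner_matrix_transpose matrix_vector_mul_assoc)
    moreover have "(?q *v b) \<bullet> (?q *v b) = - s * (b \<bullet> (?s *v a))"
      by (subst (2) e2) (simp add: inner_matrix_transpose matrix_vector_mul_assoc)
    ultimately have "(?q *v a) \<bullet> (?q *v a) + (?q *v b) \<bullet> (?q *v b) = 0" using sym by simp
    then have "?q *v a = 0" "?q *v b = 0"
      by (simp_all add: add_nonneg_eq_0_iff)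
    then have "a = 0" "b = 0" using Sp_star_inj[OF A] by blast+
    then show ?thesis by (simp add: a_def b_def vec_eq_iff complex_eq_iff)
  qed
  then show ?thesis by (simp add: det_nonzero_iff)
qed

lemma det_scalar_mat: "det (mat c :: complex^'n::finite^'n) = c ^ CARD('n)"
  by (subst det_diagonal) (auto simp: mat_def)

text \<open>Conjugated into the coordinates \<open>z, w\<close>, the matrix \<open>Fmat 1 A\<close> is block triangular.\<close>

lemma det_Fmat: "det (Fmat 1 A) = (- 4) ^ CARD('n) * cnj (det (zblock A 0))"
  for A :: "real^('n::finite + 'n)^('n + 'n)"
proof -
  let ?h = "mat (1/2) :: complex^'n^'n" and ?g = "mat (- (\<i> / 2)) :: complex^'n^'n"
  let ?C = "block_matrix ?h ?h ?g (- ?g)"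
  let ?Z = "block_matrix (mat 1) (mat \<i>) (mat 1) (- mat \<i>) :: complex^('n + 'n)^('n + 'n)"
  let ?cz = "(\<chi> k l. cnj (zblock A 0 $ k $ l)) :: complex^'n^'n"
  have ml: "(mat c ** X) $ i $ j = c * X $ i $ j" "(X ** mat c) $ i $ j = X $ i $ j * c" for c and X :: "complex^'n^'n" and i j
    by (simp_all add: matrix_matrix_mult_def mat_def if_distrib if_distribR cong: if_cong)
  have ZC: "?Z ** ?C = mat 1"
    unfolding block_matrix_mult mat_1_block
    by (rule block_eqI) (auto simp: ml matrix_neg_mult mat_nth)
  define F11 F12 F21 F22 where
    "F11 = (\<chi> k l. Fmat 1 A $ Inl k $ Inl l)" and "F12 = (\<chi> k l. Fmat 1 A $ Inl k $ Inr l)" and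
    "F21 = (\<chi> k l. Fmat 1 A $ Inr k $ Inl l)" and "F22 = (\<chi> k l. Fmat 1 A $ Inr k $ Inr l)"
  have F: "Fmat 1 A = block_matrix F11 F12 F21 F22"
    by (rule block_eqI) (simp_all add: F11_def F12_def F21_def F22_def)
  \<comment> \<open>On the \<open>z\<close> coordinates \<open>J0\<close> acts as
    \<open>\<i>\<close>, so the \<open>z\<close> part of \<open>Fmat 1 A\<close> applied to a vector
    collapses to \<open>-2 z\<close>. On the \<open>w\<close> coordinates it acts as
    \<open>- \<i>\<close>, which leaves twice the \<open>w\<close> part of \<open>A\<close>; its
    blocks are \<open>wblock A 0\<close> and, as \<open>A\<close> is real, the conjugate of
    \<open>zblock A 0\<close>.\<close>
  have ZFC: "?Z ** Fmat 1 A ** ?C = block_matrix (mat (- 2)) 0 (mat 2 ** wblock A 0) (mat 2 ** ?cz)"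
    unfolding F block_matrix_mult
    by (rule block_eqI)
      (auto simp: ml matrix_neg_mult matrix_add_distrib matrix_mul_assoc[symmetric]
        F11_def F12_def F21_def F22_def Fmat_def mat_nth zblock_zero_nth wblock_zero_nth J0_nth complex_eq_iff algebra_simps
        add_divide_distrib diff_divide_distrib)
  have eq: "det ?Z * det (Fmat 1 A) * det ?C = det (mat (- 2) :: complex^'n^'n) * (det (mat 2 :: complex^'n^'n) * det ?cz)"
    using arg_cong[OF ZFC, of det] by (simp only: det_block_lower det_mul)
  have ZC1: "det ?Z * det ?C = 1" using arg_cong[OF ZC, of det] by (simp only: det_mul det_I)
  have "det (Fmat 1 A) = (det ?Z * det ?C) * det (Fmat 1 A)" by (simp only: ZC1 mult_1)
  also have "\<dots> = det ?Z * det (Fmat 1 A) * det ?C" by (simp only: mult_ac)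
  also have "\<dots> = (- 2) ^ CARD('n) * (2 ^ CARD('n) * cnj (det (zblock A 0)))"
    unfolding eq by (simp only: det_scalar_mat det_cnj)
  also have "\<dots> = (- 4) ^ CARD('n) * cnj (det (zblock A 0))"
    by (simp add: power_mult_distrib[symmetric] mult.assoc[symmetric])
  finally show ?thesis .
qed

text \<open>The homotopy runs over \<open>s\<close>. At \<open>s = 0\<close> the determinant is real
  and nonzero but may be negative, so only the square of the phase is joined to \<open>1\<close>;
  the square also absorbs the sign of \<open>(-4)^n\<close> in \<open>det_Fmat\<close>.\<close>

lemma rho_hat_log_Sp_star:
  "\<exists>k. continuous_on Sp_star k \<and> (\<forall>A\<in>Sp_star :: (real^('n::finite + 'n)^('n + 'n)) set. (rho_hat A)\<^sup>2 = exp (\<i> * complex_of_real (k A)))"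
proof -
  let ?f = "\<lambda>s A. (sgn (det (Fmat s A)))\<^sup>2"
  have one: "?f 1 A = cnj ((rho_hat A)\<^sup>2)" for A :: "real^('n + 'n)^('n + 'n)"
  proof -
    have "sgn ((- 4 :: complex) ^ CARD('n)) = (- 1) ^ CARD('n)"
    proof -
      have "sgn (- 4 :: complex) = - 1" by (simp add: sgn_eq)
      then show ?thesis by (simp only: sgn_power_complex)
    qed
    moreover have "((- 1 :: complex) ^ CARD('n))\<^sup>2 = 1" by (cases "even CARD('n)") auto
    moreover have "sgn (cnj z) = cnj (sgn z)" for z by (simp add: sgn_eq)
    ultimately show ?thesis
      by (simp add: det_Fmat rho_hat_zblock sgn_mult power_mult_distrib)
  qed
  have zero: "?f 0 A = 1" if "A \<in> Sp_star" for A :: "real^('n + 'n)^('n + 'n)"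
  proof -
    have "Fmat 0 A = complexify (A - mat 1)" by (simp add: vec_eq_iff Fmat_def complex_eq_iff)
    moreover have "det (complexify X) = of_real (det X)" for X :: "real^('n + 'n)^('n + 'n)"
      by (simp add: det_def)
    ultimately have d: "det (Fmat 0 A) = of_real (det (A - mat 1))" by simp
    have "det (A - mat 1) \<noteq> 0" using Fmat_invertible[OF that, of 0] d by simp
    then show ?thesis unfolding d by (simp add: sgn_eq power_divide flip: of_real_power)
  qed
  have cont: "continuous_on ({0..1} \<times> Sp_star) (\<lambda>x. ?f (fst x) (snd x :: real^('n + 'n)^('n + 'n)))"
    unfolding sgn_div_norm using Fmat_invertible
    by (intro continuous_intros) (auto simp: Fmat_def Complex_eq intro!: continuous_intros)
  have "\<exists>g. continuous_on Sp_star g \<and> (\<forall>A\<in>Sp_star :: (real^('n + 'n)^('n + 'n)) set. ?f 1 A = exp (\<i> * complex_of_real (g A)))"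
    by (rule logarithm_of_homotopy[OF cont, simplified])
      (auto simp: zero norm_power norm_sgn Fmat_invertible)
  then obtain g where g: "continuous_on Sp_star g"
    "\<forall>A\<in>Sp_star :: (real^('n + 'n)^('n + 'n)) set. cnj ((rho_hat A)\<^sup>2) = exp (\<i> * complex_of_real (g A))"
    unfolding one by blast
  have "(rho_hat A)\<^sup>2 = exp (\<i> * complex_of_real (- g A))" if "A \<in> Sp_star" for A :: "real^('n + 'n)^('n + 'n)"
  proof -
    have "(rho_hat A)\<^sup>2 = cnj (exp (\<i> * complex_of_real (g A)))"
      using g(2) that by (metis complex_cnj_cnj)
    then show ?thesis by (simp add: exp_cnj)
  qed
  moreover have "continuous_on Sp_star (\<lambda>A. - g A)" using g(1) by (intro continuous_intros)
  ultimately show ?thesis by blast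
qed

section \<open>Polar decomposition and the retraction onto the unitary group\<close>

lemma symmetric_eigenbasis:
  fixes S :: "real^'m::finite^'m"
  assumes "transpose S = S"
  obtains B c where "finite B" "span B = UNIV" "pairwise orthogonal B" "\<And>b. b \<in> B \<Longrightarrow> norm b = 1"
    "\<And>b. b \<in> B \<Longrightarrow> S *v b = c b *\<^sub>R b"
proof -
  have sym: "x \<bullet> (S *v y) = y \<bullet> (S *v x)" for x y
    using inner_matrix_transpose[of S x y] assms by (simp add: inner_commute)
  have Q: "sym_bilinear (\<lambda>x y. x \<bullet> (S *v y))"
    unfolding sym_bilinear_def
  proof (intro conjI allI)
    show "linear (\<lambda>y. x \<bullet> (S *v y))" for x
      by (rule linearI) (simp_all add: vec.add inner_simps matrix_vector_mult_scaleR)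
  qed (rule sym)
  obtain B where B: "finite B" "span B = UNIV" "pairwise orthogonal B" "\<forall>b\<in>B. norm b = 1"
    "\<forall>b\<in>B. \<exists>c. b \<in> form_eigenspace UNIV (\<lambda>x y. x \<bullet> (S *v y)) c"
    using form_eigenbasis[OF Q subspace_UNIV] by blast
  have "\<exists>c. S *v b = c *\<^sub>R b" if b: "b \<in> B" for b
  proof -
    obtain c where c: "\<And>w. b \<bullet> (S *v w) = c * (b \<bullet> w)"
      using B(5) b by (auto simp: form_eigenspace_def)
    have "w \<bullet> (S *v b) = w \<bullet> (c *\<^sub>R b)" for w
      using c[of w] sym[of w b] by (simp add: inner_commute)
    then have "S *v b = c *\<^sub>R b" by (metis vector_eq_ldot)
    then show ?thesis by blast
  qed
  then obtain c where "\<And>b. b \<in> B \<Longrightarrow> S *v b = c b *\<^sub>R b" by metis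
  then show thesis using that B by blast
qed

lemma matrix_eq_on_span:
  fixes S T :: "real^'m::finite^'m"
  assumes "span B = UNIV" "\<And>b. b \<in> B \<Longrightarrow> S *v b = T *v b"
  shows "S = T"
proof -
  have "S *v x = T *v x" for x
    using linear_eq_on_span[of "(*v) S" "(*v) T" B x] assms by simp
  then show ?thesis by (simp add: matrix_eq)
qed

section \<open>Positive definite square roots\<close>

definition pos_def :: "real^'m^'m::finite \<Rightarrow> bool" where
  "pos_def P \<longleftrightarrow> transpose P = P \<and> (\<forall>x. x \<noteq> 0 \<longrightarrow> x \<bullet> (P *v x) > 0)"

lemma is_polar_factor_pos_def: "is_polar_factor A P \<longleftrightarrow> pos_def P \<and> P ** P = transpose A ** A"
  by (simp add: is_polar_factor_def pos_def_def)

lemma pos_def_det: "pos_def P \<Longrightarrow> det P \<noteq> 0"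
  unfolding det_nonzero_iff pos_def_def by (metis inner_zero_right less_irrefl)

lemma square_root_exists:
  fixes S :: "real^'m::finite^'m"
  assumes S: "pos_def S"
  shows "\<exists>P. pos_def P \<and> P ** P = S"
proof -
  have sym: "transpose S = S" and pos: "\<And>x. x \<noteq> 0 \<Longrightarrow> x \<bullet> (S *v x) > 0"
    using S by (auto simp: pos_def_def)
  obtain B c where B: "finite B" "span B = UNIV" "pairwise orthogonal B" "\<And>b. b \<in> B \<Longrightarrow> norm b = 1"
    "\<And>b. b \<in> B \<Longrightarrow> S *v b = c b *\<^sub>R b"
    using symmetric_eigenbasis[OF sym] by blast
  have bb: "b \<bullet> b' = (if b = b' then 1 else 0)" if "b \<in> B" "b' \<in> B" for b b'
    using B that by (auto simp: pairwise_def orthogonal_def norm_eq_1)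
  have cpos: "c b > 0" if "b \<in> B" for b
  proof -
    have "b \<noteq> 0" using B(4)[OF that] by auto
    then show ?thesis using pos[of b] B(5)[OF that] bb[OF that that] by simp
  qed
  define p where "p = (\<lambda>x. \<Sum>b\<in>B. (sqrt (c b) * (x \<bullet> b)) *\<^sub>R b)"
  have lin: "linear p"
    by (rule linearI) (auto simp: p_def inner_simps algebra_simps sum.distrib scaleR_sum_right)
  define P where "P = matrix p"
  have Pp: "P *v x = p x" for x using lin by (simp add: P_def matrix_works linear_matrix_vector_mul_eq)
  have form: "x \<bullet> (P *v y) = (\<Sum>b\<in>B. sqrt (c b) * (x \<bullet> b) * (y \<bullet> b))" for x y
    by (simp add: Pp p_def inner_sum_right mult_ac)
  have "x \<bullet> (transpose P *v y) = x \<bullet> (P *v y)" for x y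
    using inner_matrix_transpose[of P x y] by (simp add: form inner_commute[of "P *v x"] mult_ac)
  then have "transpose P = P" by (metis matrix_eq vector_eq_ldot)
  moreover have "x \<bullet> (P *v x) > 0" if x: "x \<noteq> 0" for x
  proof -
    have "\<exists>b\<in>B. x \<bullet> b \<noteq> 0"
    proof (rule ccontr)
      assume "\<not> ?thesis"
      then have "x = 0" using orthonormal_coeff[of B x] B by simp
      then show False using x by simp
    qed
    then obtain b where b: "b \<in> B" "x \<bullet> b \<noteq> 0" by blast
    show ?thesis unfolding form
    proof (rule sum_pos2[OF B(1) b(1)])
      show "0 < sqrt (c b) * (x \<bullet> b) * (x \<bullet> b)"
        using cpos[OF b(1)] b(2) by (auto simp: mult.assoc zero_less_mult_iff)
      show "0 \<le> sqrt (c i) * (x \<bullet> i) * (x \<bullet> i)" if "i \<in> B" for i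
        using cpos[OF that] by (auto simp: mult.assoc)
    qed
  qed
  ultimately have "pos_def P" by (simp add: pos_def_def)
  moreover have "P ** P = S"
  proof (rule matrix_eq_on_span[OF B(2)])
    fix b assume b: "b \<in> B"
    have "P *v b = (\<Sum>b'\<in>B. if b' = b then sqrt (c b) *\<^sub>R b else 0)"
      unfolding Pp p_def using b by (intro sum.cong) (auto simp: bb)
    then have "P *v b = sqrt (c b) *\<^sub>R b" using b B(1) by simp
    then show "(P ** P) *v b = S *v b"
      using cpos[OF b] B(5)[OF b] by (simp add: matrix_vector_mul_assoc[symmetric] matrix_vector_mult_scaleR)
  qed
  ultimately show ?thesis by blast
qed

text \<open>If \<open>P\<^sup>2 = N\<^sup>2\<close> and \<open>D = P - N\<close> then \<open>P D + D N = 0\<close>, and evaluating this on an eigenvector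
  of \<open>D\<close> shows that its eigenvalue vanishes.\<close>

lemma square_root_unique:
  fixes P N :: "real^'m::finite^'m"
  assumes P: "pos_def P" and N: "transpose N = N" "\<And>x. x \<bullet> (N *v x) \<ge> 0" and eq: "P ** P = N ** N"
  shows "N = P"
proof -
  define D where "D = P - N"
  have symP: "transpose P = P" using P by (simp add: pos_def_def)
  have "transpose D = transpose P - transpose N" by (simp add: D_def transpose_def vec_eq_iff)
  then have symD: "transpose D = D" using symP N by (simp add: D_def)
  have PD: "P ** D + D ** N = 0" by (simp add: D_def matrix_diff_distrib eq)
  obtain B c where B: "finite B" "span B = UNIV" "pairwise orthogonal B" "\<And>b. b \<in> B \<Longrightarrow> norm b = 1"
    "\<And>b. b \<in> B \<Longrightarrow> D *v b = c b *\<^sub>R b"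
    using symmetric_eigenbasis[OF symD] by blast
  have "D = 0"
  proof (rule matrix_eq_on_span[OF B(2)])
    fix b assume b: "b \<in> B"
    have "b \<bullet> ((P ** D + D ** N) *v b) = 0" by (simp add: PD)
    then have "b \<bullet> (P *v (D *v b)) + b \<bullet> (D *v (N *v b)) = 0"
      by (simp add: matrix_vector_mult_add_rdistrib inner_simps matrix_vector_mul_assoc)
    moreover have "b \<bullet> (D *v (N *v b)) = (D *v b) \<bullet> (N *v b)"
      using inner_matrix_transpose[of D b "N *v b"] symD by simp
    ultimately have "c b * (b \<bullet> (P *v b) + b \<bullet> (N *v b)) = 0"
      using B(5)[OF b] by (simp add: matrix_vector_mult_scaleR ring_distribs)
    moreover have "b \<noteq> 0" using B(4)[OF b] by auto
    then have "b \<bullet> (P *v b) + b \<bullet> (N *v b) > 0"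
      using P N(2)[of b] by (simp add: pos_def_def add_pos_nonneg)
    ultimately have "c b = 0" by simp
    then show "D *v b = 0 *v b" using B(5)[OF b] by simp
  qed
  then show ?thesis by (simp add: D_def)
qed

lemma pos_def_gram: assumes "det A \<noteq> 0" shows "pos_def (transpose A ** A)"
  unfolding pos_def_def
proof (intro conjI allI impI)
  fix x :: "real^'a" assume "x \<noteq> 0"
  then have "A *v x \<noteq> 0" using assms by (auto simp: det_nonzero_iff)
  moreover have "x \<bullet> (transpose A ** A *v x) = (A *v x) \<bullet> (A *v x)"
    by (simp add: inner_matrix_transpose matrix_vector_mul_assoc)
  ultimately show "x \<bullet> (transpose A ** A *v x) > 0" by simp
qed (simp add: matrix_transpose_mul)

lemma polar_factor_unique_exists:
  assumes "det A \<noteq> 0" shows "\<exists>!P. is_polar_factor A P"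
proof -
  obtain P where P: "pos_def P" "P ** P = transpose A ** A"
    using square_root_exists[OF pos_def_gram[OF assms]] by blast
  show ?thesis
  proof (rule ex1I)
    show "is_polar_factor A P" using P by (simp add: is_polar_factor_pos_def)
    fix N assume N: "is_polar_factor A N"
    have "x \<bullet> (N *v x) \<ge> 0" for x
      using N by (cases "x = 0") (auto simp: is_polar_factor_def intro: less_imp_le)
    moreover have "transpose N = N" "P ** P = N ** N" using N P(2) by (simp_all add: is_polar_factor_def)
    ultimately show "N = P" by (intro square_root_unique[OF P(1)])
  qed
qed

section \<open>Polar factors of symplectic matrices\<close>

definition polar_P :: "real^'m^'m::finite \<Rightarrow> real^'m^'m" where
  "polar_P A = (THE P. is_polar_factor A P)"

lemma polar_P: assumes "det A \<noteq> 0" shows "pos_def (polar_P A)" "polar_P A ** polar_P A = transpose A ** A"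
  using theI'[OF polar_factor_unique_exists[OF assms]]
  by (simp_all add: polar_P_def is_polar_factor_pos_def)

lemma polar_decomposition: assumes "det A \<noteq> 0" shows "polar_U A ** polar_P A = A"
  using matrix_inv_props[OF pos_def_det[OF polar_P(1)[OF assms]]]
  by (simp add: polar_U_def polar_P_def matrix_mul_assoc[symmetric])

lemma orthogonal_polar_U:
  assumes A: "det A \<noteq> 0" shows "orthogonal_matrix (polar_U A)"
proof -
  let ?P = "polar_P A" and ?R = "matrix_inv (polar_P A)"
  have P: "transpose ?P = ?P" "det ?P \<noteq> 0"
    using polar_P(1)[OF A] pos_def_det by (auto simp: pos_def_def)
  have R: "?P ** ?R = mat 1" "?R ** ?P = mat 1" using matrix_inv_props[OF P(2)] by auto
  have "transpose ?R ** transpose ?P = mat 1"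
    by (metis R(1) matrix_transpose_mul transpose_mat)
  then have tR: "transpose ?R ** ?P = mat 1" by (simp add: P(1))
  have "transpose (polar_U A) ** polar_U A = transpose ?R ** (transpose A ** A) ** ?R"
    by (simp add: polar_U_def polar_P_def matrix_transpose_mul matrix_mul_assoc)
  also have "\<dots> = (transpose ?R ** ?P) ** (?P ** ?R)"
    by (simp add: polar_P(2)[OF A, symmetric] matrix_mul_assoc)
  also have "\<dots> = mat 1" by (simp add: tR R)
  finally show ?thesis by (simp add: orthogonal_matrix)
qed

text \<open>The positivity condition is the nonstrict one because it is closed; this makes the graph
  of \<open>polar_U\<close> closed in \<open>continuous_on_polar_U\<close>.\<close>

lemma polar_U_unique:
  assumes A: "det A \<noteq> 0" and U: "orthogonal_matrix U"
    and sym: "transpose (transpose U ** A) = transpose U ** A"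
    and nn: "\<And>x. x \<bullet> ((transpose U ** A) *v x) \<ge> 0"
  shows "polar_U A = U" "polar_P A = transpose U ** A"
proof -
  have UU: "U ** transpose U = mat 1" using U by (simp add: orthogonal_matrix_def)
  have "(transpose U ** A) ** (transpose U ** A) = transpose (transpose U ** A) ** (transpose U ** A)"
    by (simp only: sym)
  also have "\<dots> = transpose A ** (U ** transpose U) ** A"
    by (simp add: matrix_transpose_mul matrix_mul_assoc)
  finally have "polar_P A ** polar_P A = (transpose U ** A) ** (transpose U ** A)"
    by (simp add: UU polar_P[OF A])
  then show P: "polar_P A = transpose U ** A"
    using square_root_unique[OF polar_P(1)[OF A] sym nn] by simp
  have "U ** polar_P A = A" by (simp add: P matrix_mul_assoc UU)
  then have "polar_U A = U ** polar_P A ** matrix_inv (polar_P A)"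
    by (simp add: polar_U_def polar_P_def)
  then show "polar_U A = U"
    by (simp add: matrix_mul_assoc[symmetric] matrix_inv_props pos_def_det polar_P A)
qed

lemma pos_def_Sp_iff: "transpose P = P \<Longrightarrow> P \<in> Sp \<longleftrightarrow> P ** J0 ** P = J0"
  by (simp add: Sp_iff)

text \<open>Put \<open>N = - J0 P^-1 J0\<close>, that is, \<open>transpose J0 ** P^-1 ** J0\<close>.
  It is symmetric and nonnegative, and since \<open>transpose A ** A\<close> is symplectic,
  \<open>N\<close> is another square root of it. Uniqueness gives \<open>N = P\<close>, which says
  that \<open>P\<close> is symplectic.\<close>

lemma polar_P_Sp: assumes A: "A \<in> Sp" shows "polar_P A \<in> Sp"
proof -
  let ?P = "polar_P A" and ?R = "matrix_inv (polar_P A)" and ?B = "transpose A ** A"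
  have dA: "det A \<noteq> 0" by (rule Sp_det_nonzero[OF A])
  note P = polar_P[OF dA]
  have symP: "transpose ?P = ?P" using P(1) by (simp add: pos_def_def)
  have dP: "det ?P \<noteq> 0" by (rule pos_def_det[OF P(1)])
  have R: "?P ** ?R = mat 1" "?R ** ?P = mat 1" using matrix_inv_props[OF dP] by auto
  have "transpose ?R ** ?P = mat 1" by (metis R(1) matrix_transpose_mul symP transpose_mat)
  then have "transpose ?R ** ?P ** ?R = ?R" by simp
  then have symR: "transpose ?R = ?R" by (simp add: matrix_mul_assoc[symmetric] R)
  define N where "N = - (J0 ** ?R ** J0)"
  have B: "?B ** J0 ** ?B = J0"
    using Sp_iff[of ?B] Sp_mult[OF Sp_transpose[OF A] A] by (simp add: matrix_transpose_mul)
  have symN: "transpose N = N"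
  proof -
    have "transpose N = - (transpose J0 ** (transpose ?R ** transpose J0))"
    proof -
      have "transpose (- X) = - transpose X" for X :: "real^('a + 'a)^('a + 'a)"
        by (simp add: transpose_def vec_eq_iff)
      then show ?thesis by (simp add: N_def matrix_transpose_mul)
    qed
    then show ?thesis by (simp add: symR transpose_J0 matrix_neg_mult N_def matrix_mul_assoc)
  qed
  have nnN: "x \<bullet> (N *v x) \<ge> 0" for x
  proof -
    have neg: "(- M) *v y = - (M *v y)" for M :: "real^('a + 'a)^('a + 'a)" and y
      by (simp add: vec_eq_iff matrix_vector_mult_def sum_negf)
    define y where "y = ?R *v (J0 *v x)"
    have y: "J0 *v x = ?P *v y" by (simp add: y_def matrix_vector_mul_assoc matrix_mul_assoc R)
    have "x \<bullet> (N *v x) = - (x \<bullet> (J0 *v y))"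
      by (simp add: N_def neg y_def matrix_vector_mul_assoc matrix_mul_assoc)
    also have "\<dots> = (J0 *v x) \<bullet> y"
      by (simp add: inner_matrix_transpose transpose_J0 neg)
    also have "\<dots> = y \<bullet> (?P *v y)" by (simp add: y inner_commute)
    also have "\<dots> \<ge> 0" using P(1) by (cases "y = 0") (auto simp: pos_def_def intro: less_imp_le)
    finally show ?thesis .
  qed
  have "N ** N = J0 ** ?R ** (J0 ** J0) ** ?R ** J0"
    by (simp add: N_def matrix_neg_mult matrix_mul_assoc)
  then have NN: "N ** N = - (J0 ** ?R ** ?R ** J0)" by (simp add: J0_J0 matrix_neg_mult)
  have RRB: "(?R ** ?R) ** ?B = mat 1"
    unfolding P(2)[symmetric] by (metis R(2) matrix_mul_assoc matrix_mul_rid)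
  have "?R ** ?R ** J0 = (?R ** ?R) ** (?B ** J0 ** ?B)" by (simp add: B)
  also have "\<dots> = (?R ** ?R ** ?B) ** J0 ** ?B" by (simp only: matrix_mul_assoc)
  also have "\<dots> = J0 ** ?B" by (simp add: RRB)
  finally have "J0 ** (?R ** ?R ** J0) = J0 ** (J0 ** ?B)" by simp
  then have "- (J0 ** ?R ** ?R ** J0) = ?B"
    by (simp add: matrix_mul_assoc J0_J0 matrix_neg_mult)
  then have "?P ** ?P = N ** N" by (simp add: NN P(2))
  then have "N = ?P" by (rule square_root_unique[OF P(1) symN nnN])
  then have "?P ** J0 = - (J0 ** ?R ** J0) ** J0" by (simp add: N_def)
  also have "\<dots> = J0 ** ?R"
    by (simp add: matrix_neg_mult matrix_mul_assoc[symmetric] J0_J0)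
  finally have "?P ** J0 ** ?P = J0" by (simp add: matrix_mul_assoc[symmetric] R)
  then show ?thesis using pos_def_Sp_iff[OF symP] by simp
qed

lemma polar_U_U_n: assumes A: "A \<in> Sp" shows "polar_U A \<in> U_n"
proof -
  have "polar_U A \<in> Sp"
    unfolding polar_U_def polar_P_def[symmetric]
    by (intro Sp_mult Sp_matrix_inv polar_P_Sp A)
  then show ?thesis using orthogonal_polar_U[OF Sp_det_nonzero[OF A]] by (simp add: U_n_def)
qed

lemma polar_U_of_U_n: assumes "A \<in> U_n" shows "polar_U A = A"
proof -
  have "orthogonal_matrix A" "A \<in> Sp" using assms by (auto simp: U_n_def)
  then show ?thesis
    by (intro polar_U_unique Sp_det_nonzero) (auto simp: orthogonal_matrix transpose_mat)
qed

lemma compact_U_n: "compact (U_n :: (real^('n::finite + 'n)^('n + 'n)) set)"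
proof -
  have "closed {A :: real^('n + 'n)^('n + 'n). transpose A ** A = mat 1}"
    by (intro closed_Collect_eq continuous_intros)
  then have "closed (U_n :: (real^('n + 'n)^('n + 'n)) set)"
    unfolding U_n_def orthogonal_matrix by (intro closed_Int closed_Sp)
  moreover have "bounded (U_n :: (real^('n + 'n)^('n + 'n)) set)"
    unfolding bounded_iff
  proof (intro exI ballI)
    fix A :: "real^('n + 'n)^('n + 'n)" assume "A \<in> U_n"
    then have "norm (A $ i) = 1" for i
      by (simp add: U_n_def orthogonal_matrix_orthonormal_rows row_def)
    then show "norm A \<le> (\<Sum>i\<in>(UNIV::('n + 'n) set). 1)"
      unfolding norm_vec_def[of A] by (intro order_trans[OF L2_set_le_sum sum_mono]) auto
  qed
  ultimately show ?thesis by (simp add: compact_eq_bounded_closed)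
qed

text \<open>The factor \<open>U\<close> is characterized by \<open>transpose U ** A\<close> being
  symmetric and nonnegative. These are closed conditions and \<open>U\<close> ranges over a compact
  group, so the closed graph criterion applies.\<close>

lemma continuous_on_polar_U:
  "continuous_on (Sp :: (real^('n::finite + 'n)^('n + 'n)) set) polar_U"
proof (rule continuous_from_closed_graph[OF compact_U_n])
  let ?S = "Sp :: (real^('n + 'n)^('n + 'n)) set"
  show "polar_U \<in> ?S \<rightarrow> U_n" using polar_U_U_n by blast
  have "(\<lambda>A. (A, polar_U A)) ` ?S = (?S \<times> U_n)
      \<inter> {x. transpose (transpose (snd x) ** fst x) = transpose (snd x) ** fst x}
      \<inter> {x. \<forall>v. 0 \<le> v \<bullet> ((transpose (snd x) ** fst x) *v v)}" (is "_ = ?G")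
  proof
    show "(\<lambda>A. (A, polar_U A)) ` ?S \<subseteq> ?G"
    proof
      fix x assume "x \<in> (\<lambda>A. (A, polar_U A)) ` ?S"
      then obtain A where A: "A \<in> Sp" "x = (A, polar_U A)" by blast
      have dA: "det A \<noteq> 0" by (rule Sp_det_nonzero[OF A(1)])
      have "transpose (polar_U A) ** A = transpose (polar_U A) ** (polar_U A ** polar_P A)"
        by (simp add: polar_decomposition dA)
      also have "\<dots> = polar_P A"
        using orthogonal_polar_U[OF dA] by (simp add: matrix_mul_assoc orthogonal_matrix)
      finally have "transpose (polar_U A) ** A = polar_P A" .
      moreover have "v \<bullet> (polar_P A *v v) \<ge> 0" for v
        using polar_P(1)[OF dA] by (cases "v = 0") (auto simp: pos_def_def intro: less_imp_le)
      ultimately show "x \<in> ?G"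
        using A polar_U_U_n polar_P(1)[OF dA] by (auto simp: pos_def_def)
    qed
    show "?G \<subseteq> (\<lambda>A. (A, polar_U A)) ` ?S"
    proof
      fix x assume x: "x \<in> ?G"
      obtain A U where AU: "x = (A, U)" by (cases x)
      have "polar_U A = U"
        using x AU by (intro polar_U_unique(1)) (auto simp: Sp_det_nonzero U_n_def)
      then show "x \<in> (\<lambda>A. (A, polar_U A)) ` ?S" using x AU by auto
    qed
  qed
  also have "closed ?G"
    by (intro closed_Int closed_Times closed_Sp compact_imp_closed[OF compact_U_n]
        closed_Collect_eq closed_Collect_all closed_Collect_le continuous_intros)
  finally show "closed ((\<lambda>A. (A, polar_U A)) ` ?S)" .
qed

text \<open>This is \<open>(1 + s C) (P + 1)\<close> for the Cayley transform
  \<open>C = (P - 1) (P + 1)^-1\<close>. The values at \<open>s\<close> and \<open>- s\<close> are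
  the numerator and denominator when the inverse transform is applied to \<open>s C\<close>.\<close>

definition moebius_num :: "real \<Rightarrow> real^'m^'m::finite \<Rightarrow> real^'m^'m" where
  "moebius_num s P = (1 + s) *\<^sub>R P + (1 - s) *\<^sub>R mat 1"

lemma moebius_num_det:
  assumes P: "pos_def P" and s: "s \<in> {-1..1}"
  shows "det (moebius_num s P) \<noteq> 0"
  unfolding det_nonzero_iff
proof (intro allI impI, rule ccontr)
  fix x assume x: "moebius_num s P *v x = 0" "x \<noteq> 0"
  have "x \<bullet> (moebius_num s P *v x) = (1 + s) * (x \<bullet> (P *v x)) + (1 - s) * (x \<bullet> x)"
    by (simp add: moebius_num_def matrix_vector_mult_add_rdistrib scaleR_matrix_vector_assoc[symmetric] inner_simps)
  moreover have "x \<bullet> (P *v x) > 0" "x \<bullet> x > 0" using P x by (auto simp: pos_def_def)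
  then have "(1 + s) * (x \<bullet> (P *v x)) + (1 - s) * (x \<bullet> x) > 0"
    using s by (cases "s = 1") (auto intro!: add_nonneg_pos mult_nonneg_nonneg)
  ultimately show False using x by simp
qed

text \<open>The path \<open>s \<mapsto> moebius s P\<close> scales the Cayley transform \<open>(P - 1) (P + 1)\<^sup>-\<^sup>1\<close> linearly; it joins
  the identity to \<open>P\<close> within the symplectic positive definite matrices.\<close>

definition moebius :: "real \<Rightarrow> real^'m^'m::finite \<Rightarrow> real^'m^'m" where
  "moebius s P = moebius_num s P ** matrix_inv (moebius_num (- s) P)"

text \<open>From \<open>P J0 = J0 P^-1\<close> it follows that \<open>?N J0 = J0 P^-1 ?D\<close>,
  and likewise with \<open>?N\<close> and \<open>?D\<close> exchanged. As \<open>?N\<close> and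
  \<open>?D\<close> commute, \<open>?N J0 ?N = ?D J0 ?D\<close>, and dividing by \<open>?D\<close>
  on both sides gives the symplectic relation.\<close>

lemma moebius_Sp:
  assumes P: "pos_def P" and Sp: "P \<in> Sp" and s: "s \<in> {0..1}"
  shows "moebius s P \<in> Sp"
proof -
  let ?N = "moebius_num s P" and ?D = "moebius_num (- s) P" and ?R = "matrix_inv P"
  let ?Di = "matrix_inv (moebius_num (- s) P)"
  have symP: "transpose P = P" using P by (simp add: pos_def_def)
  have tr: "transpose (moebius_num t P) = moebius_num t P" for t
  proof -
    have "transpose (moebius_num t P) = (1 + t) *\<^sub>R transpose P + (1 - t) *\<^sub>R transpose (mat 1)"
      by (simp add: moebius_num_def transpose_def vec_eq_iff)
    then show ?thesis by (simp add: symP transpose_mat moebius_num_def)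
  qed
  have PJP: "P ** J0 ** P = J0" using Sp pos_def_Sp_iff[OF symP] by simp
  have R: "P ** ?R = mat 1" "?R ** P = mat 1" using matrix_inv_props[OF pos_def_det[OF P]] by auto
  have PJ: "P ** J0 = J0 ** ?R"
    using arg_cong[OF PJP, of "\<lambda>X. X ** ?R"] by (simp add: matrix_mul_assoc[symmetric] R)
  have sc: "(c *\<^sub>R X) ** Y = c *\<^sub>R (X ** Y)" "X ** (c *\<^sub>R Y) = c *\<^sub>R (X ** Y)"
    for c and X Y :: "real^('a + 'a)^('a + 'a)"
    by (simp_all add: matrix_scalar_ac scalar_matrix_assoc)
  have NJ: "moebius_num t P ** J0 = J0 ** ?R ** moebius_num (- t) P" for t
    by (simp add: moebius_num_def matrix_add_distrib sc PJ matrix_mul_assoc[symmetric] R)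
  have "(a *\<^sub>R P + b *\<^sub>R mat 1) ** (c *\<^sub>R P + d *\<^sub>R mat 1)
      = (c *\<^sub>R P + d *\<^sub>R mat 1) ** (a *\<^sub>R P + b *\<^sub>R mat 1)" for a b c d
    by (simp add: matrix_add_distrib sc scaleR_add_right mult.commute add_ac)
  then have comm: "?D ** ?N = ?N ** ?D" unfolding moebius_num_def .
  have eq: "?N ** J0 ** ?N = ?D ** J0 ** ?D"
    using NJ[of s] NJ[of "- s"] comm by (simp add: matrix_mul_assoc[symmetric])
  have dD: "det ?D \<noteq> 0" using s by (intro moebius_num_det[OF P]) auto
  have Di: "?D ** ?Di = mat 1" "?Di ** ?D = mat 1" using matrix_inv_props[OF dD] by auto
  have tDi: "transpose ?Di ** ?D = mat 1" by (metis Di(1) matrix_transpose_mul tr transpose_mat)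
  have "transpose (moebius s P) ** J0 ** moebius s P = transpose ?Di ** (?N ** J0 ** ?N) ** ?Di"
    by (simp add: moebius_def matrix_transpose_mul tr matrix_mul_assoc)
  also have "\<dots> = (transpose ?Di ** ?D) ** J0 ** (?D ** ?Di)"
    by (simp only: eq matrix_mul_assoc)
  also have "\<dots> = J0" by (simp add: tDi Di)
  finally show ?thesis by (simp add: Sp_iff)
qed

lemma moebius_0_1:
  assumes "pos_def P" shows "moebius 0 P = mat 1" "moebius 1 P = P"
proof -
  show "moebius 0 P = mat 1"
    using matrix_inv_props(1)[OF moebius_num_det[OF assms, of 0]] by (simp add: moebius_def)
  have "moebius 1 P = P ** moebius_num (- 1) P ** matrix_inv (moebius_num (- 1) P)"
    by (simp add: moebius_def moebius_num_def matrix_scalar_ac)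
  then show "moebius 1 P = P"
    using matrix_inv_props(1)[OF moebius_num_det[OF assms, of "-1"]]
    by (simp add: matrix_mul_assoc[symmetric])
qed

lemma logarithm_trivial_on_U_n:
  fixes f :: "real^('n::finite + 'n)^('n + 'n) \<Rightarrow> complex"
  assumes f: "continuous_on Sp f" "f ` Sp \<subseteq> sphere 0 1" and one: "\<And>A. A \<in> U_n \<Longrightarrow> f A = 1"
  shows "\<exists>g. continuous_on Sp g \<and> (\<forall>A\<in>Sp. f A = exp (\<i> * complex_of_real (g A)))"
proof -
  \<comment> \<open>On \<open>Sp\<close> this is \<open>polar_P A\<close>; written as a product, its
    continuity follows from that of \<open>polar_U\<close>.\<close>
  let ?P = "\<lambda>A :: real^('n + 'n)^('n + 'n). transpose (polar_U A) ** A"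
  have P: "?P A = polar_P A" if "A \<in> Sp" for A
  proof -
    have dA: "det A \<noteq> 0" by (rule Sp_det_nonzero[OF that])
    have "?P A = transpose (polar_U A) ** (polar_U A ** polar_P A)"
      by (simp add: polar_decomposition dA)
    then show ?thesis using orthogonal_polar_U[OF dA] by (simp add: matrix_mul_assoc orthogonal_matrix)
  qed
  have PP: "pos_def (?P A)" "?P A \<in> Sp" if "A \<in> Sp" for A
    using P[OF that] polar_P_Sp[OF that] polar_P(1)[OF Sp_det_nonzero[OF that]] by auto
  let ?H = "\<lambda>s A. polar_U A ** moebius s (?P A)"
  have HSp: "?H s A \<in> Sp" if "s \<in> {0..1}" "A \<in> Sp" for s A
    using Sp_mult[OF U_n_Sp[OF polar_U_U_n[OF that(2)]] moebius_Sp[OF PP[OF that(2)] that(1)]] .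
  have contU: "continuous_on ({0..1::real} \<times> Sp) (\<lambda>x. polar_U (snd x :: real^('n + 'n)^('n + 'n)))"
    by (rule continuous_on_compose2[OF continuous_on_polar_U]) (auto intro!: continuous_intros)
  have contH: "continuous_on ({0..1} \<times> Sp) (\<lambda>x. ?H (fst x) (snd x))"
    unfolding moebius_def moebius_num_def
  proof (intro continuous_intros contU)
    fix x :: "real \<times> (real^('n + 'n)^('n + 'n))" assume "x \<in> {0..1} \<times> Sp"
    then show "det ((1 + - fst x) *\<^sub>R ?P (snd x) + (1 - - fst x) *\<^sub>R mat 1) \<noteq> 0"
      using moebius_num_det[OF PP(1), of "snd x" "- fst x"] by (auto simp: moebius_num_def)
  qed
  have "continuous_on ({0..1} \<times> Sp) (\<lambda>x. f (?H (fst x) (snd x)))"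
    by (rule continuous_on_compose2[OF f(1) contH]) (use HSp in auto)
  then have "\<exists>g. continuous_on Sp g \<and> (\<forall>A\<in>Sp. f (?H 1 A) = exp (\<i> * complex_of_real (g A)))"
  proof (rule logarithm_of_homotopy)
    show "cmod (f (?H s A)) = 1" if "s \<in> {0..1}" "A \<in> Sp" for s A
      using f(2) HSp[OF that] by (auto simp: image_subset_iff)
    show "f (?H 0 A) = 1" if "A \<in> Sp" for A
      using one[OF polar_U_U_n[OF that]] by (simp add: moebius_0_1 PP that)
  qed
  moreover have "?H 1 A = A" if "A \<in> Sp" for A
    using polar_decomposition[OF Sp_det_nonzero[OF that]]
    by (simp add: P[OF that] moebius_0_1 polar_P(1) Sp_det_nonzero that)
  ultimately show ?thesis by (metis (no_types, lifting))
qed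

section \<open>The path psi2_minus\<close>

definition dg :: "('n \<Rightarrow> 'a) \<Rightarrow> 'a::zero^'n^'n::finite" where
  "dg f = (\<chi> k l. if k = l then f k else 0)"

lemma dg_nth [simp]: "dg f $ k $ l = (if k = l then f k else 0)"
  by (simp add: dg_def)

lemma dg_mult: "dg f ** dg g = dg (\<lambda>k. f k * g k)" for f g :: "'n::finite \<Rightarrow> 'a::semiring_1"
proof -
  have "(dg f ** dg g) $ k $ l = (\<Sum>j\<in>UNIV. if j = k then f k * (dg g $ k $ l) else 0)" for k l
    unfolding matrix_matrix_mult_def vec_lambda_beta by (intro sum.cong refl) auto
  then show ?thesis by (simp add: vec_eq_iff)
qed

lemma dg_add: "dg f + dg g = dg (\<lambda>k. f k + g k)" for f g :: "'n::finite \<Rightarrow> 'a::semiring_1"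
  by (simp add: vec_eq_iff)

lemma dg_one: "dg (\<lambda>_. 1) = mat 1" by (simp add: vec_eq_iff mat_def)

lemma dg_zero: "dg (\<lambda>_. 0) = 0" by (simp add: vec_eq_iff)

lemma transpose_dg: "transpose (dg f) = dg f" by (simp add: vec_eq_iff transpose_def)

lemma det_dg: "det (dg f) = (\<Prod>k\<in>UNIV. f k)" for f :: "'n::finite \<Rightarrow> 'a::comm_ring_1"
  by (subst det_diagonal) auto

lemma dg_mult_vec: "(dg f *v x) $ k = f k * x $ k" for f :: "'n::finite \<Rightarrow> 'a::semiring_1"
  by (simp add: matrix_vector_mult_def if_distrib if_distribR cong: if_cong)

lemma transpose_block: "transpose (block_matrix A B C D) = block_matrix (transpose A) (transpose C) (transpose B) (transpose D)"
  by (rule block_eqI) (simp_all add: transpose_def)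

text \<open>A direct sum of \<open>n\<close> matrices of size two, one on each coordinate symplectic
  plane, so that products and the symplectic condition are checked plane by plane.\<close>

definition dblock :: "('n \<Rightarrow> 'a) \<Rightarrow> ('n \<Rightarrow> 'a) \<Rightarrow> ('n \<Rightarrow> 'a) \<Rightarrow> ('n \<Rightarrow> 'a) \<Rightarrow> 'a::zero^('n::finite + 'n)^('n + 'n)" where
  "dblock f g h m = block_matrix (dg f) (dg g) (dg h) (dg m)"

lemma dblock_mult:
  "dblock f g h m ** dblock f' g' h' m' =
    dblock (\<lambda>k. f k * f' k + g k * h' k) (\<lambda>k. f k * g' k + g k * m' k)
      (\<lambda>k. h k * f' k + m k * h' k) (\<lambda>k. h k * g' k + m k * m' k)"
  for f g h m f' g' h' m' :: "'n::finite \<Rightarrow> 'a::semiring_1"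
  by (simp add: dblock_def block_matrix_mult dg_mult dg_add)

lemma dblock_one: "dblock (\<lambda>_. 1) (\<lambda>_. 0) (\<lambda>_. 0) (\<lambda>_. 1) = (mat 1 :: 'a::zero_neq_one^('n::finite + 'n)^('n + 'n))"
  by (simp only: dblock_def dg_one dg_zero mat_1_block)

lemma dblock_cong:
  assumes "\<And>k. f k = f' k" "\<And>k. g k = g' k" "\<And>k. h k = h' k" "\<And>k. m k = m' k"
  shows "dblock f g h m = dblock f' g' h' m'"
  using assms by (metis ext)

lemma transpose_dblock: "transpose (dblock f g h m) = dblock f h g m"
  by (simp add: dblock_def transpose_block transpose_dg)

lemma dblock_mult_vec:
  "(dblock f g h m *v x) $ Inl k = f k * x $ Inl k + g k * x $ Inr k"
  "(dblock f g h m *v x) $ Inr k = h k * x $ Inl k + m k * x $ Inr k"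
  for f g h m :: "'n::finite \<Rightarrow> 'a::semiring_1"
  by (simp_all add: dblock_def matrix_vector_mult_def sum_UNIV_sum if_distrib if_distribR cong: if_cong)

lemma dblock_Sp:
  assumes "\<And>k. f k * m k - g k * h k = 1"
  shows "dblock f g h m \<in> Sp"
proof -
  have "symp_form (dblock f g h m *v v) (dblock f g h m *v w) = symp_form v w" for v w
    unfolding symp_form_eq dblock_mult_vec
  proof (intro sum.cong refl)
    fix k
    have "(f k * v $ Inl k + g k * v $ Inr k) * (h k * w $ Inl k + m k * w $ Inr k) -
         (h k * v $ Inl k + m k * v $ Inr k) * (f k * w $ Inl k + g k * w $ Inr k)
       = (f k * m k - g k * h k) * (v $ Inl k * w $ Inr k - v $ Inr k * w $ Inl k)"
      by (simp add: algebra_simps)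
    then show "(f k * v $ Inl k + g k * v $ Inr k) * (h k * w $ Inl k + m k * w $ Inr k) -
         (h k * v $ Inl k + m k * v $ Inr k) * (f k * w $ Inl k + g k * w $ Inr k)
       = v $ Inl k * w $ Inr k - v $ Inr k * w $ Inl k"
      using assms[of k] by simp
  qed
  then show ?thesis by (simp add: Sp_def)
qed

lemma det_dblock_diag: "det (dblock f (\<lambda>_. 0) (\<lambda>_. 0) m) = (\<Prod>k\<in>UNIV. f k * m k)"
  for f m :: "'n::finite \<Rightarrow> 'a::comm_ring_1"
  by (simp add: dblock_def dg_zero det_block_lower det_dg prod.distrib)

text \<open>\<open>epath i0 a b\<close> is hyperbolic in the plane of index \<open>i0\<close> and a rotation in the other planes.\<close>

definition epath :: "'n::finite \<Rightarrow> real \<Rightarrow> real \<Rightarrow> real^('n + 'n)^('n + 'n)" where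
  "epath i0 a b = dblock (\<lambda>k. if k = i0 then exp a else cos b) (\<lambda>k. if k = i0 then 0 else - sin b)
     (\<lambda>k. if k = i0 then 0 else sin b) (\<lambda>k. if k = i0 then exp (- a) else cos b)"

lemma sums_vec_nth:
  fixes f :: "nat \<Rightarrow> 'a::real_normed_vector^'n::finite"
  assumes "\<And>i. (\<lambda>k. f k $ i) sums (L $ i)" shows "f sums L"
  unfolding sums_def
proof (rule vec_tendstoI)
  show "((\<lambda>n. (\<Sum>k<n. f k) $ i) \<longlongrightarrow> L $ i) sequentially" for i
    using assms[of i] by (simp add: sums_def sum_component)
qed

lemma matrix_exp_epath:
  fixes i0 :: "'n::finite"
  defines "X \<equiv> \<lambda>a b. dblock (\<lambda>k. if k = i0 then a else 0) (\<lambda>k. if k = i0 then 0 else - b)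
    (\<lambda>k. if k = i0 then 0 else b) (\<lambda>k. if k = i0 then - a else (0::real))"
  shows "matrix_exp (X a b) = epath i0 a b"
proof -
  \<comment> \<open>On a rotation plane the generator acts as multiplication by
    \<open>\<i> b\<close>, so its powers and the exponential series are read off from the complex
    number \<open>z\<close>.\<close>
  define z where "z = \<i> * complex_of_real b"
  let ?P = "\<lambda>j. dblock (\<lambda>k. if k = i0 then a ^ j else Re (z ^ j)) (\<lambda>k. if k = i0 then 0 else - Im (z ^ j))
    (\<lambda>k. if k = i0 then 0 else Im (z ^ j)) (\<lambda>k. if k = i0 then (- a) ^ j else Re (z ^ j))"
  have pow: "(((**) (X a b)) ^^ j) (mat 1) = ?P j" for j
  proof (induction j)
    case 0
    have "?P 0 = dblock (\<lambda>_. 1) (\<lambda>_. 0) (\<lambda>_. 0) (\<lambda>_. 1)" by (simp cong: if_cong)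
    then show ?case by (simp add: dblock_one)
  next
    case (Suc j)
    have "X a b ** ?P j = ?P (Suc j)"
      unfolding X_def dblock_mult
      by (rule dblock_cong) (auto simp: z_def)
    then show ?case using Suc by simp
  qed
  have ex: "(\<lambda>j. x ^ j / fact j) sums exp x" for x :: real
    using exp_converges[of x] by (simp add: divide_inverse mult.commute scaleR_conv_of_real)
  have "(\<lambda>j. z ^ j /\<^sub>R fact j) sums exp z" by (rule exp_converges)
  then have re: "(\<lambda>j. Re (z ^ j) / fact j) sums cos b" and im: "(\<lambda>j. Im (z ^ j) / fact j) sums sin b"
    using sums_Re[of _ "exp z"] sums_Im[of _ "exp z"]
    by (force simp: z_def Re_exp Im_exp divide_inverse mult.commute)+
  have "(\<lambda>j. (1 / fact j) *\<^sub>R (((**) (X a b)) ^^ j) (mat 1)) sums epath i0 a b"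
  proof (intro sums_vec_nth)
    fix r s :: "'n + 'n"
    show "(\<lambda>j. ((1 / fact j) *\<^sub>R (((**) (X a b)) ^^ j) (mat 1)) $ r $ s) sums (epath i0 a b $ r $ s)"
      unfolding pow epath_def dblock_def
      using ex[of a] ex[of "- a"] re im sums_minus[OF im]
      by (cases r; cases s) (auto simp: sums_0)
  qed
  then show ?thesis unfolding matrix_exp_def by (rule sums_unique[symmetric])
qed

text \<open>The entry \<open>- (ln 2 / pi)\<close> is scaled so that the factor \<open>pi\<close>
  cancels: the hyperbolic exponent reaches \<open>ln 2\<close> when the rotation angle reaches
  \<open>pi\<close>, which is the matrix \<open>W_minus\<close>.\<close>

lemma psi2_minus_epath: "psi2_minus i0 t = epath i0 (t * ln 2) (t * pi)"
proof -
  have "(t * pi) *\<^sub>R (J0 ** S2_minus i0) = dblock (\<lambda>k. if k = i0 then t * ln 2 else 0)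
     (\<lambda>k. if k = i0 then 0 else - (t * pi)) (\<lambda>k. if k = i0 then 0 else t * pi)
     (\<lambda>k. if k = i0 then - (t * ln 2) else 0)"
    by (rule block_eqI) (auto simp: S2_minus_def Let_def dblock_def)
  then show ?thesis by (simp add: psi2_minus_def matrix_exp_epath)
qed

lemma epath_Sp: "epath i0 a b \<in> Sp"
  unfolding epath_def
  by (rule dblock_Sp) (auto simp: exp_minus_inverse power2_eq_square[symmetric])

lemma W_minus_epath: "W_minus i0 = epath i0 (ln 2) pi"
  by (rule block_eqI) (auto simp: W_minus_def epath_def dblock_def exp_minus)

lemma epath_0: "epath i0 0 0 = mat 1"
proof -
  have "epath i0 0 0 = dblock (\<lambda>_. 1) (\<lambda>_. 0) (\<lambda>_. 0) (\<lambda>_. 1)" by (simp add: epath_def cong: if_cong)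
  then show ?thesis by (simp add: dblock_one)
qed

lemma continuous_on_dblock:
  fixes f g h m :: "'x::topological_space \<Rightarrow> 'n::finite \<Rightarrow> real"
  assumes "\<And>k. continuous_on S (\<lambda>t. f t k)" "\<And>k. continuous_on S (\<lambda>t. g t k)"
    "\<And>k. continuous_on S (\<lambda>t. h t k)" "\<And>k. continuous_on S (\<lambda>t. m t k)"
  shows "continuous_on S (\<lambda>t. dblock (f t) (g t) (h t) (m t))"
  unfolding dblock_def block_matrix_def
proof (intro continuous_on_vec_lambda)
  have const_if: "continuous_on S (\<lambda>x. if P then u x else 0)" if "continuous_on S u"
    for P and u :: "'x \<Rightarrow> real"
    using that by (cases P) auto
  fix r s :: "'n + 'n"
  show "continuous_on S (\<lambda>t. case r of
      Inl k \<Rightarrow> (case s of Inl l \<Rightarrow> dg (f t) $ k $ l | Inr l \<Rightarrow> dg (g t) $ k $ l)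
    | Inr k \<Rightarrow> (case s of Inl l \<Rightarrow> dg (h t) $ k $ l | Inr l \<Rightarrow> dg (m t) $ k $ l))"
    by (cases r; cases s) (auto intro!: const_if assms)
qed

lemma continuous_on_epath:
  fixes f g :: "real \<Rightarrow> real"
  assumes "continuous_on S f" "continuous_on S g"
  shows "continuous_on S (\<lambda>t. epath i0 (f t) (g t))"
  unfolding epath_def
proof (rule continuous_on_dblock)
  fix k
  show "continuous_on S (\<lambda>t. if k = i0 then exp (f t) else cos (g t))"
    "continuous_on S (\<lambda>t. if k = i0 then 0 else - sin (g t))"
    "continuous_on S (\<lambda>t. if k = i0 then 0 else sin (g t))"
    "continuous_on S (\<lambda>t. if k = i0 then exp (- f t) else cos (g t))"
    by (cases "k = i0"; simp; intro continuous_intros assms)+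
qed

lemma prod_one_exceptional:
  "(\<Prod>k\<in>(UNIV::'n::finite set). if k = i0 then x else y) = x * y ^ (CARD('n) - 1)" for x y :: "'a::comm_monoid_mult"
proof -
  have "(\<Prod>k\<in>(UNIV::'n set). if k = i0 then x else y) = x * (\<Prod>k\<in>UNIV - {i0}. if k = i0 then x else y)"
    by (subst prod.remove[of UNIV i0]) auto
  also have "(\<Prod>k\<in>UNIV - {i0}. if k = i0 then x else y) = (\<Prod>k\<in>UNIV - {i0}. y)"
    by (intro prod.cong) auto
  finally show ?thesis by (simp add: card_Diff_singleton)
qed

lemma rho_squared_epath:
  fixes i0 :: "'n::finite"
  shows "(rho (epath i0 a b))\<^sup>2 = exp (\<i> * complex_of_real (2 * b * real (CARD('n) - 1)))"
proof -
  let ?A = "epath i0 a b"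
  \<comment> \<open>In the hyperbolic plane the real axis of the expanding eigenvalue, for
    \<open>a > 0\<close>, is invariant and isotropic; there \<open>z = w\<close>, whence the entry
    \<open>1\<close>. In the rotation planes \<open>w = 0\<close> is invariant, whence
    \<open>0\<close>.\<close>
  let ?Z = "dg (\<lambda>k. if k = i0 then 1 else 0) :: complex^'n^'n"
  let ?M = "dg (\<lambda>k. if k = i0 then complex_of_real (exp a) else exp (\<i> * b)) :: complex^'n^'n"
  have Z: "?Z \<in> contractions"
  proof -
    have "norm (?Z *v x) \<le> norm x" for x :: "complex^'n"
      by (rule norm_le_componentwise_cart) (simp add: dg_mult_vec)
    then show ?thesis by (simp add: contractions_def)
  qed
  have cA: "complexify ?A = dblock (\<lambda>k. if k = i0 then of_real (exp a) else of_real (cos b)) (\<lambda>k. if k = i0 then 0 else - of_real (sin b))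
     (\<lambda>k. if k = i0 then 0 else of_real (sin b)) (\<lambda>k. if k = i0 then of_real (exp (- a)) else of_real (cos b))"
    by (rule block_eqI) (auto simp: epath_def dblock_def)
  have euler: "exp (\<i> * complex_of_real b) = of_real (cos b) + \<i> * of_real (sin b)"
    by (simp add: exp_Euler cos_of_real sin_of_real) 
  have zb: "zblock ?A ?Z *v x = ?M *v x" for x
  proof -
    have "(zpart *v (complexify ?A *v (emb ?Z *v x))) $ k = (?M *v x) $ k" for k
      unfolding cA zpart_mult dblock_mult_vec emb_mult dg_mult_vec euler by (auto simp: field_simps)
    then show ?thesis by (simp add: zblock_def matrix_vector_mul_assoc[symmetric] vec_eq_iff)
  qed
  have wb: "wblock ?A ?Z *v x = ?Z *v (?M *v x)" for x
  proof -
    have "(wpart *v (complexify ?A *v (emb ?Z *v x))) $ k = (?Z *v (?M *v x)) $ k" for k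
      unfolding cA wpart_mult dblock_mult_vec emb_mult dg_mult_vec euler by (auto simp: field_simps)
    then show ?thesis by (simp add: wblock_def matrix_vector_mul_assoc[symmetric] vec_eq_iff)
  qed
  have M: "zblock ?A ?Z = ?M" using zb by (simp add: matrix_eq)
  have "wblock ?A ?Z = ?Z ** zblock ?A ?Z"
    using wb by (simp add: matrix_eq M matrix_vector_mul_assoc[symmetric])
  then have "(rho ?A)\<^sup>2 = (sgn (det ?M))\<^sup>2"
    using rho_squared_zblock[OF epath_Sp Z] by (simp add: invariance_iff M)
  also have "sgn (det ?M) = exp (\<i> * b) ^ (CARD('n) - 1)"
    by (simp only: det_dg prod_one_exceptional sgn_mult sgn_power_complex) (simp add: sgn_eq)
  finally show ?thesis by (simp add: exp_of_nat_mult[symmetric] mult_ac)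
qed

text \<open>The complex linear part of the hyperbolic block is the positive number
  \<open>cosh a\<close>, so only the rotations affect the phase.\<close>

lemma rho_hat_epath:
  fixes i0 :: "'n::finite"
  shows "rho_hat (epath i0 a b) = exp (\<i> * complex_of_real (b * real (CARD('n) - 1)))"
proof -
  have "zblock (epath i0 a b) 0 = dg (\<lambda>k. if k = i0 then complex_of_real (cosh a) else exp (\<i> * b))"
    by (auto simp: vec_eq_iff zblock_zero_nth epath_def dblock_def complex_eq_iff cosh_def Re_exp Im_exp)
  moreover have "cosh a > 0" by (rule cosh_real_pos)
  ultimately have "rho_hat (epath i0 a b) = exp (\<i> * b) ^ (CARD('n) - 1)"
    unfolding rho_hat_zblock
    by (simp only: det_dg prod_one_exceptional sgn_mult sgn_power_complex) (simp add: sgn_eq)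
  then show ?thesis by (simp add: exp_of_nat_mult[symmetric] mult_ac)
qed

text \<open>Removing the rotation \<open>?U\<close> leaves a positive diagonal matrix, so by
  uniqueness \<open>?U\<close> is the orthogonal factor.\<close>

lemma det_C_polar_U_epath:
  fixes i0 :: "'n::finite"
  shows "det_C (polar_U (epath i0 a b)) = exp (\<i> * complex_of_real (b * real (CARD('n) - 1)))"
proof -
  let ?U = "epath i0 0 b"
  have U: "orthogonal_matrix ?U"
  proof -
    have "transpose ?U ** ?U = dblock (\<lambda>_. 1) (\<lambda>_. 0) (\<lambda>_. 0) (\<lambda>_. 1)"
      unfolding epath_def transpose_dblock dblock_mult
      by (rule dblock_cong) (auto simp: power2_eq_square[symmetric])
    then show ?thesis by (simp add: orthogonal_matrix dblock_one)
  qed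
  let ?P = "dblock (\<lambda>k. if k = i0 then exp a else 1) (\<lambda>_. 0) (\<lambda>_. 0) (\<lambda>k. if k = i0 then exp (- a) else 1)"
  have P: "transpose ?U ** epath i0 a b = ?P"
    unfolding epath_def transpose_dblock dblock_mult
    by (rule dblock_cong) (auto simp: power2_eq_square[symmetric])
  have "polar_U (epath i0 a b) = ?U"
  proof (rule polar_U_unique(1)[OF Sp_det_nonzero[OF epath_Sp] U])
    show "transpose (transpose ?U ** epath i0 a b) = transpose ?U ** epath i0 a b"
      unfolding P transpose_dblock ..
    show "0 \<le> x \<bullet> ((transpose ?U ** epath i0 a b) *v x)" for x
      unfolding P by (auto simp: inner_vec_def sum_UNIV_sum dblock_mult_vec mult.left_commute[of _ "exp a"]
          mult.left_commute[of _ "exp (- a)"] intro!: add_nonneg_nonneg sum_nonneg)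
  qed
  moreover have "?U \<in> U_n" using U epath_Sp by (auto simp: U_n_def)
  ultimately show ?thesis using rho_hat_U_n rho_hat_epath[of i0 0 b] by metis
qed

section \<open>Degrees of paths\<close>

abbreviation circ :: "real \<Rightarrow> complex" where
  "circ x \<equiv> exp (2 * pi * \<i> * x)"

lemma circ_add: "circ (x + y) = circ x * circ y"
  by (simp add: exp_add[symmetric] algebra_simps)

lemma circ_diff: "circ (x - y) = circ x / circ y"
  by (simp add: exp_diff[symmetric] algebra_simps)

lemma circ_eq_1_iff: "circ x = 1 \<longleftrightarrow> x \<in> \<int>"
proof -
  have "circ x = 1 \<longleftrightarrow> (\<exists>n::int. 2 * pi * x = of_int (2 * n) * pi)"
    by (simp add: exp_eq_1 mult_ac)
  also have "\<dots> \<longleftrightarrow> (\<exists>n::int. x = of_int n)" by auto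
  finally show ?thesis by (auto simp: Ints_def)
qed

text \<open>Two lifts differ by a continuous integer valued function, which is constant on an
  interval because distinct integers are at distance at least one.\<close>

lemma circ_lift_unique:
  fixes \<theta> \<theta>' :: "real \<Rightarrow> real"
  assumes "a \<le> b" "continuous_on {a..b} \<theta>" "continuous_on {a..b} \<theta>'"
    and eq: "\<And>t. t \<in> {a..b} \<Longrightarrow> circ (\<theta> t) = circ (\<theta>' t)"
  shows "\<theta> b - \<theta> a = \<theta>' b - \<theta>' a"
proof -
  have int: "\<theta> t - \<theta>' t \<in> \<int>" if "t \<in> {a..b}" for t
    unfolding circ_eq_1_iff[symmetric] circ_diff using eq[OF that] by simp
  have "(\<lambda>t. \<theta> t - \<theta>' t) constant_on {a..b}"
  proof (rule continuous_discrete_range_constant)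
    show "continuous_on {a..b} (\<lambda>t. \<theta> t - \<theta>' t)" by (intro continuous_intros assms)
    fix x assume x: "x \<in> {a..b}"
    have "1 \<le> norm ((\<theta> y - \<theta>' y) - (\<theta> x - \<theta>' x))"
      if y: "y \<in> {a..b}" "\<theta> y - \<theta>' y \<noteq> \<theta> x - \<theta>' x" for y
    proof -
      have "(\<theta> y - \<theta>' y) - (\<theta> x - \<theta>' x) \<in> \<int>" by (rule Ints_diff[OF int[OF y(1)] int[OF x]])
      then show ?thesis using y(2) Ints_nonzero_abs_ge1 by fastforce
    qed
    then show "\<exists>e>0. \<forall>y. y \<in> {a..b} \<and> \<theta> y - \<theta>' y \<noteq> \<theta> x - \<theta>' x \<longrightarrow> e \<le> norm (\<theta> y - \<theta>' y - (\<theta> x - \<theta>' x))"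
      by (intro exI[of _ 1]) auto
  qed simp
  then obtain c where "\<And>t. t \<in> {a..b} \<Longrightarrow> \<theta> t - \<theta>' t = c" unfolding constant_on_def by blast
  then have "\<theta> a - \<theta>' a = c" "\<theta> b - \<theta>' b = c" using assms(1) by auto
  then show ?thesis by linarith
qed

lemma circle_degree_eqI:
  fixes \<theta> :: "real \<Rightarrow> real"
  assumes "a \<le> b" "continuous_on {a..b} \<theta>" "\<And>t. t \<in> {a..b} \<Longrightarrow> f t = circ (\<theta> t)" "of_int d = \<theta> b - \<theta> a"
  shows "circle_degree a b f = d"
  unfolding circle_degree_def
proof (rule the_equality)
  show "\<exists>\<theta>::real \<Rightarrow> real. continuous_on {a..b} \<theta> \<and> (\<forall>t\<in>{a..b}. f t = circ (\<theta> t)) \<and> of_int d = \<theta> b - \<theta> a"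
    using assms by blast
  fix e assume "\<exists>\<theta>::real \<Rightarrow> real. continuous_on {a..b} \<theta> \<and> (\<forall>t\<in>{a..b}. f t = circ (\<theta> t)) \<and> of_int e = \<theta> b - \<theta> a"
  then obtain \<theta>' :: "real \<Rightarrow> real" where t: "continuous_on {a..b} \<theta>'" "\<forall>t\<in>{a..b}. f t = circ (\<theta>' t)" "of_int e = \<theta>' b - \<theta>' a"
    by blast
  have "\<theta> b - \<theta> a = \<theta>' b - \<theta>' a"
    using assms(3) t(2) by (intro circ_lift_unique assms(1,2) t(1)) auto
  then show "e = d" using assms(4) t(3) by linarith
qed

lemma circ_lift_exists:
  fixes f :: "real \<Rightarrow> complex"
  assumes "continuous_on {a..b} f" "\<And>t. t \<in> {a..b} \<Longrightarrow> cmod (f t) = 1"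
  shows "\<exists>\<theta>::real \<Rightarrow> real. continuous_on {a..b} \<theta> \<and> (\<forall>t\<in>{a..b}. f t = circ (\<theta> t))"
proof -
  obtain g where g: "continuous_on {a..b} g" "\<And>t. t \<in> {a..b} \<Longrightarrow> f t = exp (g t)"
  proof (rule continuous_logarithm_on_contractible[OF assms(1)])
    show "contractible {a..b}" by (simp add: convex_imp_contractible)
    show "f t \<noteq> 0" if "t \<in> {a..b}" for t using assms(2)[OF that] by auto
  qed blast
  have "f t = circ (Im (g t) / (2 * pi))" if "t \<in> {a..b}" for t
  proof -
    have "exp (Re (g t)) = 1" using assms(2)[OF that] g(2)[OF that] by simp
    then have "g t = \<i> * Im (g t)" by (simp add: complex_eq_iff)
    then show ?thesis using g(2)[OF that] by (simp add: field_simps)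
  qed
  moreover have "continuous_on {a..b} (\<lambda>t. Im (g t) / (2 * pi))"
    by (intro continuous_intros g) auto
  ultimately show ?thesis by blast
qed

lemma exp_circ: "exp (\<i> * complex_of_real x) = circ (x / (2 * pi))"
  by (simp add: field_simps)

lemma nonzero_same_sign:
  fixes f :: "real \<Rightarrow> real"
  assumes "continuous_on {a..b} f" "a \<le> b" "\<And>t. t \<in> {a..b} \<Longrightarrow> f t \<noteq> 0"
  shows "f a > 0 \<longleftrightarrow> f b > 0"
proof (rule ccontr)
  assume "\<not> ?thesis"
  then have "f a \<le> 0 \<and> 0 \<le> f b \<or> f b \<le> 0 \<and> 0 \<le> f a" by auto
  then have "\<exists>t\<ge>a. t \<le> b \<and> f t = 0"
    using IVT'[of f a 0 b] IVT2'[of f b 0 a] assms(1,2) by blast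
  then show False using assms(3) by auto
qed

section \<open>Independence of the map and of the extension\<close>

lemma det_W_plus: "det (W_plus - mat 1 :: real^('n::finite + 'n)^('n + 'n)) > 0"
proof -
  have "W_plus - mat 1 = (dblock (\<lambda>_. - 2) (\<lambda>_. 0) (\<lambda>_. 0) (\<lambda>_. - 2) :: real^('n + 'n)^('n + 'n))"
    by (rule block_eqI) (auto simp: W_plus_def dblock_def mat_def)
  then show ?thesis by (simp add: det_dblock_diag)
qed

lemma det_W_minus: "det (W_minus i0 - mat 1) < 0"
proof -
  have "W_minus i0 - mat 1 = dblock (\<lambda>k. if k = i0 then 1 else - 2) (\<lambda>_. 0) (\<lambda>_. 0) (\<lambda>k. if k = i0 then - (1/2) else - 2)"
    by (rule block_eqI) (auto simp: W_minus_def dblock_def mat_def)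
  then have "det (W_minus i0 - mat 1) = (\<Prod>k\<in>UNIV. if k = i0 then - (1/2) else 4)"
    by (simp only: det_dblock_diag) (intro prod.cong, auto)
  then show ?thesis unfolding prod_one_exceptional by simp
qed

lemma Sp_star_det: "A \<in> Sp_star \<Longrightarrow> det (A - mat 1) \<noteq> 0"
  using Sp_star_inj by (auto simp: det_nonzero_iff)

lemma CZ_extension_Sp_star:
  assumes "CZ_extension i0 \<psi> \<eta>" "s \<in> {1..2}" shows "\<eta> s \<in> Sp_star"
  using assms by (auto simp: CZ_extension_def Sp_star_def image_subset_iff)

text \<open>On \<open>[1, 2]\<close> the determinant of \<open>\<eta> t - 1\<close> does not vanish,
  so its sign is already fixed at time \<open>1\<close>; it is positive at \<open>W_plus\<close> and
  negative at \<open>W_minus\<close>.\<close>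

lemma CZ_extension_sign:
  assumes \<eta>: "CZ_extension i0 \<psi> \<eta>"
  shows "det (\<psi> 1 - mat 1) > 0 \<longleftrightarrow> \<eta> 2 = W_plus"
proof -
  have "continuous_on {1..2} \<eta>"
    using \<eta> by (auto simp: CZ_extension_def intro: continuous_on_subset)
  then have "continuous_on {1..2} (\<lambda>t. det (\<eta> t - mat 1))" by (intro continuous_intros)
  then have "det (\<eta> 1 - mat 1) > 0 \<longleftrightarrow> det (\<eta> 2 - mat 1) > 0"
    using CZ_extension_Sp_star[OF \<eta>] Sp_star_det by (intro nonzero_same_sign) auto
  moreover have "\<eta> 1 = \<psi> 1" "\<eta> 2 = W_plus \<or> \<eta> 2 = W_minus i0" using \<eta> by (auto simp: CZ_extension_def)
  ultimately show ?thesis using det_W_plus det_W_minus[of i0] by (metis order.asym)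
qed

lemma CZ_extension_endpoint:
  assumes "CZ_extension i0 \<psi> \<eta>" "CZ_extension i0 \<psi> \<eta>'" shows "\<eta> 2 = \<eta>' 2"
  using CZ_extension_sign[OF assms(1)] CZ_extension_sign[OF assms(2)] assms
  by (metis CZ_extension_def)

section \<open>Logarithms of quotients that are trivial on the unitary group\<close>

lemma mat_1_U_n: "mat 1 \<in> U_n"
  by (simp add: U_n_def orthogonal_matrix_id mat_1_Sp)

lemma rotation_U_n: "dblock (\<lambda>_. cos t) (\<lambda>_. - sin t) (\<lambda>_. sin t) (\<lambda>_. cos t) \<in> U_n"
proof -
  have "transpose (dblock (\<lambda>_::'a. cos t) (\<lambda>_. - sin t) (\<lambda>_. sin t) (\<lambda>_. cos t)) ** dblock (\<lambda>_. cos t) (\<lambda>_. - sin t) (\<lambda>_. sin t) (\<lambda>_. cos t)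
    = dblock (\<lambda>_. 1) (\<lambda>_. 0) (\<lambda>_. 0) (\<lambda>_. 1)"
    unfolding transpose_dblock dblock_mult by (rule dblock_cong) (auto simp: power2_eq_square[symmetric])
  moreover have "dblock (\<lambda>_::'a. cos t) (\<lambda>_. - sin t) (\<lambda>_. sin t) (\<lambda>_. cos t) \<in> Sp"
    by (rule dblock_Sp) (simp add: power2_eq_square[symmetric])
  ultimately show ?thesis by (simp add: U_n_def orthogonal_matrix dblock_one)
qed

lemma rotation_pi: "dblock (\<lambda>_. cos pi) (\<lambda>_. - sin pi) (\<lambda>_. sin pi) (\<lambda>_. cos pi) = W_plus"
  by (rule block_eqI) (auto simp: dblock_def W_plus_def mat_def)

lemma W_plus_U_n: "W_plus \<in> U_n"
  using rotation_U_n[of pi] by (simp only: rotation_pi)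

text \<open>A rotation path inside \<open>U_n\<close> joins the identity to \<open>W_plus\<close>.
  Along it \<open>g\<close> is continuous with values in the multiples of \<open>2 * pi\<close>,
  hence constant.\<close>

lemma log_W_plus:
  fixes g :: "real^('n::finite + 'n)^('n + 'n) \<Rightarrow> real"
  assumes g: "continuous_on Sp g" and one: "\<And>A. A \<in> U_n \<Longrightarrow> exp (\<i> * complex_of_real (g A)) = 1"
  shows "g W_plus = g (mat 1)"
proof -
  let ?r = "\<lambda>t. dblock (\<lambda>_. cos t) (\<lambda>_. - sin t) (\<lambda>_. sin t) (\<lambda>_. cos t) :: real^('n + 'n)^('n + 'n)"
  have "continuous_on {0..pi} ?r" by (intro continuous_on_dblock continuous_intros)
  then have "continuous_on {0..pi} (\<lambda>t. g (?r t))"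
    by (rule continuous_on_compose2[OF g]) (use rotation_U_n U_n_Sp in blast)
  then have cont: "continuous_on {0..pi} (\<lambda>t. g (?r t) / (2 * pi))" by (intro continuous_intros) auto
  have "circ (g (?r t) / (2 * pi)) = circ 0" for t
    using one[OF rotation_U_n, of t] unfolding exp_circ by simp
  then have "g (?r pi) / (2 * pi) - g (?r 0) / (2 * pi) = 0 - 0"
    by (intro circ_lift_unique[OF _ cont, of "\<lambda>_. 0"]) auto
  moreover have "?r 0 = mat 1" by (simp add: dblock_one)
  ultimately show ?thesis unfolding rotation_pi by simp
qed

lemma rho_squared_W:
  "(rho (mat 1 :: real^('n::finite + 'n)^('n + 'n)))\<^sup>2 = 1"
  "(rho (W_plus :: real^('n::finite + 'n)^('n + 'n)))\<^sup>2 = 1"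
  "(rho (W_minus i0))\<^sup>2 = 1"
proof -
  \<comment> \<open>Any index may be inserted, since \<open>epath i0 0 0 = mat 1\<close> for every
    \<open>i0\<close>.\<close>
  show one: "(rho (mat 1 :: real^('n + 'n)^('n + 'n)))\<^sup>2 = 1"
    using rho_squared_epath[of "undefined :: 'n" 0 0] by (simp add: epath_0)
  have "det_C (W_plus :: real^('n + 'n)^('n + 'n)) = det (dg (\<lambda>_. - 1) :: complex^'n^'n)"
    unfolding det_C_def
    by (rule arg_cong[where f = det]) (simp add: vec_eq_iff W_plus_def mat_def complex_eq_iff)
  then have "(det_C (W_plus :: real^('n + 'n)^('n + 'n)))\<^sup>2 = 1"
    by (cases "even CARD('n)") (auto simp: det_dg)
  then show "(rho (W_plus :: real^('n + 'n)^('n + 'n)))\<^sup>2 = 1"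
    by (simp add: rho_squared_U_n[OF W_plus_U_n])
  show "(rho (W_minus i0))\<^sup>2 = 1"
    unfolding W_minus_epath rho_squared_epath exp_circ circ_eq_1_iff by simp
qed

text \<open>Along a path the lifts of \<open>f\<close> and \<open>h\<close> differ by
  \<open>g\<close>, so the increment of \<open>g\<close> measures the discrepancy of the degrees.
  The equality at \<open>W_plus\<close> settles one of the two possible end points.\<close>

lemma logarithm_of_quotient:
  fixes f h :: "real^('n::finite + 'n)^('n + 'n) \<Rightarrow> complex"
  assumes "continuous_on Sp f" "continuous_on Sp h"
    and "\<And>A. A \<in> Sp \<Longrightarrow> cmod (f A) = 1" "\<And>A. A \<in> Sp \<Longrightarrow> cmod (h A) = 1"
    and U: "\<And>A. A \<in> U_n \<Longrightarrow> f A = h A"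
  shows "\<exists>g. continuous_on Sp g \<and> g W_plus = g (mat 1) \<and> (\<forall>A\<in>Sp. f A = h A * circ (g A))"
proof -
  have nz: "h A \<noteq> 0" if "A \<in> Sp" for A using assms(4)[OF that] by auto
  have "\<exists>g. continuous_on Sp g \<and> (\<forall>A\<in>Sp. f A / h A = exp (\<i> * complex_of_real (g A)))"
  proof (rule logarithm_trivial_on_U_n)
    show "continuous_on Sp (\<lambda>A. f A / h A)" using nz by (intro continuous_intros assms) auto
    show "(\<lambda>A. f A / h A) ` Sp \<subseteq> sphere 0 1" using assms(3,4) by (auto simp: norm_divide)
    show "f A / h A = 1" if "A \<in> U_n" for A using U[OF that] nz[OF U_n_Sp[OF that]] by simp
  qed
  then obtain g where g: "continuous_on Sp g" "\<And>A. A \<in> Sp \<Longrightarrow> f A / h A = exp (\<i> * complex_of_real (g A))"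
    by blast
  have "g W_plus = g (mat 1)"
  proof (rule log_W_plus[OF g(1)])
    show "exp (\<i> * complex_of_real (g A)) = 1" if "A \<in> U_n" for A
      using g(2)[OF U_n_Sp[OF that]] U[OF that] nz[OF U_n_Sp[OF that]] by simp
  qed
  moreover have "f A = h A * circ (g A / (2 * pi))" if "A \<in> Sp" for A
    using g(2)[OF that] nz[OF that] unfolding exp_circ by (simp add: divide_eq_eq mult.commute)
  moreover have "continuous_on Sp (\<lambda>A. g A / (2 * pi))" by (intro continuous_intros g) auto
  ultimately show ?thesis by (intro exI[of _ "\<lambda>A. g A / (2 * pi)"]) auto
qed

lemma rho_squared_norm: "A \<in> Sp \<Longrightarrow> cmod ((rho A)\<^sup>2) = 1"
  using rho_squared_sphere[of A] by simp

lemma rho_hat_squared_norm: "A \<in> Sp \<Longrightarrow> cmod ((rho_hat A)\<^sup>2) = 1"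
  using rho_hat_sphere[of A] by (simp add: norm_power)

text \<open>Two extensions agree on \<open>[0, 1]\<close>; on \<open>[1, 2]\<close> they have the same end points and stay in
  \<open>Sp_star\<close>, where the square of \<open>rho_hat\<close> has a logarithm.\<close>

lemma rho_lift_increment:
  fixes i0 :: "'n::finite"
  assumes \<eta>: "CZ_extension i0 \<psi> \<eta>" and \<eta>': "CZ_extension i0 \<psi> \<eta>'"
    and \<theta>: "continuous_on {0..2} \<theta>" "\<And>t. t \<in> {0..2} \<Longrightarrow> (rho (\<eta> t))\<^sup>2 = circ (\<theta> t)"
    and \<theta>': "continuous_on {0..2} \<theta>'" "\<And>t. t \<in> {0..2} \<Longrightarrow> (rho (\<eta>' t))\<^sup>2 = circ (\<theta>' t)"
  shows "\<theta> 2 - \<theta> 0 = \<theta>' 2 - \<theta>' 0"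
proof -
  obtain g where g: "continuous_on Sp g"
    "\<And>A :: real^('n + 'n)^('n + 'n). A \<in> Sp \<Longrightarrow> (rho A)\<^sup>2 = (rho_hat A)\<^sup>2 * circ (g A)"
  proof -
    have "(rho A)\<^sup>2 = (rho_hat A)\<^sup>2" if "A \<in> U_n" for A :: "real^('n + 'n)^('n + 'n)"
      using that by (simp add: rho_squared_U_n rho_hat_U_n)
    then have "\<exists>g. continuous_on Sp g \<and> g W_plus = g (mat 1) \<and>
        (\<forall>A\<in>Sp :: (real^('n + 'n)^('n + 'n)) set. (rho A)\<^sup>2 = (rho_hat A)\<^sup>2 * circ (g A))"
      by (intro logarithm_of_quotient continuous_on_rho_squared continuous_on_power
          continuous_on_rho_hat rho_squared_norm rho_hat_squared_norm)
    then show thesis using that by blast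
  qed
  obtain k where k: "continuous_on Sp_star k"
    "\<And>A :: real^('n + 'n)^('n + 'n). A \<in> Sp_star \<Longrightarrow> (rho_hat A)\<^sup>2 = exp (\<i> * complex_of_real (k A))"
    using rho_hat_log_Sp_star by blast
  have Sps: "Sp_star \<subseteq> Sp" by (auto simp: Sp_star_def)
  \<comment> \<open>A lift of the square of \<open>rho\<close> on all of \<open>Sp_star\<close>.
    Hence over \<open>[1, 2]\<close> the increment of any lift along an extension depends only on
    the end points.\<close>
  let ?l = "\<lambda>A. k A / (2 * pi) + g A"
  have l: "continuous_on Sp_star ?l" "\<And>A. A \<in> Sp_star \<Longrightarrow> (rho A)\<^sup>2 = circ (?l A)"
  proof -
    show "continuous_on Sp_star ?l" by (intro continuous_intros k continuous_on_subset[OF g(1) Sps]) auto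
    show "(rho A)\<^sup>2 = circ (?l A)" if "A \<in> Sp_star" for A
      using g(2)[of A] k(2)[OF that] that Sps unfolding circ_add exp_circ by auto
  qed
  have inc: "\<phi> 2 - \<phi> 1 = ?l (\<omega> 2) - ?l (\<omega> 1)"
    if \<omega>: "CZ_extension i0 \<psi> \<omega>" and \<phi>: "continuous_on {0..2} \<phi>" "\<And>t. t \<in> {0..2} \<Longrightarrow> (rho (\<omega> t))\<^sup>2 = circ (\<phi> t)" for \<omega> \<phi>
  proof (rule circ_lift_unique)
    show "continuous_on {1..2} \<phi>" using \<phi>(1) by (rule continuous_on_subset) auto
    have "continuous_on {1..2} \<omega>" using \<omega> by (auto simp: CZ_extension_def intro: continuous_on_subset)
    then show "continuous_on {1..2} (\<lambda>t. ?l (\<omega> t))"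
      by (rule continuous_on_compose2[OF l(1)]) (use CZ_extension_Sp_star[OF \<omega>] in auto)
    show "circ (\<phi> t) = circ (?l (\<omega> t))" if "t \<in> {1..2}" for t
      using l(2)[OF CZ_extension_Sp_star[OF \<omega> that]] \<phi>(2)[of t] that by simp
  qed simp
  have eq: "\<eta> t = \<eta>' t" if "t \<in> {0..1}" for t using \<eta> \<eta>' that by (simp add: CZ_extension_def)
  have "\<theta> 1 - \<theta> 0 = \<theta>' 1 - \<theta>' 0"
  proof (rule circ_lift_unique)
    show "circ (\<theta> t) = circ (\<theta>' t)" if "t \<in> {0..1}" for t
      using \<theta>(2)[of t] \<theta>'(2)[of t] that eq[OF that] by simp
  qed (use \<theta>(1) \<theta>'(1) in \<open>auto intro: continuous_on_subset\<close>)
  moreover have "\<theta> 2 - \<theta> 1 = \<theta>' 2 - \<theta>' 1"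
    using inc[OF \<eta> \<theta>] inc[OF \<eta>' \<theta>'] CZ_extension_endpoint[OF \<eta> \<eta>'] eq[of 1] by simp
  ultimately show ?thesis by linarith
qed

text \<open>This exchanges the extension selected by \<open>SOME\<close> in \<open>mu_CZ\<close> for
  the given one. The increment is an integer because the square of \<open>rho\<close> is
  \<open>1\<close> at the identity, \<open>W_plus\<close> and \<open>W_minus\<close>.\<close>

lemma rho_lift:
  fixes i0 :: "'n::finite"
  assumes \<psi>: "CZ_path \<psi>" and \<eta>: "CZ_extension i0 \<psi> \<eta>"
  obtains \<theta> where "continuous_on {0..2} \<theta>" "\<And>t. t \<in> {0..2} \<Longrightarrow> (rho (\<eta> t))\<^sup>2 = circ (\<theta> t)"
    "of_int (mu_CZ i0 \<psi>) = \<theta> 2 - \<theta> 0"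
proof -
  have lift: "\<exists>\<theta>. continuous_on {0..2} \<theta> \<and> (\<forall>t\<in>{0..2}. (rho (\<omega> t))\<^sup>2 = circ (\<theta> t))"
    if \<omega>: "CZ_extension i0 \<psi> \<omega>" for \<omega>
  proof (rule circ_lift_exists)
    have S: "continuous_on {0..2} \<omega>" "\<omega> ` {0..2} \<subseteq> Sp" using \<omega> by (auto simp: CZ_extension_def)
    show "continuous_on {0..2} (\<lambda>t. (rho (\<omega> t))\<^sup>2)"
      by (rule continuous_on_compose2[OF continuous_on_rho_squared S])
    show "cmod ((rho (\<omega> t))\<^sup>2) = 1" if "t \<in> {0..2}" for t using rho_squared_norm S(2) that by blast
  qed
  define \<omega> where "\<omega> = (SOME \<psi>'. CZ_extension i0 \<psi> \<psi>')"
  have \<omega>: "CZ_extension i0 \<psi> \<omega>" unfolding \<omega>_def by (rule someI[where P = "CZ_extension i0 \<psi>", OF \<eta>])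
  obtain \<theta> where \<theta>: "continuous_on {0..2} \<theta>" "\<And>t. t \<in> {0..2} \<Longrightarrow> (rho (\<eta> t))\<^sup>2 = circ (\<theta> t)"
    using lift[OF \<eta>] by blast
  obtain \<phi> where \<phi>: "continuous_on {0..2} \<phi>" "\<And>t. t \<in> {0..2} \<Longrightarrow> (rho (\<omega> t))\<^sup>2 = circ (\<phi> t)"
    using lift[OF \<omega>] by blast
  have ends: "\<omega> 0 = mat 1" "\<omega> 2 = W_plus \<or> \<omega> 2 = W_minus i0"
    using \<psi> \<omega> by (auto simp: CZ_path_def CZ_extension_def)
  have "circ (\<phi> 2 - \<phi> 0) = 1"
    using \<phi>(2)[of 2] \<phi>(2)[of 0] ends unfolding circ_diff by (auto simp: rho_squared_W)
  then obtain d where d: "\<phi> 2 - \<phi> 0 = of_int d" unfolding circ_eq_1_iff by (auto elim: Ints_cases)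
  have "mu_CZ i0 \<psi> = d"
    unfolding mu_CZ_def \<omega>_def[symmetric] by (rule circle_degree_eqI[OF _ \<phi>]) (auto simp: d)
  moreover have "\<theta> 2 - \<theta> 0 = \<phi> 2 - \<phi> 0" by (rule rho_lift_increment[OF \<eta> \<omega> \<theta> \<phi>])
  ultimately show thesis using that \<theta> d by simp
qed

text \<open>The sum of a lift for \<open>rho\<close> and \<open>g\<close> along the extension lifts
  the square of \<open>\<rho>'\<close>, so the claim is that \<open>g\<close> has the same value at
  both ends. For \<open>W_plus\<close> this is known; for \<open>W_minus\<close> the conditions on
  \<open>\<rho>'\<close> are used.\<close>

lemma mu_CZ_eq_degree:
  fixes i0 :: "'n::finite" and \<rho>' :: "real^('n + 'n)^('n + 'n) \<Rightarrow> complex"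
  assumes \<psi>: "CZ_path \<psi>" and \<eta>: "CZ_extension i0 \<psi> \<eta>"
    and cont: "continuous_on Sp \<rho>'" and sph: "\<rho>' ` Sp \<subseteq> sphere 0 1"
    and U: "\<And>A. A \<in> U_n \<Longrightarrow> \<rho>' A = det_C A" and W: "\<rho>' (W_minus i0) \<in> {1, -1}"
    and deg: "circle_degree 0 1 (\<lambda>t. (\<rho>' (psi2_minus i0 t))\<^sup>2) = int CARD('n) - 1"
  shows "mu_CZ i0 \<psi> = circle_degree 0 2 (\<lambda>t. (\<rho>' (\<eta> t))\<^sup>2)"
proof -
  have nrm: "cmod ((\<rho>' A)\<^sup>2) = 1" if "A \<in> Sp" for A
    using sph that by (auto simp: norm_power image_subset_iff)
  obtain g where g: "continuous_on Sp g" "g W_plus = g (mat 1)"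
    "\<And>A. A \<in> Sp \<Longrightarrow> (\<rho>' A)\<^sup>2 = (rho A)\<^sup>2 * circ (g A)"
  proof -
    have "(\<rho>' A)\<^sup>2 = (rho A)\<^sup>2" if "A \<in> U_n" for A
      using that by (simp add: rho_squared_U_n U)
    then have "\<exists>g. continuous_on Sp g \<and> g W_plus = g (mat 1) \<and>
        (\<forall>A\<in>Sp. (\<rho>' A)\<^sup>2 = (rho A)\<^sup>2 * circ (g A))"
      by (intro logarithm_of_quotient continuous_on_rho_squared continuous_on_power
          cont rho_squared_norm nrm)
    then show thesis using that by blast
  qed
  have gW: "g (W_minus i0) = g (mat 1)"
  proof -
    let ?n = "real (CARD('n) - 1)"
    let ?e = "\<lambda>t. epath i0 (t * ln 2) (t * pi)"
    \<comment> \<open>The term \<open>t * ?n\<close> lifts the square of \<open>rho\<close> along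
      the path and has increment \<open>n - 1\<close>, so prescribing that degree for
      \<open>\<rho>'\<close> forces the increment of \<open>g\<close> to vanish.\<close>
    let ?\<phi> = "\<lambda>t. t * ?n + g (?e t)"
    have e: "?e 0 = mat 1" "?e 1 = W_minus i0" by (simp_all add: epath_0 W_minus_epath)
    have lift: "(\<rho>' (psi2_minus i0 t))\<^sup>2 = circ (?\<phi> t)" for t
    proof -
      have "(rho (?e t))\<^sup>2 = circ (t * ?n)"
        unfolding rho_squared_epath by (simp add: algebra_simps)
      then show ?thesis using g(3)[OF epath_Sp] unfolding psi2_minus_epath circ_add by simp
    qed
    have "continuous_on {0..1} ?\<phi>"
    proof (intro continuous_intros)
      show "continuous_on {0..1} (\<lambda>t. g (?e t))"
        by (rule continuous_on_compose2[OF g(1)])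
          (auto intro!: continuous_on_epath continuous_intros epath_Sp)
    qed
    \<comment> \<open>The value of \<open>\<rho>'\<close> at \<open>W_minus\<close> being a sign
      makes the increment an integer, so that a degree exists and the definite description in
      \<open>circle_degree\<close> has a value.\<close>
    moreover have "circ (?\<phi> 1 - ?\<phi> 0) = 1"
    proof -
      have "(\<rho>' (mat 1))\<^sup>2 = (rho (mat 1 :: real^('n + 'n)^('n + 'n)))\<^sup>2" by (simp add: U mat_1_U_n rho_squared_U_n)
      then have "(\<rho>' (psi2_minus i0 0))\<^sup>2 = 1" by (simp add: psi2_minus_epath epath_0 rho_squared_W)
      moreover have "(\<rho>' (psi2_minus i0 1))\<^sup>2 = 1" using W by (auto simp: psi2_minus_epath W_minus_epath)
      ultimately show ?thesis unfolding circ_diff lift by simp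
    qed
    then obtain d where d: "?\<phi> 1 - ?\<phi> 0 = of_int d" unfolding circ_eq_1_iff by (auto elim: Ints_cases)
    ultimately have "circle_degree 0 1 (\<lambda>t. (\<rho>' (psi2_minus i0 t))\<^sup>2) = d"
      using lift by (intro circle_degree_eqI[where \<theta> = ?\<phi>]) auto
    \<comment> \<open>The natural number difference in \<open>?n\<close> is harmless, as
      \<open>CARD('n)\<close> is at least one.\<close>
    then have "of_int d = ?n" using deg by (simp add: of_nat_diff Suc_leI)
    then show ?thesis using d e by simp
  qed
  obtain \<theta> where \<theta>: "continuous_on {0..2} \<theta>" "\<And>t. t \<in> {0..2} \<Longrightarrow> (rho (\<eta> t))\<^sup>2 = circ (\<theta> t)"
    "of_int (mu_CZ i0 \<psi>) = \<theta> 2 - \<theta> 0"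
    using rho_lift[OF \<psi> \<eta>] by blast
  have S: "continuous_on {0..2} \<eta>" "\<eta> ` {0..2} \<subseteq> Sp" and ends: "\<eta> 0 = mat 1" "\<eta> 2 = W_plus \<or> \<eta> 2 = W_minus i0"
    using \<psi> \<eta> by (auto simp: CZ_extension_def CZ_path_def)
  have "circle_degree 0 2 (\<lambda>t. (\<rho>' (\<eta> t))\<^sup>2) = mu_CZ i0 \<psi>"
  proof (rule circle_degree_eqI[where \<theta> = "\<lambda>t. \<theta> t + g (\<eta> t)"])
    show "continuous_on {0..2} (\<lambda>t. \<theta> t + g (\<eta> t))"
      by (intro continuous_intros \<theta>(1) continuous_on_compose2[OF g(1) S])
    show "(\<rho>' (\<eta> t))\<^sup>2 = circ (\<theta> t + g (\<eta> t))" if "t \<in> {0..2}" for t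
    proof -
      have "\<eta> t \<in> Sp" using S(2) that by blast
      then show ?thesis using g(3)[of "\<eta> t"] \<theta>(2)[OF that] unfolding circ_add by simp
    qed
    show "of_int (mu_CZ i0 \<psi>) = \<theta> 2 + g (\<eta> 2) - (\<theta> 0 + g (\<eta> 0))"
      using ends gW g(2) \<theta>(3) by auto
  qed simp
  then show ?thesis by simp
qed

text \<open>Both concrete maps take the same values on \<open>epath\<close>. This one formula yields
  the sign at \<open>W_minus\<close> and the degree along \<open>psi2_minus\<close>.\<close>

lemma mu_CZ_eq_degree_explicit:
  fixes i0 :: "'n::finite" and \<rho>' :: "real^('n + 'n)^('n + 'n) \<Rightarrow> complex"
  assumes \<psi>: "CZ_path \<psi>" and \<eta>: "CZ_extension i0 \<psi> \<eta>"
    and cont: "continuous_on Sp \<rho>'" and sph: "\<rho>' ` Sp \<subseteq> sphere 0 1"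
    and U: "\<And>A. A \<in> U_n \<Longrightarrow> \<rho>' A = det_C A"
    and e: "\<And>a b. \<rho>' (epath i0 a b) = exp (\<i> * complex_of_real (b * real (CARD('n) - 1)))"
  shows "mu_CZ i0 \<psi> = circle_degree 0 2 (\<lambda>t. (\<rho>' (\<eta> t))\<^sup>2)"
proof (rule mu_CZ_eq_degree[OF \<psi> \<eta> cont sph U])
  define m where "m = CARD('n) - 1"
  have "\<rho>' (W_minus i0) = exp (of_nat m * (\<i> * pi))"
    unfolding W_minus_epath e m_def[symmetric] by (simp add: mult_ac)
  also have "\<dots> = (- 1) ^ m" by (simp only: exp_of_nat_mult) simp
  finally show "\<rho>' (W_minus i0) \<in> {1, - 1}" by (cases "even m") auto
  show "circle_degree 0 1 (\<lambda>t. (\<rho>' (psi2_minus i0 t))\<^sup>2) = int CARD('n) - 1"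
  proof (rule circle_degree_eqI[where \<theta> = "\<lambda>t. t * real (CARD('n) - 1)"])
    show "(\<rho>' (psi2_minus i0 t))\<^sup>2 = circ (t * real (CARD('n) - 1))" for t
      unfolding psi2_minus_epath e by (simp add: exp_double[symmetric] algebra_simps)
    show "of_int (int CARD('n) - 1) = 1 * real (CARD('n) - 1) - 0 * real (CARD('n) - 1)"
      by (simp add: of_nat_diff Suc_leI)
  qed (auto intro!: continuous_intros)
qed

lemma continuous_on_det_C: "continuous_on UNIV det_C"
  unfolding det_C_def Complex_eq by (intro continuous_intros)

text \<open>The polar factor is a definite description and \<open>rho_hat\<close> divides by a
  modulus. The conclusion therefore also asserts that the factor exists uniquely and that the maps
  take values in \<open>U_n\<close> and in the circle.\<close>

theorem theorem1:
  fixes i0 :: "'n::finite"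
    and \<psi> \<psi>' :: "real \<Rightarrow> real^('n + 'n)^('n + 'n)"
  assumes "CZ_path \<psi>"
    and "CZ_extension i0 \<psi> \<psi>'"
  shows
    "(\<forall>\<rho>' :: real^('n + 'n)^('n + 'n) \<Rightarrow> complex.
        continuous_on Sp \<rho>' \<and> \<rho>' ` Sp \<subseteq> sphere 0 1 \<and>
        (\<forall>A\<in>U_n. \<rho>' A = det_C A) \<and>
        \<rho>' (W_minus i0) \<in> {1, -1} \<and>
        circle_degree 0 1 (\<lambda>t. (\<rho>' (psi2_minus i0 t))\<^sup>2) = int CARD('n) - 1
        \<longrightarrow> mu_CZ i0 \<psi> = circle_degree 0 2 (\<lambda>t. (\<rho>' (\<psi>' t))\<^sup>2))
     \<and> ((\<forall>A\<in>Sp :: (real^('n + 'n)^('n + 'n)) set. \<exists>!P. is_polar_factor A P) \<and>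
        polar_U ` (Sp :: (real^('n + 'n)^('n + 'n)) set) \<subseteq> U_n \<and>
        mu_CZ i0 \<psi> = circle_degree 0 2 (\<lambda>t. (det_C (polar_U (\<psi>' t)))\<^sup>2))
     \<and> (rho_hat ` (Sp :: (real^('n + 'n)^('n + 'n)) set) \<subseteq> sphere 0 1 \<and>
        mu_CZ i0 \<psi> = circle_degree 0 2 (\<lambda>t. (rho_hat (\<psi>' t))\<^sup>2))"
proof (intro conjI allI impI ballI)
  show "mu_CZ i0 \<psi> = circle_degree 0 2 (\<lambda>t. (\<rho>' (\<psi>' t))\<^sup>2)"
    if "continuous_on Sp \<rho>' \<and> \<rho>' ` Sp \<subseteq> sphere 0 1 \<and>
        (\<forall>A\<in>U_n. \<rho>' A = det_C A) \<and> \<rho>' (W_minus i0) \<in> {1, -1} \<and>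
        circle_degree 0 1 (\<lambda>t. (\<rho>' (psi2_minus i0 t))\<^sup>2) = int CARD('n) - 1" for \<rho>'
    using that by (intro mu_CZ_eq_degree[OF assms]) auto
  show "\<exists>!P. is_polar_factor A P" if "A \<in> Sp" for A :: "real^('n + 'n)^('n + 'n)"
    by (rule polar_factor_unique_exists[OF Sp_det_nonzero[OF that]])
  show "polar_U ` (Sp :: (real^('n + 'n)^('n + 'n)) set) \<subseteq> U_n" using polar_U_U_n by blast
  show "mu_CZ i0 \<psi> = circle_degree 0 2 (\<lambda>t. (det_C (polar_U (\<psi>' t)))\<^sup>2)"
  proof (rule mu_CZ_eq_degree_explicit[OF assms, where \<rho>' = "\<lambda>A. det_C (polar_U A)"])
    show "continuous_on Sp (\<lambda>A :: real^('n + 'n)^('n + 'n). det_C (polar_U A))"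
      by (rule continuous_on_compose2[OF continuous_on_det_C continuous_on_polar_U]) auto
  qed (auto simp: cmod_det_C polar_U_U_n polar_U_of_U_n det_C_polar_U_epath)
  show "rho_hat ` (Sp :: (real^('n + 'n)^('n + 'n)) set) \<subseteq> sphere 0 1" using rho_hat_sphere by blast
  then show "mu_CZ i0 \<psi> = circle_degree 0 2 (\<lambda>t. (rho_hat (\<psi>' t))\<^sup>2)"
    by (intro mu_CZ_eq_degree_explicit[OF assms continuous_on_rho_hat]) (auto simp: rho_hat_U_n rho_hat_epath)
qed

end
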